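(* Let $\widetilde\Gamma\to\Gamma$ be a double cover of tropical curves, let $q\in\widetilde\Gamma$ be a basepoint, and let $g_0=\dim\mathrm{Prym}_c(\widetilde\Gamma/\Gamma)=g(\widetilde\Gamma)-g(\Gamma)$. Then for all $1\le d\le g_0$ the following equality holds in $H_{d,d}(\mathrm{Prym}_c(\widetilde\Gamma/\Gamma))$ (with rational coefficients): $$\frac{\Psi^d_{q,*}\,\mathrm{cyc}[\widetilde\Gamma^d]}{d!}=\frac{2^d}{(g_0-d)!}\,[\zeta_c]^{g_0-d},$$ where $[\zeta_c]\in H_{g_0-1,g_0-1}(\mathrm{Prym}_c(\widetilde\Gamma/\Gamma))$ is the class of the principal polarization $\zeta_c$ of $\mathrm{Prym}_c(\widetilde\Gamma/\Gamma)$ and $\Psi^d_q:\widetilde\Gamma^d\to\mathrm{Prym}_c(\widetilde\Gamma/\Gamma)$ is the $d$-fold tropical Abel--Prym map with respect to the basepoint $q$.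
   Context: Real tori. For a lattice $M$ write $M_{\mathbb R}=M\otimes_{\mathbb Z}\mathbb R$, $M^*=\mathrm{Hom}(M,\mathbb Z)$. A real torus with integral structure is $T=N_{\mathbb R}/\Lambda$ with $N$ a lattice of rank $n$ and $\Lambda\subset N_{\mathbb R}$ a lattice of full rank; equivalently it is given by lattices $(M,\Lambda)$, $M=N^*$, and a perfect-over-$\mathbb R$ pairing $\Lambda\times M\to\mathbb R$, via $N=M^*$. Tropical (co)homology: $H^{p,q}(T)=\bigwedge^q\Lambda^*\otimes\bigwedge^pN^*$, $H_{p,q}(T)=\bigwedge^q\Lambda\otimes\bigwedge^pN$, with componentwise wedge product as cup product. Poincaré duality $H^{p,q}(T)\cong H_{n-p,n-q}(T)$ is cap product (componentwise interior product) with $\mathrm{cyc}[T]=(\lambda_1\wedge\dots\wedge\lambda_n)\otimes(\eta_1\wedge\dots\wedge\eta_n)$, for bases of $\Lambda$ and $N$ inducing the same orientation of $N_{\mathbb R}$. A polarization is a positive-definite symmetric form $E$ on $N_{\mathbb R}$ with $E(\Lambda\times N)\subseteq\mathbb Z$, viewed as $E\in\Lambda^*\otimes N^*=H^{1,1}(T)$; equivalently an injection $\rho_E:\Lambda\to N^*$, $\lambda\mapsto E(\lambda,-)$; it is principal if $\rho_E$ is an isomorphism. Its class $[E]\in H_{n-1,n-1}(T)$ is the Poincaré dual of $E$, and $[E]^{k}\in H_{n-k,n-k}(T)$ (tropical intersection power) is the Poincaré dual of $E^{\wedge k}$. Curves. A tropical curve is a compact connected metric graph $\Gamma$, with genus $g(\Gamma)$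 its first Betti number, regarded as a rational polyhedral space whose integral affine functions are the continuous piecewise linear functions with integer slopes that are harmonic (sum of outgoing slopes zero at each point). A double cover $\pi:\widetilde\Gamma\to\Gamma$ is a harmonic morphism of degree 2 of tropical curves; it carries the associated involution $\iota:\widetilde\Gamma\to\widetilde\Gamma$ exchanging the sheets, whose fixed locus is the dilated part and whose topological quotient is $\Gamma$. Let $\Omega(\widetilde\Gamma)$ be the lattice of integral harmonic 1-forms on $\widetilde\Gamma$, i.e. sums $\sum_ea_e\,de$ over oriented edges with $a_e\in\mathbb Z$ and $\sum_ea_ee$ a cycle; so $\Omega(\widetilde\Gamma)\cong H_1(\widetilde\Gamma,\mathbb Z)$ canonically, and integration gives a pairing $H_1(\widetilde\Gamma,\mathbb Z)\times\Omega(\widetilde\Gamma)\to\mathbb R$ (the edge length pairing). The tropical Jacobian is $\mathrm{Jac}(\widetilde\Gamma)=\Omega(\widetilde\Gamma)^*_{\mathbb R}/H_1(\widetilde\Gamma,\mathbb Z)$ (so $N^*=\Omega(\widetilde\Gamma)$, $\Lambda=H_1(\widetilde\Gamma,\mathbb Z)$), with canonical principal polarization given by the canonical isomorphism $H_1(\widetilde\Gamma,\mathbb Z)\cong\Omega(\widetilde\Gamma)$. The Abel--Jacobi map $\Phi_q:\widetilde\Gamma\to\mathrm{Jac}(\widetilde\Gamma)$ is $p\mapsto(\omega\mapsto\int_q^p\omega)$. Continuous Prym variety (Röhrle--Zakharov). The map $\mathrm{Id}-\iota$ on $\mathrm{Jac}(\widetilde\Gamma)$ factors as $\mathrm{Jac}(\widetilde\Gamma)\xrightarrow{\epsilon}\mathrm{Prym}_c(\widetilde\Gamma/\Gamma)\xrightarrow{j}\mathrm{Jac}(\widetilde\Gamma)$,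 where $\mathrm{Prym}_c(\widetilde\Gamma/\Gamma)=N_{\mathbb R}/\Lambda$ is the torus with $N^*=(\mathrm{Id}-\iota^* )\Omega(\widetilde\Gamma)\subseteq\Omega(\widetilde\Gamma)$ and $\Lambda=H_1(\widetilde\Gamma,\mathbb Z)/\{c:\iota_*c=c\}$, embedded in $N_{\mathbb R}$ through the integration pairing. The map $\epsilon$ is induced by the quotient $H_1(\widetilde\Gamma,\mathbb Z)\to\Lambda$ and, dually, the inclusion $N^*\subseteq\Omega(\widetilde\Gamma)$; the map $j$ is induced by $\Lambda\to H_1(\widetilde\Gamma,\mathbb Z)$, $\bar c\mapsto c-\iota_*c$, and, dually, $\Omega(\widetilde\Gamma)\to N^*$, $\omega\mapsto\omega-\iota^*\omega$. The polarization induced on $\mathrm{Prym}_c(\widetilde\Gamma/\Gamma)$ by pulling back the canonical one along $j$ equals $2\zeta_c$ with $\zeta_c$ a principal polarization; explicitly $\rho_{\zeta_c}(\bar c)=\omega_c-\iota^*\omega_c$, where $\omega_c\in\Omega(\widetilde\Gamma)$ corresponds to $c\in H_1(\widetilde\Gamma,\mathbb Z)$. The Abel--Prym map is $\Psi_q=\epsilon\circ\Phi_q:\widetilde\Gamma\to\mathrm{Prym}_c(\widetilde\Gamma/\Gamma)$, and $\Psi^d_q(p_1,\dots,p_d)=\sum_i\Psi_q(p_i)$. Cycle classes. $\mathrm{cyc}[\widetilde\Gamma]\in H_{1,1}(\widetilde\Gamma)$ is the tropical homology class of the tropical chain $\sum_ee\otimes u_e$ over (arbitrarily oriented) edges $e$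 of $\widetilde\Gamma$, with $u_e$ the primitive tangent vector along $e$; $\mathrm{cyc}[\widetilde\Gamma^d]\in H_{d,d}(\widetilde\Gamma^d)$ is its $d$-fold cross product, the class of the fundamental cycle of $\widetilde\Gamma^d$. Pushforward on tropical homology along a morphism to a torus pushes forward chains and (multi)tangent vectors. *)

theory Defs
  imports
    "HOL-Analysis.Analysis"
    "HOL-Algebra.Coset"
    "HOL-Algebra.Elementary_Groups"
    "HOL-Algebra.Free_Abelian_Groups"
begin

section \<open>Lattices\<close>

text \<open>A lattice is a free abelian group of finite rank, written multiplicatively.\<close>

definition lattice_basis :: "'a monoid \<Rightarrow> nat \<Rightarrow> (nat \<Rightarrow> 'a) \<Rightarrow> bool" where
  "lattice_basis A n b \<longleftrightarrow> b \<in> {..<n} \<rightarrow> carrier A \<and>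
     (\<forall>x\<in>carrier A. \<exists>!k. k \<in> {..<n} \<rightarrow>\<^sub>E (UNIV :: int set) \<and>
        x = finprod A (\<lambda>i. b i [^]\<^bsub>A\<^esub> k i) {..<n})"

definition lattice_rank :: "'a monoid \<Rightarrow> nat" where
  "lattice_rank A = (THE n. \<exists>b. lattice_basis A n b)"

definition int_dual :: "'a monoid \<Rightarrow> ('a \<Rightarrow> int) monoid" where
  "int_dual A = \<lparr>carrier = hom A integer_group \<inter> extensional (carrier A),
     mult = (\<lambda>f g. \<lambda>a\<in>carrier A. f a + g a), one = (\<lambda>a\<in>carrier A. 0)\<rparr>"

definition real_dual :: "'a monoid \<Rightarrow> ('a \<Rightarrow> real) monoid" where
  "real_dual A = \<lparr>carrier = {x \<in> extensional (carrier A).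
       \<forall>a\<in>carrier A. \<forall>b\<in>carrier A. x (a \<otimes>\<^bsub>A\<^esub> b) = x a + x b},
     mult = (\<lambda>x y. \<lambda>a\<in>carrier A. x a + y a), one = (\<lambda>a\<in>carrier A. 0)\<rparr>"

definition ndet :: "nat \<Rightarrow> (nat \<Rightarrow> nat \<Rightarrow> real) \<Rightarrow> real" where
  "ndet n A = (\<Sum>\<pi> | \<pi> permutes {..<n}. of_int (sign \<pi>) * (\<Prod>i<n. A i (\<pi> i)))"


section \<open>Real tori with integral structure\<close>

text \<open>A torus is given by lattices \<open>\<Lambda>\<close> and \<open>M = N\<^sup>*\<close> and a pairing
  \<open>\<Lambda> \<times> M \<rightarrow> \<real>\<close>. Then \<open>N = Hom(M, \<int>)\<close> and \<open>N\<^sub>\<real> = Hom(M, \<real>)\<close>, and \<open>\<Lambda>\<close> embeds in \<open>N\<^sub>\<real>\<close>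
  through the pairing. Points of \<open>N\<^sub>\<real>/\<Lambda>\<close> are cosets.\<close>

record ('l, 'm) real_torus =
  tlam :: "'l monoid"
  tform :: "'m monoid"
  tpair :: "'l \<Rightarrow> 'm \<Rightarrow> real"

definition torus_dim :: "('l, 'm) real_torus \<Rightarrow> nat" where
  "torus_dim T = lattice_rank (tform T)"

definition torus_N :: "('l, 'm) real_torus \<Rightarrow> ('m \<Rightarrow> int) monoid" where
  "torus_N T = int_dual (tform T)"

definition torus_NR :: "('l, 'm) real_torus \<Rightarrow> ('m \<Rightarrow> real) monoid" where
  "torus_NR T = real_dual (tform T)"

definition lam_embed :: "('l, 'm) real_torus \<Rightarrow> 'l \<Rightarrow> 'm \<Rightarrow> real" where
  "lam_embed T l = (\<lambda>m\<in>carrier (tform T). tpair T l m)"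

definition torus_group :: "('l, 'm) real_torus \<Rightarrow> ('m \<Rightarrow> real) set monoid" where
  "torus_group T = torus_NR T Mod (lam_embed T ` carrier (tlam T))"

definition torus_proj :: "('l, 'm) real_torus \<Rightarrow> ('m \<Rightarrow> real) \<Rightarrow> ('m \<Rightarrow> real) set" where
  "torus_proj T x = (lam_embed T ` carrier (tlam T)) #>\<^bsub>torus_NR T\<^esub> x"

text \<open>The map on points induced by a homomorphism of tori into \<open>T\<close>, in terms of its
  dual map on the lattices of forms.\<close>

definition torus_map ::
  "('l, 'm) real_torus \<Rightarrow> ('m \<Rightarrow> 'k) \<Rightarrow> ('k \<Rightarrow> real) set \<Rightarrow> ('m \<Rightarrow> real) set" where
  "torus_map T h C = the_elem ((\<lambda>x. torus_proj T (\<lambda>m\<in>carrier (tform T). x (h m))) ` C)"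

text \<open>The \<open>\<real>\<close>-linear extension to \<open>N\<^sub>\<real> = \<Lambda>\<^sub>\<real>\<close> of \<open>f \<in> \<Lambda>\<^sup>*\<close>.\<close>

definition real_ext :: "('l, 'm) real_torus \<Rightarrow> ('l \<Rightarrow> int) \<Rightarrow> ('m \<Rightarrow> real) \<Rightarrow> real" where
  "real_ext T f x = (THE r. \<exists>L c. finite L \<and> L \<subseteq> carrier (tlam T) \<and>
     (\<forall>m\<in>carrier (tform T). x m = (\<Sum>l\<in>L. c l * tpair T l m)) \<and>
     r = (\<Sum>l\<in>L. c l * of_int (f l)))"


section \<open>Tropical (co)homology of tori\<close>

text \<open>For a lattice \<open>A\<close> of finite rank, \<open>\<And>\<^sup>k A\<close> is identified with the alternating forms in \<open>k\<close>
  arguments from \<open>A\<^sup>*\<close>, a decomposable \<open>a\<^sub>1 \<and> \<dots> \<and> a\<^sub>k\<close> being \<open>(f\<^sub>1, \<dots>, f\<^sub>k) \<mapsto> det (f\<^sub>i(a\<^sub>j))\<close>.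
  Hence \<open>H\<^sup>p\<^sup>,\<^sup>q = \<And>\<^sup>q \<Lambda>\<^sup>* \<otimes> \<And>\<^sup>p N\<^sup>*\<close> consists of forms alternating in \<open>q\<close> arguments from \<open>\<Lambda>\<close> and in
  \<open>p\<close> arguments from \<open>N\<close>, and \<open>H\<^sub>p\<^sub>,\<^sub>q = \<And>\<^sup>q \<Lambda> \<otimes> \<And>\<^sup>p N\<close> of forms alternating in \<open>q\<close> arguments from
  \<open>\<Lambda>\<^sup>*\<close> and in \<open>p\<close> arguments from \<open>M = N\<^sup>*\<close>. Argument tuples are functions on \<open>nat\<close>; homology
  classes are set to \<open>0\<close> off their domain, so that they are equal iff they are equal as functions.\<close>

type_synonym ('l, 'm) tcohom = "(nat \<Rightarrow> 'l) \<Rightarrow> (nat \<Rightarrow> 'm \<Rightarrow> int) \<Rightarrow> real"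
type_synonym ('l, 'm) thom = "(nat \<Rightarrow> 'l \<Rightarrow> int) \<Rightarrow> (nat \<Rightarrow> 'm) \<Rightarrow> real"

definition hom_dom ::
  "('l, 'm) real_torus \<Rightarrow> nat \<Rightarrow> nat \<Rightarrow> ((nat \<Rightarrow> 'l \<Rightarrow> int) \<times> (nat \<Rightarrow> 'm)) set" where
  "hom_dom T p q =
     ({..<q} \<rightarrow>\<^sub>E carrier (int_dual (tlam T))) \<times> ({..<p} \<rightarrow>\<^sub>E carrier (tform T))"

definition hom_restrict ::
  "('l, 'm) real_torus \<Rightarrow> nat \<Rightarrow> nat \<Rightarrow> ('l, 'm) thom \<Rightarrow> ('l, 'm) thom" where
  "hom_restrict T p q F = (\<lambda>f m. if (f, m) \<in> hom_dom T p q then F f m else 0)"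

definition alternating_multilinear ::
  "'a monoid \<Rightarrow> nat \<Rightarrow> ((nat \<Rightarrow> 'a) \<Rightarrow> real) \<Rightarrow> bool" where
  "alternating_multilinear A k F \<longleftrightarrow>
     (\<forall>x\<in>{..<k} \<rightarrow>\<^sub>E carrier A. \<forall>i<k. \<forall>a\<in>carrier A. \<forall>b\<in>carrier A.
        F (x(i := a \<otimes>\<^bsub>A\<^esub> b)) = F (x(i := a)) + F (x(i := b))) \<and>
     (\<forall>x\<in>{..<k} \<rightarrow>\<^sub>E carrier A. \<forall>i<k. \<forall>j<k. i \<noteq> j \<and> x i = x j \<longrightarrow> F x = 0)"

text \<open>\<open>H\<^sub>p\<^sub>,\<^sub>q(T)\<close> with rational coefficients.\<close>

definition trop_homology :: "('l, 'm) real_torus \<Rightarrow> nat \<Rightarrow> nat \<Rightarrow> ('l, 'm) thom set" where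
  "trop_homology T p q = {F.
     (\<forall>f m. (f, m) \<notin> hom_dom T p q \<longrightarrow> F f m = 0) \<and>
     (\<forall>f m. F f m \<in> \<rat>) \<and>
     (\<forall>m\<in>{..<p} \<rightarrow>\<^sub>E carrier (tform T).
        alternating_multilinear (int_dual (tlam T)) q (\<lambda>f. F f m)) \<and>
     (\<forall>f\<in>{..<q} \<rightarrow>\<^sub>E carrier (int_dual (tlam T)).
        alternating_multilinear (tform T) p (F f))}"

text \<open>Componentwise wedge product \<open>H\<^sup>p\<^sup>,\<^sup>q \<times> H\<^sup>r\<^sup>,\<^sup>s \<rightarrow> H\<^sup>p\<^sup>+\<^sup>r\<^sup>,\<^sup>q\<^sup>+\<^sup>s\<close>, normalised so that
  \<open>(f\<^sub>1 \<and> \<dots> \<and> f\<^sub>k)(x) = det (f\<^sub>i(x\<^sub>j))\<close>.\<close>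

definition cup ::
  "nat \<Rightarrow> nat \<Rightarrow> nat \<Rightarrow> nat \<Rightarrow> ('l, 'm) tcohom \<Rightarrow> ('l, 'm) tcohom \<Rightarrow> ('l, 'm) tcohom" where
  "cup p q r s \<alpha> \<beta> = (\<lambda>x y.
     (\<Sum>\<sigma> | \<sigma> permutes {..<q + s}. \<Sum>\<tau> | \<tau> permutes {..<p + r}.
        of_int (sign \<sigma> * sign \<tau>) *
        \<alpha> (\<lambda>i. x (\<sigma> i)) (\<lambda>i. y (\<tau> i)) *
        \<beta> (\<lambda>i. x (\<sigma> (q + i))) (\<lambda>i. y (\<tau> (p + i))))
     / (fact p * fact q * fact r * fact s))"

primrec cup_power :: "('l, 'm) tcohom \<Rightarrow> nat \<Rightarrow> ('l, 'm) tcohom" where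
  "cup_power \<alpha> 0 = (\<lambda>x y. 1)"
| "cup_power \<alpha> (Suc k) = cup 1 1 k k \<alpha> (cup_power \<alpha> k)"

text \<open>\<open>(f\<^sub>1 \<and> \<dots> \<and> f\<^sub>q) \<otimes> (m\<^sub>1 \<and> \<dots> \<and> m\<^sub>p)\<close> in \<open>H\<^sup>p\<^sup>,\<^sup>q\<close>\<close>

definition cohom_decomp ::
  "nat \<Rightarrow> nat \<Rightarrow> (nat \<Rightarrow> 'l \<Rightarrow> int) \<Rightarrow> (nat \<Rightarrow> 'm) \<Rightarrow> ('l, 'm) tcohom" where
  "cohom_decomp p q f m = (\<lambda>x y.
     ndet q (\<lambda>i j. of_int (f i (x j))) * ndet p (\<lambda>i j. of_int (y j (m i))))"

text \<open>Bases \<open>\<lambda>\<close> of \<open>\<Lambda>\<close> and \<open>\<eta>\<close> of \<open>N\<close> inducing the same orientation of \<open>N\<^sub>\<real>\<close>; the fundamental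
  class of \<open>T\<close> is \<open>(\<lambda>\<^sub>1 \<and> \<dots> \<and> \<lambda>\<^sub>n) \<otimes> (\<eta>\<^sub>1 \<and> \<dots> \<and> \<eta>\<^sub>n)\<close>.\<close>

definition oriented_bases ::
  "('l, 'm) real_torus \<Rightarrow> (nat \<Rightarrow> 'l) \<times> (nat \<Rightarrow> 'm \<Rightarrow> int) \<Rightarrow> bool" where
  "oriented_bases T = (\<lambda>(bs, ns).
     lattice_basis (tlam T) (torus_dim T) bs \<and> lattice_basis (torus_N T) (torus_dim T) ns \<and>
     (\<exists>A. (\<forall>i<torus_dim T. \<forall>m\<in>carrier (tform T).
             tpair T (bs i) m = (\<Sum>j<torus_dim T. A i j * of_int (ns j m))) \<and>
          ndet (torus_dim T) A > 0))"

text \<open>Cap product \<open>H\<^sup>p\<^sup>,\<^sup>q \<rightarrow> H\<^sub>n\<^sub>-\<^sub>p\<^sub>,\<^sub>n\<^sub>-\<^sub>q\<close> with the fundamental class: the componentwise interior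
  product, \<open>\<langle>\<beta>, \<alpha> \<frown> cyc[T]\<rangle> = \<langle>\<alpha> \<and> \<beta>, cyc[T]\<rangle>\<close>. The choice of oriented bases is immaterial, and for
  \<open>p = q\<close> so is the order of \<open>\<alpha>\<close> and \<open>\<beta>\<close>.\<close>

definition poincare_dual ::
  "('l, 'm) real_torus \<Rightarrow> nat \<Rightarrow> nat \<Rightarrow> ('l, 'm) tcohom \<Rightarrow> ('l, 'm) thom" where
  "poincare_dual T p q \<alpha> = (let n = torus_dim T; (bs, ns) = (SOME b. oriented_bases T b) in
     hom_restrict T (n - p) (n - q) (\<lambda>f m.
       cup p q (n - p) (n - q) \<alpha> (cohom_decomp (n - p) (n - q) f m) bs ns))"

text \<open>A polarization, given as \<open>\<rho> : \<Lambda> \<rightarrow> N\<^sup>*\<close>, as an element of \<open>H\<^sup>1\<^sup>,\<^sup>1 = \<Lambda>\<^sup>* \<otimes> N\<^sup>*\<close>.\<close>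

definition polarization_form :: "('l \<Rightarrow> 'm) \<Rightarrow> ('l, 'm) tcohom" where
  "polarization_form \<rho> = (\<lambda>x y. of_int (y 0 (\<rho> (x 0))))"

definition polarization_power ::
  "('l, 'm) real_torus \<Rightarrow> ('l \<Rightarrow> 'm) \<Rightarrow> nat \<Rightarrow> ('l, 'm) thom" where
  "polarization_power T \<rho> k = poincare_dual T k k (cup_power (polarization_form \<rho>) k)"


section \<open>Tropical chains and their pushforward to a torus\<close>

text \<open>A tropical cubical chain in a space is a formal sum of pairs \<open>(\<sigma>, v)\<close> of a singular cube
  \<open>\<sigma>\<close> and vectors \<open>v 0, v 1, \<dots>\<close>, standing for \<open>\<sigma> \<otimes> (v 0 \<and> \<dots> \<and> v (p - 1))\<close>, where the tangent
  vectors \<open>v j\<close> along \<open>\<sigma>\<close> are given by their components in the coordinates of the cube.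
  In a torus the coefficient is a multivector in \<open>\<And>\<^sup>p N\<close>, as an alternating form on \<open>M\<close>.\<close>

type_synonym 'x tchain = "(((nat \<Rightarrow> real) \<Rightarrow> 'x) \<times> (nat \<Rightarrow> nat \<Rightarrow> real)) multiset"
type_synonym 'm torus_chain =
  "(((nat \<Rightarrow> real) \<Rightarrow> ('m \<Rightarrow> real) set) \<times> ((nat \<Rightarrow> 'm) \<Rightarrow> real)) multiset"

definition std_cube :: "nat \<Rightarrow> (nat \<Rightarrow> real) set" where
  "std_cube q = {..<q} \<rightarrow>\<^sub>E {0..1}"

definition is_lift ::
  "('l, 'm) real_torus \<Rightarrow> nat \<Rightarrow> ((nat \<Rightarrow> real) \<Rightarrow> ('m \<Rightarrow> real) set) \<Rightarrow>
   ((nat \<Rightarrow> real) \<Rightarrow> 'm \<Rightarrow> real) \<Rightarrow> bool" where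
  "is_lift T q \<sigma> s \<longleftrightarrow>
     (\<forall>t\<in>std_cube q. s t \<in> carrier (torus_NR T) \<and> torus_proj T (s t) = \<sigma> t) \<and>
     (\<forall>m\<in>carrier (tform T). continuous_on (std_cube q) (\<lambda>t. s t m))"

text \<open>Lifts are unique up to translation by \<open>\<Lambda>\<close>, which does not affect derivatives.\<close>

definition cube_lift ::
  "('l, 'm) real_torus \<Rightarrow> nat \<Rightarrow> ((nat \<Rightarrow> real) \<Rightarrow> ('m \<Rightarrow> real) set) \<Rightarrow>
   (nat \<Rightarrow> real) \<Rightarrow> 'm \<Rightarrow> real" where
  "cube_lift T q \<sigma> = (SOME s. is_lift T q \<sigma> s)"

text \<open>The differential at the centre of the cube of \<open>F \<circ> \<sigma>\<close> (for a morphism \<open>F\<close> to a torus it is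
  constant along the cells), as a map from tangent vectors to \<open>N\<^sub>\<real> = Hom(M, \<real>)\<close>.\<close>

definition push_tangent ::
  "('l, 'm) real_torus \<Rightarrow> nat \<Rightarrow> ((nat \<Rightarrow> real) \<Rightarrow> ('m \<Rightarrow> real) set) \<Rightarrow>
   (nat \<Rightarrow> real) \<Rightarrow> 'm \<Rightarrow> real" where
  "push_tangent T q \<sigma> v m = deriv (\<lambda>s. cube_lift T q \<sigma> (\<lambda>k\<in>{..<q}. 1 / 2 + s * v k) m) 0"

definition push_chain ::
  "('l, 'm) real_torus \<Rightarrow> nat \<Rightarrow> nat \<Rightarrow> ('x \<Rightarrow> ('m \<Rightarrow> real) set) \<Rightarrow> 'x tchain \<Rightarrow>
   'm torus_chain" where
  "push_chain T p q F Z = image_mset (\<lambda>(\<sigma>, v).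
     (F \<circ> \<sigma>, \<lambda>m. ndet p (\<lambda>i j. push_tangent T q (F \<circ> \<sigma>) (v j) (m i)))) Z"

text \<open>\<open>\<integral>\<^sub>\<sigma> f\<^sub>1 \<and> \<dots> \<and> f\<^sub>q\<close>, for \<open>f\<^sub>i \<in> \<Lambda>\<^sup>*\<close> regarded as constant 1-forms on \<open>N\<^sub>\<real>/\<Lambda>\<close>.\<close>

definition cube_integral ::
  "('l, 'm) real_torus \<Rightarrow> nat \<Rightarrow> ((nat \<Rightarrow> real) \<Rightarrow> ('m \<Rightarrow> real) set) \<Rightarrow>
   (nat \<Rightarrow> 'l \<Rightarrow> int) \<Rightarrow> real" where
  "cube_integral T q \<sigma> f =
     (LINT t | PiM {..<q} (\<lambda>_. restrict_space lborel {0<..<1}).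
        ndet q (\<lambda>i j. deriv (\<lambda>s. real_ext T (f i) (cube_lift T q \<sigma> (t(j := s)))) (t j)))"

text \<open>The class of a cycle in \<open>H\<^sub>q(T; \<And>\<^sup>p N) = \<And>\<^sup>q \<Lambda> \<otimes> \<And>\<^sup>p N\<close>. The identification
  \<open>H\<^sub>q(N\<^sub>\<real>/\<Lambda>) = \<And>\<^sup>q \<Lambda>\<close>, which sends the parallelotope spanned by \<open>\<lambda>\<^sub>1, \<dots>, \<lambda>\<^sub>q \<in> \<Lambda>\<close> to
  \<open>\<lambda>\<^sub>1 \<and> \<dots> \<and> \<lambda>\<^sub>q\<close>, is given by the periods of the constant forms.\<close>

definition chain_class ::
  "('l, 'm) real_torus \<Rightarrow> nat \<Rightarrow> nat \<Rightarrow> 'm torus_chain \<Rightarrow> ('l, 'm) thom" where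
  "chain_class T p q Z = hom_restrict T p q (\<lambda>f m.
     (\<Sum>(\<sigma>, w) \<in># Z. cube_integral T q \<sigma> f * w m))"


section \<open>Tropical curves\<close>

text \<open>A metric graph is given by a model: loops and multiple edges are allowed, and every edge \<open>e\<close>
  carries an (arbitrary) orientation that identifies it with the interval from \<open>0\<close> to \<open>len e\<close>.\<close>

record ('v, 'e) metric_graph =
  verts :: "'v set"
  edges :: "'e set"
  src :: "'e \<Rightarrow> 'v"
  tgt :: "'e \<Rightarrow> 'v"
  len :: "'e \<Rightarrow> real"

definition tropical_curve :: "('v, 'e) metric_graph \<Rightarrow> bool" where
  "tropical_curve G \<longleftrightarrow>
     finite (verts G) \<and> finite (edges G) \<and> verts G \<noteq> {} \<and>
     src G ` edges G \<subseteq> verts G \<and> tgt G ` edges G \<subseteq> verts G \<and>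
     (\<forall>e\<in>edges G. len G e > 0) \<and>
     (\<forall>u\<in>verts G. \<forall>v\<in>verts G.
        (u, v) \<in> ((\<Union>e\<in>edges G. {(src G e, tgt G e), (tgt G e, src G e)}))\<^sup>*)"

datatype ('v, 'e) gpoint = Vertex 'v | Interior 'e real

definition points :: "('v, 'e) metric_graph \<Rightarrow> ('v, 'e) gpoint set" where
  "points G = Vertex ` verts G \<union> {Interior e t | e t. e \<in> edges G \<and> 0 < t \<and> t < len G e}"

definition edge_point :: "('v, 'e) metric_graph \<Rightarrow> 'e \<Rightarrow> real \<Rightarrow> ('v, 'e) gpoint" where
  "edge_point G e t =
     (if t = 0 then Vertex (src G e) else if t = len G e then Vertex (tgt G e) else Interior e t)"

text \<open>A path is a list of segments \<open>(e, a, b)\<close>, each running along the edge \<open>e\<close> from parameter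
  \<open>a\<close> to parameter \<open>b\<close>.\<close>

inductive is_path ::
  "('v, 'e) metric_graph \<Rightarrow> ('v, 'e) gpoint \<Rightarrow> ('e \<times> real \<times> real) list \<Rightarrow> ('v, 'e) gpoint \<Rightarrow> bool"
  for G where
  "is_path G x [] x"
| "\<lbrakk>e \<in> edges G; a \<in> {0..len G e}; b \<in> {0..len G e}; is_path G (edge_point G e b) ps y\<rbrakk>
   \<Longrightarrow> is_path G (edge_point G e a) ((e, a, b) # ps) y"

definition boundary :: "('v, 'e) metric_graph \<Rightarrow> ('e \<Rightarrow>\<^sub>0 int) \<Rightarrow> ('v \<Rightarrow>\<^sub>0 int)" where
  "boundary G = frag_extend (\<lambda>e. frag_of (tgt G e) - frag_of (src G e))"

definition H1 :: "('v, 'e) metric_graph \<Rightarrow> ('e \<Rightarrow>\<^sub>0 int) monoid" where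
  "H1 G = (free_Abelian_group (edges G))
     \<lparr>carrier := kernel (free_Abelian_group (edges G)) (free_Abelian_group (verts G)) (boundary G)\<rparr>"

definition genus :: "('v, 'e) metric_graph \<Rightarrow> nat" where
  "genus G = lattice_rank (H1 G)"

text \<open>The harmonic form \<open>\<Sum>\<^sub>e a\<^sub>e de\<close> is represented by its coefficients \<open>a\<close>, so the canonical
  isomorphism \<open>H\<^sub>1 \<cong> \<Omega>\<close> is the identity.\<close>

definition harmonic_forms :: "('v, 'e) metric_graph \<Rightarrow> ('e \<Rightarrow>\<^sub>0 int) monoid" where
  "harmonic_forms G = H1 G"

definition path_integral :: "('e \<times> real \<times> real) list \<Rightarrow> ('e \<Rightarrow>\<^sub>0 int) \<Rightarrow> real" where
  "path_integral ps \<omega> = (\<Sum>(e, a, b) \<leftarrow> ps. of_int (Poly_Mapping.lookup \<omega> e) * (b - a))"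

definition cycle_integral ::
  "('v, 'e) metric_graph \<Rightarrow> ('e \<Rightarrow>\<^sub>0 int) \<Rightarrow> ('e \<Rightarrow>\<^sub>0 int) \<Rightarrow> real" where
  "cycle_integral G c \<omega> = (\<Sum>e\<in>edges G.
     of_int (Poly_Mapping.lookup c e) * of_int (Poly_Mapping.lookup \<omega> e) * len G e)"

definition jacobian :: "('v, 'e) metric_graph \<Rightarrow> ('e \<Rightarrow>\<^sub>0 int, 'e \<Rightarrow>\<^sub>0 int) real_torus" where
  "jacobian G = \<lparr>tlam = H1 G, tform = harmonic_forms G, tpair = cycle_integral G\<rparr>"

definition abel_jacobi ::
  "('v, 'e) metric_graph \<Rightarrow> ('v, 'e) gpoint \<Rightarrow> ('v, 'e) gpoint \<Rightarrow> (('e \<Rightarrow>\<^sub>0 int) \<Rightarrow> real) set" where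
  "abel_jacobi G q p = torus_proj (jacobian G)
     (\<lambda>\<omega>\<in>carrier (harmonic_forms G). path_integral (SOME ps. is_path G q ps p) \<omega>)"

text \<open>The fundamental chain of the \<open>d\<close>-fold product: the cells are products of \<open>d\<close> edges,
  parametrized proportionally to arc length, so the primitive tangent vector along the \<open>j\<close>-th
  factor has \<open>j\<close>-th coordinate \<open>1 / len\<close>.\<close>

definition fundamental_chain ::
  "('v, 'e) metric_graph \<Rightarrow> nat \<Rightarrow> (nat \<Rightarrow> ('v, 'e) gpoint) tchain" where
  "fundamental_chain G d = image_mset (\<lambda>e.
     (\<lambda>t. \<lambda>i\<in>{..<d}. edge_point G (e i) (t i * len G (e i)),
      \<lambda>j k. if k = j then 1 / len G (e j) else 0)) (mset_set ({..<d} \<rightarrow>\<^sub>E edges G))"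


section \<open>Double covers and the continuous Prym variety\<close>

record ('v, 'e, 'w, 'f) graph_cover =
  vmap :: "'v \<Rightarrow> 'w"
  emap :: "'e \<Rightarrow> 'f"
  vdeg :: "'v \<Rightarrow> nat"
  edeg :: "'e \<Rightarrow> nat"

text \<open>Finite harmonic morphisms, with respect to models for which vertices map to vertices and
  edges map to edges, with compatible orientations. The dilation factor \<open>edeg e\<close> is the slope
  along \<open>e\<close>; harmonicity is required separately for outgoing and incoming half-edges, so that
  loops are counted correctly.\<close>

definition harmonic_morphism ::
  "('v, 'e) metric_graph \<Rightarrow> ('w, 'f) metric_graph \<Rightarrow> ('v, 'e, 'w, 'f) graph_cover \<Rightarrow> bool" where
  "harmonic_morphism Gt G \<pi> \<longleftrightarrow>
     vmap \<pi> ` verts Gt \<subseteq> verts G \<and> emap \<pi> ` edges Gt \<subseteq> edges G \<and>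
     (\<forall>v\<in>verts Gt. vdeg \<pi> v \<ge> 1) \<and>
     (\<forall>e\<in>edges Gt. edeg \<pi> e \<ge> 1 \<and>
        src G (emap \<pi> e) = vmap \<pi> (src Gt e) \<and> tgt G (emap \<pi> e) = vmap \<pi> (tgt Gt e) \<and>
        len G (emap \<pi> e) = of_nat (edeg \<pi> e) * len Gt e) \<and>
     (\<forall>v\<in>verts Gt. \<forall>f\<in>edges G.
        (src G f = vmap \<pi> v \<longrightarrow>
           (\<Sum>e | e \<in> edges Gt \<and> emap \<pi> e = f \<and> src Gt e = v. edeg \<pi> e) = vdeg \<pi> v) \<and>
        (tgt G f = vmap \<pi> v \<longrightarrow>
           (\<Sum>e | e \<in> edges Gt \<and> emap \<pi> e = f \<and> tgt Gt e = v. edeg \<pi> e) = vdeg \<pi> v))"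

definition double_cover ::
  "('v, 'e) metric_graph \<Rightarrow> ('w, 'f) metric_graph \<Rightarrow> ('v, 'e, 'w, 'f) graph_cover \<Rightarrow> bool" where
  "double_cover Gt G \<pi> \<longleftrightarrow>
     tropical_curve Gt \<and> tropical_curve G \<and> harmonic_morphism Gt G \<pi> \<and>
     (\<forall>w\<in>verts G. (\<Sum>v | v \<in> verts Gt \<and> vmap \<pi> v = w. vdeg \<pi> v) = 2)"

text \<open>The associated involution on edges: over an edge of the target lie either two undilated edges,
  which are exchanged, or one dilated edge, which is fixed.\<close>

definition sheet_swap :: "('v, 'e) metric_graph \<Rightarrow> ('v, 'e, 'w, 'f) graph_cover \<Rightarrow> 'e \<Rightarrow> 'e" where
  "sheet_swap Gt \<pi> e =
     (if e \<in> edges Gt \<and> (\<exists>e'\<in>edges Gt. e' \<noteq> e \<and> emap \<pi> e' = emap \<pi> e)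
      then THE e'. e' \<in> edges Gt \<and> e' \<noteq> e \<and> emap \<pi> e' = emap \<pi> e
      else e)"

text \<open>The involution preserves orientations and lengths, so \<open>\<iota>\<^sup>* de = d(\<iota> e)\<close>; hence on
  coefficients both \<open>\<iota>\<^sub>*\<close> and \<open>\<iota>\<^sup>*\<close> are given by the following map.\<close>

definition chain_swap ::
  "('v, 'e) metric_graph \<Rightarrow> ('v, 'e, 'w, 'f) graph_cover \<Rightarrow> ('e \<Rightarrow>\<^sub>0 int) \<Rightarrow> ('e \<Rightarrow>\<^sub>0 int)" where
  "chain_swap Gt \<pi> = frag_extend (frag_of \<circ> sheet_swap Gt \<pi>)"

definition prym ::
  "('v, 'e) metric_graph \<Rightarrow> ('v, 'e, 'w, 'f) graph_cover \<Rightarrow>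
   (('e \<Rightarrow>\<^sub>0 int) set, 'e \<Rightarrow>\<^sub>0 int) real_torus" where
  "prym Gt \<pi> = \<lparr>
     tlam = H1 Gt Mod {c \<in> carrier (H1 Gt). chain_swap Gt \<pi> c = c},
     tform = (harmonic_forms Gt)
       \<lparr>carrier := (\<lambda>\<omega>. \<omega> - chain_swap Gt \<pi> \<omega>) ` carrier (harmonic_forms Gt)\<rparr>,
     tpair = (\<lambda>C \<omega>. the_elem ((\<lambda>c. cycle_integral Gt c \<omega>) ` C))\<rparr>"

definition prym_polarization ::
  "('v, 'e) metric_graph \<Rightarrow> ('v, 'e, 'w, 'f) graph_cover \<Rightarrow> ('e \<Rightarrow>\<^sub>0 int) set \<Rightarrow> ('e \<Rightarrow>\<^sub>0 int)" where
  "prym_polarization Gt \<pi> C = the_elem ((\<lambda>c. c - chain_swap Gt \<pi> c) ` C)"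

definition prym_eps ::
  "('v, 'e) metric_graph \<Rightarrow> ('v, 'e, 'w, 'f) graph_cover \<Rightarrow>
   (('e \<Rightarrow>\<^sub>0 int) \<Rightarrow> real) set \<Rightarrow> (('e \<Rightarrow>\<^sub>0 int) \<Rightarrow> real) set" where
  "prym_eps Gt \<pi> = torus_map (prym Gt \<pi>) (\<lambda>\<omega>. \<omega>)"

definition abel_prym ::
  "('v, 'e) metric_graph \<Rightarrow> ('v, 'e, 'w, 'f) graph_cover \<Rightarrow> ('v, 'e) gpoint \<Rightarrow>
   ('v, 'e) gpoint \<Rightarrow> (('e \<Rightarrow>\<^sub>0 int) \<Rightarrow> real) set" where
  "abel_prym Gt \<pi> q = prym_eps Gt \<pi> \<circ> abel_jacobi Gt q"

definition abel_prym_sum ::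
  "('v, 'e) metric_graph \<Rightarrow> ('v, 'e, 'w, 'f) graph_cover \<Rightarrow> ('v, 'e) gpoint \<Rightarrow> nat \<Rightarrow>
   (nat \<Rightarrow> ('v, 'e) gpoint) \<Rightarrow> (('e \<Rightarrow>\<^sub>0 int) \<Rightarrow> real) set" where
  "abel_prym_sum Gt \<pi> q d p =
     finprod (torus_group (prym Gt \<pi>)) (\<lambda>i. abel_prym Gt \<pi> q (p i)) {..<d}"

text \<open>\<open>\<Psi>\<^sup>d\<^sub>q\<^sub>,\<^sub>* cyc[\<Gamma>\<^sup>d]\<close>\<close>

definition abel_prym_cycle ::
  "('v, 'e) metric_graph \<Rightarrow> ('v, 'e, 'w, 'f) graph_cover \<Rightarrow> ('v, 'e) gpoint \<Rightarrow> nat \<Rightarrow>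
   (('e \<Rightarrow>\<^sub>0 int) set, 'e \<Rightarrow>\<^sub>0 int) thom" where
  "abel_prym_cycle Gt \<pi> q d = chain_class (prym Gt \<pi>) d d
     (push_chain (prym Gt \<pi>) d d (abel_prym_sum Gt \<pi> q d) (fundamental_chain Gt d))"

end

theory Submission
  imports Defs "Jordan_Normal_Form.Determinant"
begin

text \<open>Write \<open>\<rho> : \<Lambda> \<rightarrow> M\<close> for the isomorphism given by the principal polarization. Both sides of the
  identity are multiples of the class \<open>(f, m) \<mapsto> det (f\<^sub>i (\<rho>\<inverse> m\<^sub>j))\<close>. On the polarization side this is the
  complementary minor of the identity matrix, once the matrix of the polarization with respect to
  oriented bases is known to have determinant \<open>1\<close>; the latter holds because it is unimodular and the Gram
  matrix of the polarization is positive definite. On the other side, \<open>\<Psi>\<^sup>d\<close> is affine on every cell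
  \<open>e\<^sub>1 \<times> \<dots> \<times> e\<^sub>d\<close>, so the cycle is a sum of products of two \<open>d \<times> d\<close> determinants over all \<open>d\<close>-tuples of
  edges, and the Cauchy--Binet formula turns it into \<open>d!\<close> times a single determinant. Its entries are
  \<open>f\<^sub>i\<close> of the class of the cycle \<open>m\<^sub>j\<close> in \<open>\<Lambda>\<close>; since \<open>\<iota>\<^sup>* m\<^sub>j = - m\<^sub>j\<close>, this class is \<open>2 \<rho>\<inverse> m\<^sub>j\<close>, whence the
  factor \<open>2\<^sup>d\<close>.\<close>

section \<open>Determinants\<close>

text \<open>Three data in the definitions are picked by \<open>SOME\<close>: the path behind
  \<open>abel_jacobi\<close>, the lift of a cube, and the oriented bases behind
  \<open>poincare_dual\<close>. Each choice has to be shown harmless before anything can be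
  computed: two paths differ by an integral cycle, two lifts by a constant, and two base changes by
  determinants 1 or -1 whose signs are tied together by the orientation. The real extension of an
  element of \<open>\<Lambda>\<^sup>*\<close> is defined by a description as well, and becomes a
  linear formula because the Gram matrix is invertible. The classes are compared on all arguments
  \<open>(f, m)\<close> instead of on a basis of the homology, so no basis of an exterior power
  appears, and membership in \<open>trop_homology\<close> is read off from the determinant. The
  factorials arise because the sums run over all permutations or tuples, where the classical
  determinant identities run over subsets. The formula for the dimension is a separate argument with
  traces.\<close>

lemma permutes_lessThan_iff: "p permutes {..<n::nat} \<Longrightarrow> p i < n \<longleftrightarrow> i < n"
  using permutes_in_image by fastforce

text \<open>The bridge to matrices, through which multiplicativity, transposition and the adjugate
  are imported.\<close>

lemma ndet_eq_det: "ndet n A = Determinant.det (Matrix.mat n n (\<lambda>(i, j). A i j))"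
proof -
  have "(\<Prod>i<n. A i (p i)) = (\<Prod>i=0..<n. Matrix.mat n n (\<lambda>(i, j). A i j) $$ (i, p i))"
    if "p permutes {0..<n}" for p
    using that by (intro prod.cong) (auto simp: permutes_lessThan_iff simp flip: lessThan_atLeast0)
  then show ?thesis
    by (simp add: ndet_def Determinant.det_def lessThan_atLeast0)
qed

lemma ndet_cong:
  assumes "\<And>i j. i < n \<Longrightarrow> j < n \<Longrightarrow> A i j = B i j"
  shows "ndet n A = ndet n B"
proof -
  have "Matrix.mat n n (\<lambda>(i, j). A i j) = Matrix.mat n n (\<lambda>(i, j). B i j)"
    by (rule eq_matI) (use assms in auto)
  then show ?thesis
    by (simp add: ndet_eq_det)
qed

lemma ndet_mult: "ndet n (\<lambda>i j. \<Sum>k<n. A i k * B k j) = ndet n A * ndet n B"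
proof -
  have "Matrix.mat n n (\<lambda>(i, j). \<Sum>k<n. A i k * B k j) =
      Matrix.mat n n (\<lambda>(i, j). A i j) * Matrix.mat n n (\<lambda>(i, j). B i j)"
    by (rule eq_matI) (auto simp: scalar_prod_def lessThan_atLeast0)
  then show ?thesis
    by (simp add: ndet_eq_det Determinant.det_mult[of _ n])
qed

lemma ndet_transpose: "ndet n (\<lambda>i j. A j i) = ndet n A"
proof -
  have "Matrix.mat n n (\<lambda>(i, j). A j i) = transpose_mat (Matrix.mat n n (\<lambda>(i, j). A i j))"
    by (rule eq_matI) auto
  then show ?thesis
    by (simp add: ndet_eq_det Determinant.det_transpose[of _ n])
qed

lemma ndet_identity: "ndet n (\<lambda>i j. if i = j then 1 else 0) = 1"
proof -
  have "Matrix.mat n n (\<lambda>(i, j). if i = j then 1 else 0) = (1\<^sub>m n :: real mat)"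
    by (rule eq_matI) auto
  then show ?thesis
    by (simp add: ndet_eq_det)
qed

lemma ndet_Ints:
  assumes "\<And>i j. i < n \<Longrightarrow> j < n \<Longrightarrow> A i j \<in> \<int>"
  shows "ndet n A \<in> \<int>"
  unfolding ndet_def using assms
  by (intro Ints_sum Ints_mult Ints_prod) (auto simp: permutes_lessThan_iff)

lemma ndet_inverse:
  assumes "ndet n A \<noteq> 0"
  obtains B where "\<And>i j. i < n \<Longrightarrow> j < n \<Longrightarrow> (\<Sum>k<n. A i k * B k j) = (if i = j then 1 else 0)"
    and "\<And>i j. i < n \<Longrightarrow> j < n \<Longrightarrow> (\<Sum>k<n. B i k * A k j) = (if i = j then 1 else 0)"
proof -
  define X where "X = Matrix.mat n n (\<lambda>(i, j). A i j)"
  define B where "B = (\<lambda>i j. adj_mat X $$ (i, j) / ndet n A)"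
  have X: "X \<in> carrier_mat n n" by (simp add: X_def)
  note adj = adj_mat[OF X]
  have X_index: "X $$ (i, j) = A i j" if "i < n" "j < n" for i j
    using that by (simp add: X_def)
  have dim: "dim_row (adj_mat X) = n" "dim_col (adj_mat X) = n"
    using adj(1) by auto
  have d: "Determinant.det X = ndet n A" by (simp add: X_def ndet_eq_det)
  show ?thesis
  proof
    fix i j assume ij: "i < n" "j < n"
    have "(X * adj_mat X) $$ (i, j) = ndet n A * (if i = j then 1 else 0)"
      using ij by (simp add: adj d)
    also have "(X * adj_mat X) $$ (i, j) = (\<Sum>k<n. A i k * adj_mat X $$ (k, j))"
      using ij X by (simp add: scalar_prod_def lessThan_atLeast0 dim X_index)
    finally show "(\<Sum>k<n. A i k * B k j) = (if i = j then 1 else 0)"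
      using assms by (simp add: B_def flip: sum_divide_distrib)
    have "(adj_mat X * X) $$ (i, j) = ndet n A * (if i = j then 1 else 0)"
      using ij by (simp add: adj d)
    also have "(adj_mat X * X) $$ (i, j) = (\<Sum>k<n. adj_mat X $$ (i, k) * A k j)"
      using ij X by (simp add: scalar_prod_def lessThan_atLeast0 dim X_index)
    finally show "(\<Sum>k<n. B i k * A k j) = (if i = j then 1 else 0)"
      using assms by (simp add: B_def flip: sum_divide_distrib)
  qed
qed

lemma ndet_neq_0_if_trivial_kernel:
  assumes "\<And>y. (\<And>i. i < n \<Longrightarrow> (\<Sum>j<n. A i j * y j) = 0) \<Longrightarrow> (\<And>i. i < n \<Longrightarrow> y i = 0)"
  shows "ndet n A \<noteq> 0"
proof
  define X where "X = Matrix.mat n n (\<lambda>(i, j). A i j)"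
  have X: "X \<in> carrier_mat n n" by (simp add: X_def)
  assume "ndet n A = 0"
  then have "Determinant.det X = 0" by (simp add: X_def ndet_eq_det)
  then obtain v where v: "v \<in> carrier_vec n" "v \<noteq> 0\<^sub>v n" "X *\<^sub>v v = 0\<^sub>v n"
    using det_0_iff_vec_prod_zero[OF X] by auto
  have "(\<Sum>j<n. A i j * (vec_index v j)) = 0" if "i < n" for i
  proof -
    have "vec_index (X *\<^sub>v v) i = 0" using that v by simp
    then show ?thesis
      using that v(1) by (simp add: X_def scalar_prod_def lessThan_atLeast0)
  qed
  then have "vec_index v i = 0" if "i < n" for i
    using assms[of "\<lambda>j. vec_index v j"] that by auto
  then have "v = 0\<^sub>v n"
    using v(1) by (intro eq_vecI) auto
  with v(2) show False by simp
qed

text \<open>The segment from the identity to \<open>S\<close> avoids the singular matrices.\<close>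

lemma ndet_pos_if_pos_def:
  assumes pd: "\<And>y. (\<exists>i<n. y i \<noteq> 0) \<Longrightarrow> 0 < (\<Sum>i<n. \<Sum>j<n. y i * y j * S i j)"
  shows "ndet n S > 0"
proof -
  define P where "P = (\<lambda>t::real. \<lambda>i j. (1 - t) * (if i = j then 1 else 0) + t * S i j)"
  have nz: "ndet n (P t) \<noteq> 0" if t: "0 \<le> t" "t \<le> 1" for t
  proof (rule ndet_neq_0_if_trivial_kernel)
    fix y i assume K: "\<And>i. i < n \<Longrightarrow> (\<Sum>j<n. P t i j * y j) = 0" and i: "i < n"
    show "y i = 0"
    proof (rule ccontr)
      assume yi: "y i \<noteq> 0"
      \<comment> \<open>Pairing the kernel equation with \<open>y\<close> itself gives a convex
        combination of the squared norm and the form of \<open>S\<close>. Both are positive, so the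
        combination cannot vanish; \<open>t = 0\<close> is separate because only the norm survives
        there.\<close>
      have "0 = (\<Sum>i<n. y i * (\<Sum>j<n. P t i j * y j))" using K by simp
      also have "\<dots> = (\<Sum>i<n. \<Sum>j<n. (1 - t) * (if i = j then y i * y j else 0) + t * (y i * y j * S i j))"
        unfolding sum_distrib_left by (intro sum.cong refl) (auto simp: P_def algebra_simps)
      also have "\<dots> = (1 - t) * (\<Sum>i<n. (y i)\<^sup>2) + t * (\<Sum>i<n. \<Sum>j<n. y i * y j * S i j)"
        by (simp add: sum.distrib power2_eq_square flip: sum_distrib_left)
      finally have eq: "0 = (1 - t) * (\<Sum>i<n. (y i)\<^sup>2) + t * (\<Sum>i<n. \<Sum>j<n. y i * y j * S i j)" .
      have p1: "0 < (\<Sum>i<n. (y i)\<^sup>2)"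
        by (rule sum_pos2[of _ i]) (use yi i in auto)
      have p2: "0 < (\<Sum>i<n. \<Sum>j<n. y i * y j * S i j)" using pd yi i by blast
      show False
      proof (cases "t = 0")
        case False
        then have "0 < t * (\<Sum>i<n. \<Sum>j<n. y i * y j * S i j)"
          using p2 t by simp
        moreover have "0 \<le> (1 - t) * (\<Sum>i<n. (y i)\<^sup>2)" using p1 t by simp
        ultimately show False using eq by linarith
      qed (use eq p1 in simp)
    qed
  qed
  have P0: "ndet n (P 0) = 1"
    using ndet_identity[of n] by (simp add: P_def cong: ndet_cong)
  have P1: "ndet n (P 1) = ndet n S"
    by (rule ndet_cong) (simp add: P_def)
  have cont: "continuous_on {0..1} (\<lambda>t. ndet n (P t))"
    unfolding ndet_def P_def by (intro continuous_intros)
  show ?thesis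
  proof (rule ccontr)
    assume "\<not> ?thesis"
    then obtain t where "0 \<le> t" "t \<le> 1" "ndet n (P t) = 0"
      using IVT2'[of "\<lambda>t. ndet n (P t)" 1 0 0] P0 P1 cont by auto
    with nz show False by blast
  qed
qed

section \<open>Permuted columns and the Cauchy--Binet formula\<close>

lemma permutation_lessThan: "p permutes {..<n::nat} \<Longrightarrow> permutation p"
  using permutation_permutes by blast

lemma of_int_sign_left_idempotent: "of_int (sign p) * (of_int (sign p) * x) = (x :: real)"
  by (simp add: sign_def)

lemma ndet_permute_columns:
  assumes p: "p permutes {..<n}"
  shows "ndet n (\<lambda>i j. A i (p j)) = of_int (sign p) * ndet n A"
proof -
  have "ndet n A = (\<Sum>s | s permutes {..<n}. of_int (sign (p \<circ> s)) * (\<Prod>i<n. A i ((p \<circ> s) i)))"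
    unfolding ndet_def by (rule setum_permutations_compose_left[OF p])
  also have "\<dots> = (\<Sum>s | s permutes {..<n}. of_int (sign p) * (of_int (sign s) * (\<Prod>i<n. A i (p (s i)))))"
    by (intro sum.cong refl)
       (use p in \<open>auto simp: sign_compose permutation_lessThan mult.assoc\<close>)
  also have "\<dots> = of_int (sign p) * ndet n (\<lambda>i j. A i (p j))"
    by (simp add: ndet_def sum_distrib_left)
  finally have "of_int (sign p) * ndet n A = of_int (sign p * sign p) * ndet n (\<lambda>i j. A i (p j))"
    by (simp only: of_int_mult mult.assoc)
  then show ?thesis by simp
qed

lemma ndet_equal_columns:
  assumes "a < n" "b < n" "a \<noteq> b" and eq: "\<And>i. i < n \<Longrightarrow> A i a = A i b"
  shows "ndet n A = 0"
proof -
  let ?p = "Transposition.transpose a b"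
  have "ndet n A = ndet n (\<lambda>i j. A i (?p j))"
    by (rule ndet_cong) (use eq in \<open>auto simp: Transposition.transpose_def\<close>)
  also have "\<dots> = - ndet n A"
    using ndet_permute_columns[of ?p n A] assms by (simp add: permutes_swap_id sign_swap_id)
  finally show ?thesis by simp
qed

text \<open>Multilinearity in the columns, read backwards: each \<open>s\<close> selects one summand
  from every column of the matrix on the right. Besides leading to Cauchy--Binet, this half is used
  on the polarization side, where only one of the two factors is a determinant.\<close>

lemma sum_PiE_prod_ndet:
  assumes "finite S"
  shows "(\<Sum>s\<in>{..<d} \<rightarrow>\<^sub>E S. (\<Prod>j<d. C j (s j)) * ndet d (\<lambda>i j. F i (s j))) =
    ndet d (\<lambda>i j. \<Sum>a\<in>S. F i a * C j a)"
proof -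
  have "(\<Sum>s\<in>{..<d} \<rightarrow>\<^sub>E S. (\<Prod>j<d. C j (s j)) * ndet d (\<lambda>i j. F i (s j))) =
    (\<Sum>s\<in>{..<d} \<rightarrow>\<^sub>E S. \<Sum>p | p permutes {..<d}. of_int (sign p) * (\<Prod>j<d. F (p j) (s j) * C j (s j)))"
    by (subst ndet_transpose[symmetric])
       (simp add: ndet_def sum_distrib_left prod.distrib mult_ac)
  also have "\<dots> = (\<Sum>p | p permutes {..<d}. of_int (sign p) * (\<Prod>j<d. \<Sum>a\<in>S. F (p j) a * C j a))"
    by (subst sum.swap) (simp add: prod_sum_PiE assms flip: sum_distrib_left)
  also have "\<dots> = ndet d (\<lambda>j i. \<Sum>a\<in>S. F i a * C j a)"
    by (simp add: ndet_def)
  also have "\<dots> = ndet d (\<lambda>i j. \<Sum>a\<in>S. F i a * C j a)"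
    by (rule ndet_transpose)
  finally show ?thesis .
qed

lemma sum_PiE_permute:
  assumes p: "p permutes {..<d::nat}"
  shows "(\<Sum>s\<in>{..<d} \<rightarrow>\<^sub>E S. g s) = (\<Sum>s\<in>{..<d} \<rightarrow>\<^sub>E S. g (\<lambda>i\<in>{..<d}. s (p i)))"
proof (rule sum.reindex_bij_witness[of _ "\<lambda>s. \<lambda>i\<in>{..<d}. s (p i)" "\<lambda>s. \<lambda>i\<in>{..<d}. s (inv_into UNIV p i)"])
  have ip: "inv_into UNIV p permutes {..<d}" by (rule permutes_inv[OF p])
  have lt: "p i < d \<longleftrightarrow> i < d" "inv_into UNIV p i < d \<longleftrightarrow> i < d" for i
    using permutes_in_image[OF p] permutes_in_image[OF ip] by auto
  fix s assume s: "s \<in> {..<d} \<rightarrow>\<^sub>E S"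
  show "(\<lambda>i\<in>{..<d}. s (p i)) \<in> {..<d} \<rightarrow>\<^sub>E S" "(\<lambda>i\<in>{..<d}. s (inv_into UNIV p i)) \<in> {..<d} \<rightarrow>\<^sub>E S"
    using s lt by (auto simp: PiE_iff)
  show eq: "(\<lambda>i\<in>{..<d}. (\<lambda>i\<in>{..<d}. s (inv_into UNIV p i)) (p i)) = s"
    using s by (intro ext) (auto simp: lt permutes_inverses[OF p] restrict_def PiE_def extensional_def)
  show "g (\<lambda>i\<in>{..<d}. (\<lambda>i\<in>{..<d}. s (inv_into UNIV p i)) (p i)) = g s" by (simp only: eq)
  show "(\<lambda>i\<in>{..<d}. (\<lambda>i\<in>{..<d}. s (p i)) (inv_into UNIV p i)) = s"
    using s by (intro ext) (auto simp: lt permutes_inverses[OF p] restrict_def PiE_def extensional_def)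
qed

text \<open>Cauchy--Binet with a sum over all tuples instead of subsets: a subset of size
  \<open>d\<close> is met \<open>d!\<close> times, and tuples with a repetition contribute 0. After
  expanding the second determinant, every permutation \<open>p\<close> can be absorbed by
  relabelling the tuple, so all \<open>d!\<close> terms agree.\<close>

lemma sum_PiE_ndet_ndet:
  assumes "finite S"
  shows "(\<Sum>s\<in>{..<d} \<rightarrow>\<^sub>E S. ndet d (\<lambda>i j. F i (s j)) * ndet d (\<lambda>i j. C i (s j))) =
    fact d * ndet d (\<lambda>i j. \<Sum>a\<in>S. F i a * C j a)"
proof -
  have "(\<Sum>s\<in>{..<d} \<rightarrow>\<^sub>E S. ndet d (\<lambda>i j. F i (s j)) * ndet d (\<lambda>i j. C i (s j))) =
    (\<Sum>p | p permutes {..<d}. \<Sum>s\<in>{..<d} \<rightarrow>\<^sub>E S.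
      of_int (sign p) * (\<Prod>j<d. C j (s (p j))) * ndet d (\<lambda>i j. F i (s j)))"
    by (subst sum.swap) (simp add: ndet_def[of d "\<lambda>i j. C i (s j)" for s] sum_distrib_left mult_ac)
  also have "\<dots> = (\<Sum>p | p permutes {..<d}. ndet d (\<lambda>i j. \<Sum>a\<in>S. F i a * C j a))"
  proof (rule sum.cong[OF refl])
    fix p assume "p \<in> {p. p permutes {..<d}}"
    then have p: "p permutes {..<d}" by simp
    have ip: "inv_into UNIV p permutes {..<d}" by (rule permutes_inv[OF p])
    have lt: "p i < d \<longleftrightarrow> i < d" "inv_into UNIV p i < d \<longleftrightarrow> i < d" for i
      using permutes_in_image[OF p] permutes_in_image[OF ip] by auto
    have "(\<Sum>s\<in>{..<d} \<rightarrow>\<^sub>E S.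
        of_int (sign p) * (\<Prod>j<d. C j (s (p j))) * ndet d (\<lambda>i j. F i (s j))) =
      (\<Sum>s\<in>{..<d} \<rightarrow>\<^sub>E S.
        of_int (sign p) * (\<Prod>j<d. C j (s j)) * ndet d (\<lambda>i j. F i (s (inv_into UNIV p j))))"
      \<comment> \<open>Relabelling by the inverse moves \<open>p\<close> out of the product and
        into the columns of the determinant, where it only costs its sign.\<close>
      unfolding sum_PiE_permute[OF ip, of "\<lambda>s. of_int (sign p) * (\<Prod>j<d. C j (s (p j))) * ndet d (\<lambda>i j. F i (s j))"]
    proof (rule sum.cong[OF refl])
      fix s
      have "(\<Prod>j<d. C j ((\<lambda>i\<in>{..<d}. s (inv_into UNIV p i)) (p j))) = (\<Prod>j<d. C j (s j))"
        by (rule prod.cong) (simp_all add: lt permutes_inverses[OF p])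
      moreover have "ndet d (\<lambda>i j. F i ((\<lambda>i\<in>{..<d}. s (inv_into UNIV p i)) j)) =
          ndet d (\<lambda>i j. F i (s (inv_into UNIV p j)))"
        by (rule ndet_cong) simp
      ultimately show "of_int (sign p) * (\<Prod>j<d. C j ((\<lambda>i\<in>{..<d}. s (inv_into UNIV p i)) (p j))) *
          ndet d (\<lambda>i j. F i ((\<lambda>i\<in>{..<d}. s (inv_into UNIV p i)) j)) =
        of_int (sign p) * (\<Prod>j<d. C j (s j)) * ndet d (\<lambda>i j. F i (s (inv_into UNIV p j)))"
        by (simp only:)
    qed
    also have "\<dots> = (\<Sum>s\<in>{..<d} \<rightarrow>\<^sub>E S. (\<Prod>j<d. C j (s j)) * ndet d (\<lambda>i j. F i (s j)))"
    proof (rule sum.cong[OF refl])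
      fix s
      have "ndet d (\<lambda>i j. F i (s (inv_into UNIV p j))) = of_int (sign p) * ndet d (\<lambda>i j. F i (s j))"
        using ndet_permute_columns[OF ip, of "\<lambda>i j. F i (s j)"]
        by (simp add: sign_inverse[OF permutation_lessThan[OF p]])
      moreover have "real_of_int (sign p) * real_of_int (sign p) = 1"
        by (simp flip: of_int_mult)
      ultimately show "of_int (sign p) * (\<Prod>j<d. C j (s j)) * ndet d (\<lambda>i j. F i (s (inv_into UNIV p j))) =
          (\<Prod>j<d. C j (s j)) * ndet d (\<lambda>i j. F i (s j))"
        by (simp add: mult_ac)
    qed
    also have "\<dots> = ndet d (\<lambda>i j. \<Sum>a\<in>S. F i a * C j a)"
      by (rule sum_PiE_prod_ndet[OF assms])
    finally show "(\<Sum>s\<in>{..<d} \<rightarrow>\<^sub>E S.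
        of_int (sign p) * (\<Prod>j<d. C j (s (p j))) * ndet d (\<lambda>i j. F i (s j))) =
      ndet d (\<lambda>i j. \<Sum>a\<in>S. F i a * C j a)" .
  qed
  also have "\<dots> = fact d * ndet d (\<lambda>i j. \<Sum>a\<in>S. F i a * C j a)"
    by (simp add: card_permutations[of _ d])
  finally show ?thesis .
qed


section \<open>Antisymmetrised sums over permutations of two blocks\<close>

lemma prod_lessThan_add: "(\<Prod>i<k + d. h i) = (\<Prod>i<k. h i) * (\<Prod>j<d. h (k + j :: nat))"
  for h :: "nat \<Rightarrow> 'a::comm_monoid_mult"
  by (induction d) (simp_all add: mult_ac)

text \<open>The embedding of the permutations of \<open>d\<close> letters into those of
  \<open>k + d\<close> letters, acting on the last block.\<close>

definition shift_perm :: "nat \<Rightarrow> (nat \<Rightarrow> nat) \<Rightarrow> nat \<Rightarrow> nat" where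
  "shift_perm k p i = (if i < k then i else k + p (i - k))"

text \<open>The embedding respects composition and takes transpositions to transpositions, so an
  induction over transpositions preserves the sign.\<close>

lemma shift_perm_permutes_sign:
  assumes "p permutes {..<d}"
  shows "shift_perm k p permutes {..<k + d} \<and> sign (shift_perm k p) = sign p"
  using assms finite_lessThan
proof (induction p rule: permutes_induct)
  case id
  have "shift_perm k id = id" by (auto simp: shift_perm_def fun_eq_iff)
  then show ?case by (simp only: permutes_id sign_id simp_thms)
next
  case (swap a b p)
  have eq: "shift_perm k (Transposition.transpose a b \<circ> p) =
      Transposition.transpose (k + a) (k + b) \<circ> shift_perm k p"
    by (auto simp: shift_perm_def fun_eq_iff Transposition.transpose_def)
  have t: "Transposition.transpose (k + a) (k + b) permutes {..<k + d}"
    using swap by (intro permutes_swap_id) auto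
  have p: "shift_perm k p permutes {..<k + d}" "sign (shift_perm k p) = sign p"
    using swap by auto
  have "sign (Transposition.transpose a b \<circ> p) = - sign p"
    using swap sign_compose[OF permutation_swap_id[of a b] permutation_lessThan[OF swap.hyps(4)]]
    by (simp only: sign_swap_id if_False mult_minus1)
  moreover have "sign (Transposition.transpose (k + a) (k + b) \<circ> shift_perm k p) = - sign p"
    using swap sign_compose[OF permutation_lessThan[OF t] permutation_lessThan[OF p(1)]]
    by (simp only: sign_swap_id p add_left_cancel if_False mult_minus1)
  ultimately show ?case
    unfolding eq using permutes_compose[OF p(1) t] by (simp only: simp_thms)
qed

text \<open>A permutation that fixes the first block pointwise cannot, by injectivity, send the
  second block into the first; it is therefore determined by its shifted-down action there.\<close>

lemma shift_perm_image:
  "shift_perm k ` {p. p permutes {..<d}} = {s. s permutes {..<k + d} \<and> (\<forall>i<k. s i = i)}"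
proof (intro equalityI subsetI)
  fix s assume "s \<in> shift_perm k ` {p. p permutes {..<d}}"
  then show "s \<in> {s. s permutes {..<k + d} \<and> (\<forall>i<k. s i = i)}"
    using shift_perm_permutes_sign by (auto simp: shift_perm_def)
next
  fix s assume "s \<in> {s. s permutes {..<k + d} \<and> (\<forall>i<k. s i = i)}"
  then have s: "s permutes {..<k + d}" and fix': "\<And>i. i < k \<Longrightarrow> s i = i" by auto
  have inj: "s i = s j \<Longrightarrow> i = j" for i j
    using permutes_inj[OF s] by (auto dest: injD)
  have ge: "k \<le> s i" if "k \<le> i" for i
    using that fix'[of "s i"] inj[of "s i" i] by (cases "s i < k") auto
  define p where "p = (\<lambda>j. s (k + j) - k)"
  have eq: "s = shift_perm k p"
    using ge by (auto simp: fun_eq_iff shift_perm_def p_def fix')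
  have "p permutes {..<d}"
  proof (rule bij_imp_permutes)
    have "inj_on p {..<d}"
    proof (rule inj_onI)
      fix x y assume "p x = p y"
      then have "s (k + x) = s (k + y)"
        using ge[of "k + x"] ge[of "k + y"] by (simp add: p_def)
      then show "x = y" using inj by fastforce
    qed
    moreover have "p ` {..<d} \<subseteq> {..<d}"
    proof (intro image_subsetI)
      fix x assume "x \<in> {..<d}"
      then have "s (k + x) < k + d" using permutes_lessThan_iff[OF s] by simp
      then show "p x \<in> {..<d}" using ge[of "k + x"] by (simp add: p_def less_diff_conv2)
    qed
    ultimately show "bij_betw p {..<d} {..<d}"
      by (simp add: bij_betw_def endo_inj_surj)
    show "p x = x" if "x \<notin> {..<d}" for x
      using that permutes_not_in[OF s, of "k + x"] by (simp add: p_def)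
  qed
  with eq show "s \<in> shift_perm k ` {p. p permutes {..<d}}" by blast
qed

lemma inj_shift_perm: "inj (shift_perm k)"
proof (rule injI, rule ext)
  fix p p' x assume "shift_perm k p = shift_perm k p'"
  then have "shift_perm k p (k + x) = shift_perm k p' (k + x)" by simp
  then show "p x = p' x" by (simp add: shift_perm_def)
qed

text \<open>Inside an antisymmetrised sum an inner determinant is worth \<open>d!\<close> times its
  diagonal product: the permutation \<open>p\<close> of its expansion is absorbed into the outer one
  through \<open>s \<circ> \<phi> p\<close>, and the sign of \<open>p\<close> is exactly the change
  of the sign of \<open>s\<close>. Here \<open>\<phi>\<close> embeds the small symmetric group and
  \<open>o'\<close> gives the position of its block. This is the mechanism that cancels the
  normalisation in \<open>cup\<close>.\<close>

lemma sum_sign_ndet_absorb: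
  fixes \<phi> :: "(nat \<Rightarrow> nat) \<Rightarrow> nat \<Rightarrow> nat" and n :: nat
  assumes \<phi>: "\<And>p. p permutes {..<d} \<Longrightarrow> \<phi> p permutes {..<n} \<and> sign (\<phi> p) = sign p"
    and o: "\<And>p j. p permutes {..<d} \<Longrightarrow> j < d \<Longrightarrow> \<phi> p (o' j) = o' (p j)"
    and g: "\<And>s p. s permutes {..<n} \<Longrightarrow> p permutes {..<d} \<Longrightarrow> g (s \<circ> \<phi> p) = g s"
  shows "(\<Sum>s | s permutes {..<n}. of_int (sign s) * g s * ndet d (\<lambda>i j. B i (s (o' j)))) =
    fact d * (\<Sum>s | s permutes {..<n}. of_int (sign s) * g s * (\<Prod>j<d. B j (s (o' j))))"
proof -
  define h where "h = (\<lambda>s. real_of_int (sign s) * g s * (\<Prod>j<d. B j (s (o' j))))"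
  have "(\<Sum>s | s permutes {..<n}. of_int (sign s) * g s * ndet d (\<lambda>i j. B i (s (o' j)))) =
    (\<Sum>s | s permutes {..<n}. \<Sum>p | p permutes {..<d}.
        of_int (sign p) * of_int (sign s) * g s * (\<Prod>j<d. B j (s (o' (p j)))))"
    by (simp add: ndet_def sum_distrib_left mult_ac)
  also have "\<dots> = (\<Sum>s | s permutes {..<n}. \<Sum>p | p permutes {..<d}. h (s \<circ> \<phi> p))"
  proof (intro sum.cong refl)
    fix s p assume "s \<in> {s. s permutes {..<n}}" "p \<in> {p. p permutes {..<d}}"
    then have s: "s permutes {..<n}" and p: "p permutes {..<d}" by auto
    have "(\<Prod>j<d. B j (s (o' (p j)))) = (\<Prod>j<d. B j ((s \<circ> \<phi> p) (o' j)))"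
      by (intro prod.cong) (simp_all add: o[OF p])
    moreover have "sign (s \<circ> \<phi> p) = sign s * sign p"
      using sign_compose[OF permutation_lessThan[OF s] permutation_lessThan, of "\<phi> p" n] \<phi>[OF p]
      by (simp only:)
    ultimately show "of_int (sign p) * of_int (sign s) * g s * (\<Prod>j<d. B j (s (o' (p j)))) = h (s \<circ> \<phi> p)"
      unfolding h_def g[OF s p] by (simp only: of_int_mult mult_ac)
  qed
  also have "\<dots> = (\<Sum>p | p permutes {..<d}. \<Sum>s | s permutes {..<n}. h s)"
  proof (subst sum.swap, rule sum.cong[OF refl])
    fix p assume "p \<in> {p. p permutes {..<d}}"
    then show "(\<Sum>s | s permutes {..<n}. h (s \<circ> \<phi> p)) = (\<Sum>s | s permutes {..<n}. h s)"
      using \<phi> sum_permutations_compose_right[of "\<phi> p" "{..<n}" h] by simp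
  qed
  also have "\<dots> = fact d * (\<Sum>s | s permutes {..<n}. h s)"
    by (simp add: card_permutations[of _ d])
  finally show ?thesis by (simp add: h_def)
qed

lemma sum_sign_ndet_absorb_last:
  assumes "\<And>s p. s permutes {..<k + d} \<Longrightarrow> p permutes {..<d} \<Longrightarrow> g (s \<circ> shift_perm k p) = g s"
  shows "(\<Sum>s | s permutes {..<k + d}. of_int (sign s) * g s * ndet d (\<lambda>i j. B i (s (k + j)))) =
    fact d * (\<Sum>s | s permutes {..<k + d}. of_int (sign s) * g s * (\<Prod>j<d. B j (s (k + j))))"
  by (rule sum_sign_ndet_absorb[where \<phi> = "shift_perm k" and o' = "\<lambda>j. k + j"])
     (use assms shift_perm_permutes_sign in \<open>auto simp: shift_perm_def\<close>)

lemma sum_sign_ndet_absorb_first: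
  assumes "\<And>s p. s permutes {..<k + d} \<Longrightarrow> p permutes {..<k} \<Longrightarrow> g (s \<circ> p) = g s"
  shows "(\<Sum>s | s permutes {..<k + d}. of_int (sign s) * g s * ndet k (\<lambda>i j. B i (s j))) =
    fact k * (\<Sum>s | s permutes {..<k + d}. of_int (sign s) * g s * (\<Prod>j<k. B j (s j)))"
proof (rule sum_sign_ndet_absorb[where \<phi> = "\<lambda>p. p" and o' = "\<lambda>j. j"])
  show "p permutes {..<k + d} \<and> sign p = sign p" if "p permutes {..<k}" for p
    using that by (auto intro: permutes_subset)
qed (use assms in auto)

section \<open>Cup powers of the polarization and complementary minors\<close>

lemma ndet_permute_rows:
  assumes p: "p permutes {..<n}"
  shows "ndet n (\<lambda>i j. A (p i) j) = of_int (sign p) * ndet n A"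
  using ndet_permute_columns[OF p, of "\<lambda>i j. A j i"]
  by (simp add: ndet_transpose[of n "\<lambda>i j. A i j"] ndet_transpose[of n "\<lambda>i j. A (p i) j"])

text \<open>If the polarization is written as a sum of pure tensors, its \<open>k\<close>-th power
  meets every set of \<open>k\<close> of them in \<open>k!\<close> orders, whence the factor. In the
  induction, the sum over \<open>t\<close> for fixed \<open>s\<close> is a determinant with rows
  permuted by \<open>s\<close>; the two signs of \<open>s\<close> cancel and all
  \<open>(k + 1)!\<close> summands agree.\<close>

lemma cup_power_polarization_form:
  "cup_power (polarization_form \<rho>) k x y = fact k * ndet k (\<lambda>i j. of_int (y j (\<rho> (x i))))"
proof (induction k arbitrary: x y)
  case 0
  show ?case by (simp add: ndet_def)
next
  case (Suc k)
  define A where "A = (\<lambda>i j. real_of_int (y j (\<rho> (x i))))"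
  have inner: "(\<Sum>t | t permutes {..<1 + k}. of_int (sign t) * A (s 0) (t 0) *
      ndet k (\<lambda>i j. A (s (1 + i)) (t (1 + j)))) = fact k * of_int (sign s) * ndet (1 + k) A"
    if s: "s permutes {..<1 + k}" for s
  proof -
    have "(\<Sum>t | t permutes {..<1 + k}. of_int (sign t) * A (s 0) (t 0) *
        ndet k (\<lambda>i j. A (s (1 + i)) (t (1 + j)))) =
      fact k * (\<Sum>t | t permutes {..<1 + k}. of_int (sign t) * A (s 0) (t 0) *
        (\<Prod>j<k. A (s (1 + j)) (t (1 + j))))"
      by (rule sum_sign_ndet_absorb_last) (simp add: shift_perm_def)
    also have "(\<Sum>t | t permutes {..<1 + k}. of_int (sign t) * A (s 0) (t 0) *
        (\<Prod>j<k. A (s (1 + j)) (t (1 + j)))) = ndet (1 + k) (\<lambda>i j. A (s i) j)"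
      unfolding ndet_def prod_lessThan_add by (simp add: mult.assoc)
    also have "\<dots> = of_int (sign s) * ndet (1 + k) A"
      by (rule ndet_permute_rows[OF s])
    finally show ?thesis by simp
  qed
  have "cup_power (polarization_form \<rho>) (Suc k) x y =
      (\<Sum>s | s permutes {..<1 + k}. of_int (sign s) * (fact k * (\<Sum>t | t permutes {..<1 + k}.
        of_int (sign t) * A (s 0) (t 0) * ndet k (\<lambda>i j. A (s (1 + i)) (t (1 + j)))))) / (fact k * fact k)"
    by (simp add: cup_def Suc.IH A_def sum_distrib_left mult_ac)
       (simp add: polarization_form_def)
  \<comment> \<open>One \<open>fact k\<close> comes from the induction hypothesis and the other from
    absorbing the inner determinant; together they cancel the normalisation of
    \<open>cup\<close>.\<close>
  also have "\<dots> = (\<Sum>s | s permutes {..<1 + k}. of_int (sign s) * (fact k * (fact k * of_int (sign s) * ndet (1 + k) A))) / (fact k * fact k)"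
    by (intro arg_cong2[where f = divide] sum.cong refl) (simp only: inner mem_Collect_eq)
  also have "\<dots> = (\<Sum>s | s permutes {..<1 + k}. ndet (1 + k) A)"
    by (simp add: sum_divide_distrib of_int_sign_left_idempotent)
  also have "\<dots> = fact (1 + k) * ndet (1 + k) A"
    by (simp add: card_permutations[of _ "Suc k"] algebra_simps)
  finally show ?case by (simp add: A_def)
qed

text \<open>Of the four factorials in the normalisation of \<open>cup\<close>, one
  \<open>fact k\<close> is cancelled by the factor of the power and the other three by absorbing the
  determinants of the power, of \<open>m\<close> and of \<open>f\<close>. The sum over
  \<open>s\<close> ends up innermost because it is the one that turns into a determinant for fixed
  \<open>t\<close>.\<close>

lemma cup_polarization_decomp:
  fixes \<rho> :: "'l \<Rightarrow> 'm"
  defines "A \<equiv> \<lambda>x y i j. real_of_int (y j (\<rho> (x i)))"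
  shows "cup k k d d (cup_power (polarization_form \<rho>) k) (cohom_decomp d d f m) x y =
    (\<Sum>t | t permutes {..<k + d}. of_int (sign t) * (\<Prod>j<d. of_int (y (t (k + j)) (m j))) *
      (\<Sum>s | s permutes {..<k + d}. of_int (sign s) *
        (\<Prod>i<k. A x y (s i) (t i)) * (\<Prod>j<d. of_int (f j (x (s (k + j)))))))"
proof -
  define F where "F = (\<lambda>j a. real_of_int (f j (x a)))"
  define C where "C = (\<lambda>j a. real_of_int (y a (m j)))"
  let ?S = "{s. s permutes {..<k + d}}"
  have "cup k k d d (cup_power (polarization_form \<rho>) k) (cohom_decomp d d f m) x y =
    fact k * (\<Sum>s\<in>?S. of_int (sign s) * ndet d (\<lambda>i j. F i (s (k + j))) * (\<Sum>t\<in>?S. of_int (sign t) *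
      ndet d (\<lambda>i j. C i (t (k + j))) *
      ndet k (\<lambda>i j. A x y (s i) (t j)))) / (fact k * fact k * fact d * fact d)"
    by (simp add: cup_def cup_power_polarization_form cohom_decomp_def A_def F_def C_def
        sum_distrib_left mult_ac)
  also have "\<dots> = fact k * (\<Sum>s\<in>?S. of_int (sign s) * ndet d (\<lambda>i j. F i (s (k + j))) *
     (fact k * (\<Sum>t\<in>?S. of_int (sign t) * ndet d (\<lambda>i j. C i (t (k + j))) *
      (\<Prod>i<k. A x y (s i) (t i))))) / (fact k * fact k * fact d * fact d)"
    by (subst sum_sign_ndet_absorb_first)
       (auto intro!: ndet_cong simp: permutes_not_in)
  also have "\<dots> = (\<Sum>s\<in>?S. of_int (sign s) * ndet d (\<lambda>i j. F i (s (k + j))) *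
      (\<Sum>t\<in>?S. of_int (sign t) * (\<Prod>i<k. A x y (s i) (t i)) * ndet d (\<lambda>i j. C i (t (k + j))))) / (fact d * fact d)"
    by (simp add: mult_ac sum_divide_distrib flip: sum_distrib_left)
  also have "\<dots> = (\<Sum>s\<in>?S. of_int (sign s) * ndet d (\<lambda>i j. F i (s (k + j))) *
      (fact d * (\<Sum>t\<in>?S. of_int (sign t) * (\<Prod>i<k. A x y (s i) (t i)) * (\<Prod>j<d. C j (t (k + j)))))) / (fact d * fact d)"
    by (subst sum_sign_ndet_absorb_last) (auto simp: shift_perm_def)
  also have "\<dots> = (\<Sum>s\<in>?S. \<Sum>t\<in>?S. of_int (sign s) * ndet d (\<lambda>i j. F i (s (k + j))) *
       (of_int (sign t) * (\<Prod>i<k. A x y (s i) (t i)) * (\<Prod>j<d. C j (t (k + j))))) / fact d"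
    by (simp add: sum_distrib_left sum_divide_distrib mult_ac)
  also have "\<dots> = (\<Sum>t\<in>?S. of_int (sign t) * (\<Prod>j<d. C j (t (k + j))) * (\<Sum>s\<in>?S. of_int (sign s) * (\<Prod>i<k. A x y (s i) (t i)) *
       ndet d (\<lambda>i j. F i (s (k + j))))) / fact d"
    by (subst sum.swap) (simp add: sum_distrib_left mult_ac)
  also have "\<dots> = (\<Sum>t\<in>?S. of_int (sign t) * (\<Prod>j<d. C j (t (k + j))) * (fact d * (\<Sum>s\<in>?S. of_int (sign s) * (\<Prod>i<k. A x y (s i) (t i)) *
       (\<Prod>j<d. F j (s (k + j)))))) / fact d"
    by (subst sum_sign_ndet_absorb_last) (auto simp: shift_perm_def)
  also have "\<dots> = (\<Sum>t\<in>?S. of_int (sign t) * (\<Prod>j<d. C j (t (k + j))) * (\<Sum>s\<in>?S. of_int (sign s) * (\<Prod>i<k. A x y (s i) (t i)) *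
       (\<Prod>j<d. F j (s (k + j)))))"
    by (simp add: sum_divide_distrib mult.assoc)
  finally show ?thesis by (simp add: F_def C_def)
qed

text \<open>Once one extension \<open>t\<close> is built, by enumerating the complement of the image
  of \<open>s\<close> on the first block, all others are \<open>t \<circ> p\<close> with
  \<open>p\<close> a permutation of the first \<open>k\<close> positions.\<close>

lemma card_permutes_extending:
  assumes s: "s \<in> {..<d} \<rightarrow>\<^sub>E {..<k + d}" and inj: "inj_on s {..<d}"
  shows "card {t. t permutes {..<k + d} \<and> (\<lambda>j\<in>{..<d}. t (k + j)) = s} = fact k"
proof -
  define R where "R = {..<k + d} - s ` {..<d}"
  have "card R = k"
    using s unfolding R_def by (subst card_Diff_subset) (auto simp: card_image[OF inj])
  then obtain h where h: "bij_betw h {..<k} R"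
    using finite_same_card_bij[of "{..<k}" R] by (auto simp: R_def)
  define t where "t = (\<lambda>i. if i < k then h i else if i < k + d then s (i - k) else i)"
  have t_lo: "t i = h i" if "i < k" for i using that by (simp add: t_def)
  have t_hi: "t i = s (i - k)" if "k \<le> i" "i < k + d" for i using that by (simp add: t_def)
  have hR: "h i \<in> R" if "i < k" for i using h that by (auto simp: bij_betw_def)
  have hs: "h i \<noteq> s j" if "i < k" "j < d" for i j using hR[OF that(1)] that(2) by (auto simp: R_def)
  have t_inj: "inj_on t {..<k + d}"
  proof (rule inj_onI)
    fix a b assume ab: "a \<in> {..<k + d}" "b \<in> {..<k + d}" "t a = t b"
    consider "a < k" "b < k" | "a < k" "k \<le> b" | "k \<le> a" "b < k" | "k \<le> a" "k \<le> b" by linarith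
    then show "a = b"
    proof cases
      case 1
      then have "h a = h b" using ab(3) by (simp only: t_lo)
      then show ?thesis using 1 h by (auto simp: bij_betw_def inj_on_def)
    next
      case 2
      then show ?thesis using ab hs[of a "b - k"] t_lo[of a] t_hi[of b] by fastforce
    next
      case 3
      then show ?thesis using ab hs[of b "a - k"] t_lo[of b] t_hi[of a] by fastforce
    next
      case 4
      have "s (a - k) = s (b - k)" using ab t_hi[OF 4(1)] t_hi[OF 4(2)] by simp
      moreover have "a - k \<in> {..<d}" "b - k \<in> {..<d}" using ab 4 by auto
      ultimately have "a - k = b - k" by (rule inj_onD[OF inj])
      then show ?thesis using 4 by linarith
    qed
  qed
  have "t ` {..<k + d} \<subseteq> {..<k + d}"
  proof (intro image_subsetI)
    fix i assume i: "i \<in> {..<k + d}"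
    show "t i \<in> {..<k + d}"
    proof (cases "i < k")
      case True
      then show ?thesis using hR[of i] by (simp add: t_lo R_def)
    next
      case False
      then have "i - k \<in> {..<d}" using i by auto
      then have "s (i - k) \<in> {..<k + d}" by (rule PiE_mem[OF s])
      then show ?thesis using False i t_hi[of i] by simp
    qed
  qed
  then have "bij_betw t {..<k + d} {..<k + d}"
    using t_inj by (simp add: bij_betw_def endo_inj_surj)
  then have tp: "t permutes {..<k + d}"
    by (rule bij_imp_permutes) (simp add: t_def)
  have ts: "t (k + j) = s j" if "j < d" for j using that by (simp add: t_def)
  have s_undef: "s j = undefined" if "\<not> j < d" for j using s that by (auto simp: PiE_iff extensional_def)
  have "{t. t permutes {..<k + d} \<and> (\<lambda>j\<in>{..<d}. t (k + j)) = s} = (\<lambda>p. t \<circ> p) ` {p. p permutes {..<k}}"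
  proof (intro equalityI subsetI)
    fix u assume "u \<in> {t. t permutes {..<k + d} \<and> (\<lambda>j\<in>{..<d}. t (k + j)) = s}"
    then have u: "u permutes {..<k + d}" and us: "(\<lambda>j\<in>{..<d}. u (k + j)) = s" by auto
    have us': "u (k + j) = s j" if "j < d" for j
      using fun_cong[OF us, of j] that by simp
    define p where "p = inv_into UNIV t \<circ> u"
    have "p permutes {..<k + d}"
      unfolding p_def by (rule permutes_compose[OF u permutes_inv[OF tp]])
    moreover have "p i = i" if "i \<in> {..<k + d} - {..<k}" for i
    proof -
      define j where "j = i - k"
      have j: "i = k + j" "j < d" using that by (auto simp: j_def)
      then show ?thesis
        by (simp add: p_def us' ts[symmetric] permutes_inverses[OF tp])
    qed
    ultimately have "p permutes {..<k}" by (rule permutes_superset)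
    moreover have "u = t \<circ> p"
      by (simp add: p_def fun_eq_iff permutes_inverses[OF tp])
    ultimately show "u \<in> (\<lambda>p. t \<circ> p) ` {p. p permutes {..<k}}" by blast
  next
    fix u assume "u \<in> (\<lambda>p. t \<circ> p) ` {p. p permutes {..<k}}"
    then obtain p where p: "p permutes {..<k}" "u = t \<circ> p" by auto
    have "u permutes {..<k + d}"
      unfolding p(2) by (rule permutes_compose[OF permutes_subset[OF p(1)] tp]) auto
    moreover have "(\<lambda>j\<in>{..<d}. u (k + j)) = s"
      using p by (auto simp: fun_eq_iff permutes_not_in ts s_undef)
    ultimately show "u \<in> {t. t permutes {..<k + d} \<and> (\<lambda>j\<in>{..<d}. t (k + j)) = s}" by simp
  qed
  moreover have "inj (\<lambda>p. t \<circ> p)"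
    using permutes_inj[OF tp] by (auto simp: inj_def fun_eq_iff)
  moreover have "card (((\<circ>) t) ` {p. p permutes {..<k}}) = card {p. p permutes {..<k}}"
    by (rule card_image, rule inj_on_subset[OF \<open>inj (\<lambda>p. t \<circ> p)\<close> subset_UNIV])
  ultimately show ?thesis
    by (simp add: card_permutations[of _ k])
qed

text \<open>Every injective tuple is the last block of exactly \<open>k!\<close> permutations.
  Letting non-injective tuples contribute 0 turns the sum into one over a full product set, to which
  multilinearity applies.\<close>

lemma sum_permutes_last:
  fixes h :: "(nat \<Rightarrow> nat) \<Rightarrow> real"
  assumes "\<And>s. s \<in> {..<d} \<rightarrow>\<^sub>E {..<k + d} \<Longrightarrow> \<not> inj_on s {..<d} \<Longrightarrow> h s = 0"
  shows "(\<Sum>t | t permutes {..<k + d}. h (\<lambda>j\<in>{..<d}. t (k + j))) =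
    fact k * (\<Sum>s\<in>{..<d} \<rightarrow>\<^sub>E {..<k + d}. h s)"
proof -
  let ?r = "\<lambda>t. \<lambda>j\<in>{..<d}. t (k + j)"
  have "(\<Sum>t | t permutes {..<k + d}. h (?r t)) =
    (\<Sum>s\<in>{..<d} \<rightarrow>\<^sub>E {..<k + d}. \<Sum>t\<in>{t \<in> {t. t permutes {..<k + d}}. ?r t = s}. h (?r t))"
    by (rule sum.group[symmetric])
       (auto simp: finite_permutations finite_PiE permutes_lessThan_iff intro!: restrict_PiE_iff[THEN iffD2])
  also have "\<dots> = (\<Sum>s\<in>{..<d} \<rightarrow>\<^sub>E {..<k + d}. fact k * h s)"
  proof (rule sum.cong[OF refl])
    fix s assume s: "s \<in> {..<d} \<rightarrow>\<^sub>E {..<k + d}"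
    have "(\<Sum>t\<in>{t \<in> {t. t permutes {..<k + d}}. ?r t = s}. h (?r t)) =
      (\<Sum>t\<in>{t. t permutes {..<k + d} \<and> ?r t = s}. h s)"
      by (intro sum.cong) auto
    then show "(\<Sum>t\<in>{t \<in> {t. t permutes {..<k + d}}. ?r t = s}. h (?r t)) = fact k * h s"
      using assms[OF s] card_permutes_extending[OF s] by (cases "inj_on s {..<d}") auto
  qed
  finally show ?thesis by (simp add: sum_distrib_left)
qed

text \<open>Laplace expansion along the unit rows: permuting the columns by \<open>t\<close> puts
  their ones on the diagonal, so only permutations fixing the first block survive and the
  complementary minor is left.\<close>

lemma ndet_unit_rows:
  assumes t: "t permutes {..<k + d}"
  shows "ndet (k + d) (\<lambda>i b. if i < k then (if b = t i then 1 else 0) else F (i - k) b) =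
    of_int (sign t) * ndet d (\<lambda>i j. F i (t (k + j)))"
proof -
  let ?Y = "\<lambda>i b. if i < k then (if b = t i then 1 else 0) else F (i - k) b"
  have tinj: "t a = t b \<longleftrightarrow> a = b" for a b
    using permutes_inj[OF t] by (auto dest: injD)
  let ?Q = "\<lambda>p. of_int (sign p) * ((\<Prod>i<k. if p i = i then 1 else 0) * (\<Prod>j<d. F j (t (p (k + j)))))"
  have "ndet (k + d) (\<lambda>i b. ?Y i (t b)) = (\<Sum>p | p permutes {..<k + d}. ?Q p)"
    unfolding ndet_def prod_lessThan_add by (simp add: tinj)
  also have "\<dots> = (\<Sum>p\<in>{p. p permutes {..<k + d} \<and> (\<forall>i<k. p i = i)}. ?Q p)"
  proof (rule sum.mono_neutral_right)
    show "\<forall>p\<in>{p. p permutes {..<k + d}} - {p. p permutes {..<k + d} \<and> (\<forall>i<k. p i = i)}. ?Q p = 0"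
      by auto
  qed (auto simp: finite_permutations)
  also have "\<dots> = (\<Sum>p | p permutes {..<d}. ?Q (shift_perm k p))"
    unfolding shift_perm_image[symmetric]
    by (subst sum.reindex) (auto intro: inj_on_subset[OF inj_shift_perm])
  also have "\<dots> = (\<Sum>p | p permutes {..<d}. of_int (sign p) * (\<Prod>j<d. F j (t (k + p j))))"
    by (intro sum.cong refl)
       (use shift_perm_permutes_sign in \<open>auto simp: shift_perm_def[of k p i for p i]\<close>)
  finally have *: "ndet (k + d) (\<lambda>i b. ?Y i (t b)) = ndet d (\<lambda>i j. F i (t (k + j)))"
    by (simp add: ndet_def)
  have "ndet (k + d) (\<lambda>i b. ?Y i (t b)) = of_int (sign t) * ndet (k + d) ?Y"
    by (rule ndet_permute_columns[OF t])
  moreover have "real_of_int (sign t) * real_of_int (sign t) = 1"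
    by (simp flip: of_int_mult)
  ultimately have "ndet (k + d) ?Y = of_int (sign t) * ndet (k + d) (\<lambda>i b. ?Y i (t b))"
    by (simp only: mult.assoc[symmetric] mult_1)
  with * show ?thesis by (simp only:)
qed

text \<open>Jacobi's identity for complementary minors, in a form summed over all choices of
  columns. For fixed \<open>t\<close> the inner sum is the determinant of \<open>k\<close> columns
  of \<open>A\<close>, written as rows, stacked on the rows of \<open>F\<close>. The hypothesis
  factors this matrix as unit rows over \<open>F'\<close>, times the transpose of \<open>A\<close>,
  so the determinant of \<open>A\<close> splits off and a minor of \<open>F'\<close>
  remains.\<close>

lemma double_permutation_sum:
  fixes A F F' C :: "nat \<Rightarrow> nat \<Rightarrow> real"
  assumes F: "\<And>j a. j < d \<Longrightarrow> a < k + d \<Longrightarrow> F j a = (\<Sum>b<k + d. F' j b * A a b)"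
  shows "(\<Sum>t | t permutes {..<k + d}. of_int (sign t) * (\<Prod>j<d. C j (t (k + j))) *
      (\<Sum>s | s permutes {..<k + d}. of_int (sign s) *
        (\<Prod>i<k. A (s i) (t i)) * (\<Prod>j<d. F j (s (k + j))))) =
    fact k * ndet (k + d) A * ndet d (\<lambda>i j. \<Sum>a<k + d. F' i a * C j a)"
proof -
  have inner: "(\<Sum>s | s permutes {..<k + d}. of_int (sign s) *
        (\<Prod>i<k. A (s i) (t i)) * (\<Prod>j<d. F j (s (k + j)))) =
      of_int (sign t) * ndet d (\<lambda>i j. F' i (t (k + j))) * ndet (k + d) A"
    if t: "t permutes {..<k + d}" for t
  proof -
    let ?Y = "\<lambda>i b. if i < k then (if b = t i then 1 else 0) else F' (i - k) b"
    have "(\<Sum>s | s permutes {..<k + d}. of_int (sign s) *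
        (\<Prod>i<k. A (s i) (t i)) * (\<Prod>j<d. F j (s (k + j)))) =
      ndet (k + d) (\<lambda>i a. if i < k then A a (t i) else F (i - k) a)"
      unfolding ndet_def prod_lessThan_add by (simp add: mult.assoc)
    also have "\<dots> = ndet (k + d) (\<lambda>i a. \<Sum>b<k + d. ?Y i b * A a b)"
    proof (rule ndet_cong)
      fix i a assume i: "i < k + d" and a: "a < k + d"
      show "(if i < k then A a (t i) else F (i - k) a) = (\<Sum>b<k + d. ?Y i b * A a b)"
      proof (cases "i < k")
        case True
        then have "t i < k + d" using permutes_lessThan_iff[OF t] i by simp
        moreover have "(\<Sum>b<k + d. ?Y i b * A a b) = (\<Sum>b<k + d. if b = t i then A a b else 0)"
          using True by (intro sum.cong) auto
        ultimately show ?thesis using True by simp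
      next
        case False
        then show ?thesis using i a F[of "i - k" a] by simp
      qed
    qed
    also have "\<dots> = ndet (k + d) ?Y * ndet (k + d) A"
      by (simp add: ndet_mult[where B = "\<lambda>b a. A a b"] ndet_transpose[of _ A])
    finally show ?thesis by (simp add: ndet_unit_rows[OF t])
  qed
  let ?h = "\<lambda>s. (\<Prod>j<d. C j (s j)) * ndet d (\<lambda>i j. F' i (s j))"
  have "(\<Sum>t | t permutes {..<k + d}. of_int (sign t) * (\<Prod>j<d. C j (t (k + j))) *
      (\<Sum>s | s permutes {..<k + d}. of_int (sign s) *
        (\<Prod>i<k. A (s i) (t i)) * (\<Prod>j<d. F j (s (k + j))))) =
      (\<Sum>t | t permutes {..<k + d}. of_int (sign t * sign t) * (?h (\<lambda>j. t (k + j)) * ndet (k + d) A))"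
  proof (intro sum.cong refl)
    fix t assume "t \<in> {t. t permutes {..<k + d}}"
    then have t: "t permutes {..<k + d}" by simp
    show "of_int (sign t) * (\<Prod>j<d. C j (t (k + j))) *
        (\<Sum>s | s permutes {..<k + d}. of_int (sign s) *
          (\<Prod>i<k. A (s i) (t i)) * (\<Prod>j<d. F j (s (k + j)))) =
      of_int (sign t * sign t) * (?h (\<lambda>j. t (k + j)) * ndet (k + d) A)"
      unfolding inner[OF t] of_int_mult by (simp only: mult_ac)
  qed
  also have "\<dots> = (\<Sum>t | t permutes {..<k + d}. ?h (\<lambda>j\<in>{..<d}. t (k + j))) * ndet (k + d) A"
    unfolding sum_distrib_right
  proof (intro sum.cong refl)
    fix t
    have "ndet d (\<lambda>i j. F' i (t (k + j))) = ndet d (\<lambda>i j. F' i ((\<lambda>j\<in>{..<d}. t (k + j)) j))"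
      by (rule ndet_cong) simp
    then show "of_int (sign t * sign t) * (?h (\<lambda>j. t (k + j)) * ndet (k + d) A) =
        ?h (\<lambda>j\<in>{..<d}. t (k + j)) * ndet (k + d) A"
      by simp
  qed
  also have "(\<Sum>t | t permutes {..<k + d}. ?h (\<lambda>j\<in>{..<d}. t (k + j))) =
      fact k * (\<Sum>s\<in>{..<d} \<rightarrow>\<^sub>E {..<k + d}. ?h s)"
  proof (rule sum_permutes_last)
    fix s :: "nat \<Rightarrow> nat" assume "\<not> inj_on s {..<d}"
    then obtain a b where "a < d" "b < d" "a \<noteq> b" "s a = s b" by (auto simp: inj_on_def)
    then show "?h s = 0" using ndet_equal_columns[of a d b "\<lambda>i j. F' i (s j)"] by simp
  qed
  also have "(\<Sum>s\<in>{..<d} \<rightarrow>\<^sub>E {..<k + d}. ?h s) = ndet d (\<lambda>i j. \<Sum>a<k + d. F' i a * C j a)"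
    by (rule sum_PiE_prod_ndet) simp
  finally show ?thesis by (simp add: mult_ac)
qed

section \<open>Lattices with a basis\<close>

text \<open>Additivity is asked on the carrier only and with values in any ring, so that integral
  coordinates, real pairings and evaluations are treated alike without restricting them to
  extensional functions.\<close>

definition additive_map :: "('a, 'z) monoid_scheme \<Rightarrow> ('a \<Rightarrow> 'r::ring_1) \<Rightarrow> bool" where
  "additive_map A \<phi> \<longleftrightarrow> (\<forall>x\<in>carrier A. \<forall>y\<in>carrier A. \<phi> (x \<otimes>\<^bsub>A\<^esub> y) = \<phi> x + \<phi> y)"

lemma additive_mapD:
  "additive_map A \<phi> \<Longrightarrow> x \<in> carrier A \<Longrightarrow> y \<in> carrier A \<Longrightarrow> \<phi> (x \<otimes>\<^bsub>A\<^esub> y) = \<phi> x + \<phi> y"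
  by (simp add: additive_map_def)

lemma additive_map_comp_hom:
  "additive_map B \<phi> \<Longrightarrow> h \<in> hom A B \<Longrightarrow> additive_map A (\<lambda>x. \<phi> (h x))"
  by (auto simp: additive_map_def hom_def Pi_def)

lemma additive_map_of_int: "additive_map A \<phi> \<Longrightarrow> additive_map A (\<lambda>x. of_int (\<phi> x))"
  by (simp add: additive_map_def)

context comm_group
begin

lemma additive_map_one: "additive_map G \<phi> \<Longrightarrow> \<phi> \<one> = 0"
  using additive_mapD[of G \<phi> \<one> \<one>] by simp

lemma additive_map_inv: "additive_map G \<phi> \<Longrightarrow> x \<in> carrier G \<Longrightarrow> \<phi> (inv x) = - \<phi> x"
  using additive_mapD[of G \<phi> x "inv x"] by (simp add: additive_map_one add_eq_0_iff)

lemma additive_map_nat_pow: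
  assumes "additive_map G \<phi>" "x \<in> carrier G"
  shows "\<phi> (x [^] (k::nat)) = of_nat k * \<phi> x"
  by (induction k) (simp_all add: assms additive_map_one additive_mapD algebra_simps)

lemma additive_map_int_pow:
  assumes "additive_map G \<phi>" "x \<in> carrier G"
  shows "\<phi> (x [^] (k::int)) = of_int k * \<phi> x"
proof (cases k)
  case (nonneg m)
  then show ?thesis using assms by (simp add: int_pow_int additive_map_nat_pow)
next
  case (neg m)
  have "x [^] (- int (Suc m)) = inv (x [^] Suc m)"
    using assms(2) by (simp only: int_pow_neg int_pow_int)
  then show ?thesis
    using assms unfolding neg
    by (simp only: additive_map_inv additive_map_nat_pow nat_pow_closed) (simp add: algebra_simps)
qed

lemma additive_map_finprod:
  assumes "additive_map G \<phi>" "finite S" "f \<in> S \<rightarrow> carrier G"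
  shows "\<phi> (finprod G f S) = (\<Sum>i\<in>S. \<phi> (f i))"
  using assms(2,3)
proof (induction S rule: finite_induct)
  case (insert i S)
  then show ?case
    using assms(1) by (simp add: additive_mapD Pi_def)
qed (simp add: additive_map_one assms(1))

lemma additive_map_lincomb:
  assumes "additive_map G \<phi>" "b \<in> {..<n::nat} \<rightarrow> carrier G"
  shows "\<phi> (finprod G (\<lambda>i. b i [^] (k i :: int)) {..<n}) = (\<Sum>i<n. of_int (k i) * \<phi> (b i))"
proof -
  have "(\<lambda>i. b i [^] k i) \<in> {..<n} \<rightarrow> carrier G" using assms(2) by auto
  then show ?thesis
    using assms by (simp add: additive_map_finprod additive_map_int_pow Pi_def)
qed

end

lemma hom_finprod:
  assumes "comm_group A" "comm_group B" "h \<in> hom A B" "finite S" "f \<in> S \<rightarrow> carrier A"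
  shows "h (finprod A f S) = finprod B (\<lambda>i. h (f i)) S"
proof -
  interpret A: comm_group A by fact
  interpret B: comm_group B by fact
  show ?thesis
    using assms(4,5)
  proof (induction S rule: finite_induct)
    case empty
    then show ?case using assms(3) A.is_group B.is_group by (simp add: hom_one)
  next
    case (insert i S)
    then have "f i \<in> carrier A" "finprod A f S \<in> carrier A" by (auto simp: Pi_def)
    moreover have "(\<lambda>i. h (f i)) \<in> S \<rightarrow> carrier B" "h (f i) \<in> carrier B"
      using insert.prems assms(3) by (auto simp: hom_def Pi_def)
    ultimately show ?case
      using insert assms(3) by (simp add: hom_mult Pi_def)
  qed
qed

text \<open>Uniqueness of the coefficients is tested by a family \<Phi> of real functionals, which
  turns it into a linear system over the reals: two expansions of \<open>x\<close> have the same
  values under every functional.\<close>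

lemma lattice_basisI:
  assumes "comm_group A" and b: "b \<in> {..<n} \<rightarrow> carrier A"
    and span: "\<And>x. x \<in> carrier A \<Longrightarrow> \<exists>k. x = finprod A (\<lambda>i. b i [^]\<^bsub>A\<^esub> (k i :: int)) {..<n}"
    and \<Phi>: "\<And>\<phi>. \<phi> \<in> \<Phi> \<Longrightarrow> additive_map A (\<phi> :: 'a \<Rightarrow> real)"
    and sep: "\<And>k i. (\<And>\<phi>. \<phi> \<in> \<Phi> \<Longrightarrow> (\<Sum>i<n. of_int (k i) * \<phi> (b i)) = 0) \<Longrightarrow> i < n \<Longrightarrow> k i = (0 :: int)"
  shows "lattice_basis A n b"
  unfolding lattice_basis_def
proof (intro conjI ballI b)
  interpret comm_group A by fact
  fix x assume x: "x \<in> carrier A"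
  obtain k where k: "x = finprod A (\<lambda>i. b i [^]\<^bsub>A\<^esub> (k i :: int)) {..<n}"
    using span[OF x] by auto
  show "\<exists>!k. k \<in> {..<n} \<rightarrow>\<^sub>E (UNIV :: int set) \<and> x = finprod A (\<lambda>i. b i [^]\<^bsub>A\<^esub> k i) {..<n}"
  proof (rule ex1I[of _ "restrict k {..<n}"])
    have "finprod A (\<lambda>i. b i [^]\<^bsub>A\<^esub> restrict k {..<n} i) {..<n} = x"
      unfolding k using b by (intro finprod_cong') auto
    then show "restrict k {..<n} \<in> {..<n} \<rightarrow>\<^sub>E UNIV \<and> x = finprod A (\<lambda>i. b i [^]\<^bsub>A\<^esub> restrict k {..<n} i) {..<n}"
      by simp
    fix l assume l: "l \<in> {..<n} \<rightarrow>\<^sub>E (UNIV :: int set) \<and> x = finprod A (\<lambda>i. b i [^]\<^bsub>A\<^esub> l i) {..<n}"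
    have "l i - k i = 0" if "i < n" for i
    proof (rule sep[OF _ that])
      fix \<phi> assume "\<phi> \<in> \<Phi>"
      then have "\<phi> x = (\<Sum>i<n. of_int (k i) * \<phi> (b i))" "\<phi> x = (\<Sum>i<n. of_int (l i) * \<phi> (b i))"
        using additive_map_lincomb[OF \<Phi> b] k l by metis+
      then show "(\<Sum>i<n. of_int (l i - k i) * \<phi> (b i)) = 0"
        by (simp add: algebra_simps sum_subtractf)
    qed
    then show "l = restrict k {..<n}"
      using l by (auto simp: PiE_iff extensional_def restrict_def)
  qed
qed

definition coord :: "'a monoid \<Rightarrow> nat \<Rightarrow> (nat \<Rightarrow> 'a) \<Rightarrow> 'a \<Rightarrow> nat \<Rightarrow> int" where
  "coord A n b x = (THE k. k \<in> {..<n} \<rightarrow>\<^sub>E UNIV \<and> x = finprod A (\<lambda>i. b i [^]\<^bsub>A\<^esub> k i) {..<n})"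

locale based_lattice = comm_group A for A :: "'a monoid" (structure) +
  fixes n :: nat and b :: "nat \<Rightarrow> 'a"
  assumes basis: "lattice_basis A n b"
begin

lemma basis_closed: "b \<in> {..<n} \<rightarrow> carrier A"
  using basis by (simp add: lattice_basis_def)

lemma basis_mem: "i < n \<Longrightarrow> b i \<in> carrier A"
  using basis_closed by auto

lemma coord_expand:
  assumes "x \<in> carrier A"
  shows "coord A n b x \<in> {..<n} \<rightarrow>\<^sub>E UNIV"
    and "x = finprod A (\<lambda>i. b i [^] coord A n b x i) {..<n}"
  using theI'[of "\<lambda>k. k \<in> {..<n} \<rightarrow>\<^sub>E (UNIV :: int set) \<and> x = finprod A (\<lambda>i. b i [^] k i) {..<n}"]
    basis assms by (auto simp: lattice_basis_def coord_def)

lemma lincomb_mem: "finprod A (\<lambda>i. b i [^] (k i :: int)) {..<n} \<in> carrier A"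
  using basis_closed by (intro finprod_closed) auto

lemma coord_lincomb:
  assumes "i < n"
  shows "coord A n b (finprod A (\<lambda>i. b i [^] (k i :: int)) {..<n}) i = k i"
proof -
  let ?x = "finprod A (\<lambda>i. b i [^] (k i :: int)) {..<n}"
  have "?x = finprod A (\<lambda>i. b i [^] restrict k {..<n} i) {..<n}"
    using basis_closed by (intro finprod_cong') auto
  moreover have "\<exists>!l. l \<in> {..<n} \<rightarrow>\<^sub>E (UNIV :: int set) \<and> ?x = finprod A (\<lambda>i. b i [^] l i) {..<n}"
    using basis lincomb_mem[of k] unfolding lattice_basis_def by blast
  ultimately have "coord A n b ?x = restrict k {..<n}"
    unfolding coord_def by (intro the1_equality) auto
  then show ?thesis using assms by simp
qed

lemma coord_additive:
  assumes "i < n"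
  shows "additive_map A (\<lambda>x. coord A n b x i)"
  unfolding additive_map_def
proof (intro ballI)
  fix x y assume xy: "x \<in> carrier A" "y \<in> carrier A"
  have "x \<otimes> y = finprod A (\<lambda>i. b i [^] coord A n b x i) {..<n} \<otimes> finprod A (\<lambda>i. b i [^] coord A n b y i) {..<n}"
    using coord_expand[OF xy(1)] coord_expand[OF xy(2)] by simp
  also have "\<dots> = finprod A (\<lambda>i. b i [^] coord A n b x i \<otimes> b i [^] coord A n b y i) {..<n}"
    using basis_closed by (intro finprod_multf[symmetric]) auto
  also have "\<dots> = finprod A (\<lambda>i. b i [^] (coord A n b x i + coord A n b y i)) {..<n}"
    using basis_closed by (intro finprod_cong') (auto simp: int_pow_mult basis_mem)
  finally show "coord A n b (x \<otimes> y) i = coord A n b x i + coord A n b y i"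
    using coord_lincomb[OF assms] by simp
qed

lemma coord_basis:
  assumes "i < n" "j < n"
  shows "coord A n b (b j) i = (if i = j then 1 else 0)"
proof -
  have "finprod A (\<lambda>i. b i [^] (if i = j then 1 else 0 :: int)) {..<n} =
      finprod A (\<lambda>i. if j = i then b i else \<one>) {..<n}"
    using basis_closed by (intro finprod_cong') (auto simp: basis_mem)
  also have "\<dots> = b j"
    using assms basis_closed by (intro finprod_singleton) auto
  finally show ?thesis
    using coord_lincomb[OF assms(1), of "\<lambda>i. if i = j then 1 else 0"] by simp
qed

lemma additive_map_expand:
  assumes "additive_map A \<phi>" "x \<in> carrier A"
  shows "\<phi> x = (\<Sum>i<n. of_int (coord A n b x i) * \<phi> (b i))"
  using additive_map_lincomb[OF assms(1) basis_closed, of "coord A n b x"] coord_expand(2)[OF assms(2)]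
  by simp

lemma countable_carrier: "countable (carrier A)"
proof -
  have "carrier A \<subseteq> (\<lambda>k. finprod A (\<lambda>i. b i [^] (k i :: int)) {..<n}) ` ({..<n} \<rightarrow>\<^sub>E UNIV)"
    using coord_expand by blast
  moreover have "countable ({..<n} \<rightarrow>\<^sub>E (UNIV :: int set))"
    by (rule countable_PiE) auto
  ultimately show ?thesis
    by (meson countable_image countable_subset)
qed

end

text \<open>The identity tr(gf) = tr(fg) for lattices that may differ in rank; both sides expand to
  the same double sum of matrix entries. It gives the invariance of the rank, by way of identity
  maps, and later the genus formula.\<close>

lemma lattice_trace:
  assumes "based_lattice A n a" "based_lattice B m b" and f: "f \<in> hom A B" and g: "g \<in> hom B A"
  shows "(\<Sum>i<n. coord A n a (g (f (a i))) i) = (\<Sum>j<m. coord B m b (f (g (b j))) j)"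
proof -
  interpret A: based_lattice A n a by fact
  interpret B: based_lattice B m b by fact
  have "(\<Sum>i<n. coord A n a (g (f (a i))) i) =
      (\<Sum>i<n. \<Sum>j<m. coord B m b (f (a i)) j * coord A n a (g (b j)) i)"
  proof (rule sum.cong[OF refl])
    fix i assume i: "i \<in> {..<n}"
    then have "additive_map B (\<lambda>y. coord A n a (g y) i)"
      using additive_map_comp_hom[OF A.coord_additive g] by simp
    moreover have "f (a i) \<in> carrier B" using f i A.basis_mem by (auto simp: hom_def)
    ultimately show "coord A n a (g (f (a i))) i = (\<Sum>j<m. coord B m b (f (a i)) j * coord A n a (g (b j)) i)"
      using B.additive_map_expand by fastforce
  qed
  also have "\<dots> = (\<Sum>j<m. \<Sum>i<n. coord A n a (g (b j)) i * coord B m b (f (a i)) j)"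
    by (subst sum.swap) (simp add: mult.commute)
  also have "\<dots> = (\<Sum>j<m. coord B m b (f (g (b j))) j)"
  proof (rule sum.cong[OF refl])
    fix j assume j: "j \<in> {..<m}"
    then have "additive_map A (\<lambda>x. coord B m b (f x) j)"
      using additive_map_comp_hom[OF B.coord_additive f] by simp
    moreover have "g (b j) \<in> carrier A" using g j B.basis_mem by (auto simp: hom_def)
    ultimately show "(\<Sum>i<n. coord A n a (g (b j)) i * coord B m b (f (a i)) j) = coord B m b (f (g (b j))) j"
      using A.additive_map_expand by fastforce
  qed
  finally show ?thesis .
qed

lemma lattice_rank_eqI:
  assumes "based_lattice A n a"
  shows "lattice_rank A = n"
  unfolding lattice_rank_def
proof (rule the_equality)
  interpret A: based_lattice A n a by fact
  show "\<exists>b. lattice_basis A n b" using A.basis by blast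
  fix m assume "\<exists>b. lattice_basis A m b"
  then obtain b where b: "lattice_basis A m b" ..
  interpret B: based_lattice A m b by unfold_locales (rule b)
  have "(\<lambda>x. x) \<in> hom A A" by (simp add: hom_def)
  then have "(\<Sum>i<n. coord A n a (a i) i) = (\<Sum>j<m. coord A m b (b j) j)"
    using lattice_trace[OF assms B.based_lattice_axioms] by blast
  then have "int n = int m" by (simp add: A.coord_basis B.coord_basis)
  then show "m = n" by simp
qed

section \<open>Unimodular base change and dual lattices\<close>

lemma ndet_unimodular:
  fixes P Q :: "nat \<Rightarrow> nat \<Rightarrow> int"
  assumes "\<And>i j. i < n \<Longrightarrow> j < n \<Longrightarrow> (\<Sum>k<n. P i k * Q k j) = (if i = j then 1 else 0)"
  shows "ndet n (\<lambda>i j. of_int (P i j)) = 1 \<or> ndet n (\<lambda>i j. of_int (P i j)) = - 1"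
proof -
  let ?P = "\<lambda>i j. real_of_int (P i j)" and ?Q = "\<lambda>i j. real_of_int (Q i j)"
  have "ndet n ?P * ndet n ?Q = ndet n (\<lambda>i j. \<Sum>k<n. ?P i k * ?Q k j)"
    by (rule ndet_mult[symmetric])
  also have "\<dots> = ndet n (\<lambda>i j. if i = j then 1 else 0)"
  proof (rule ndet_cong)
    fix i j assume "i < n" "j < n"
    then have "real_of_int (\<Sum>k<n. P i k * Q k j) = real_of_int (if i = j then 1 else 0)"
      using assms by presburger
    then show "(\<Sum>k<n. ?P i k * ?Q k j) = (if i = j then 1 else 0)" by simp
  qed
  finally have 1: "ndet n ?P * ndet n ?Q = 1" by (simp add: ndet_identity)
  have "ndet n ?P \<in> \<int>" "ndet n ?Q \<in> \<int>" by (auto intro!: ndet_Ints)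
  then obtain p q where pq: "ndet n ?P = of_int p" "ndet n ?Q = of_int q" by (auto elim!: Ints_cases)
  with 1 have "p * q = 1" by (metis of_int_eq_1_iff of_int_mult)
  then show ?thesis using pq by (auto simp: zmult_eq_1_iff)
qed

lemma ndet_change_of_basis:
  assumes "based_lattice A n a" "based_lattice A n b"
  shows "ndet n (\<lambda>i j. of_int (coord A n b (a i) j)) = 1 \<or> ndet n (\<lambda>i j. of_int (coord A n b (a i) j)) = - 1"
proof (rule ndet_unimodular)
  interpret A: based_lattice A n a by fact
  interpret B: based_lattice A n b by fact
  fix i j assume ij: "i < n" "j < n"
  have "coord A n a (a i) j = (\<Sum>k<n. coord A n b (a i) k * coord A n a (b k) j)"
    using B.additive_map_expand[OF A.coord_additive[OF ij(2)] A.basis_mem[OF ij(1)]] by simp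
  then show "(\<Sum>k<n. coord A n b (a i) k * coord A n a (b k) j) = (if i = j then 1 else 0)"
    using ij by (auto simp: A.coord_basis)
qed

lemma lattice_iso:
  assumes "based_lattice A n a" "comm_group B" and h: "h \<in> iso A B"
  shows "based_lattice B n (\<lambda>i. h (a i))"
proof -
  interpret A: based_lattice A n a by fact
  interpret B: comm_group B by fact
  have hom: "h \<in> hom A B" and bij: "bij_betw h (carrier A) (carrier B)"
    using h by (auto simp: iso_def)
  define g where "g = inv_into (carrier A) h"
  have g: "g \<in> hom B A"
    using A.iso_set_sym[OF h] by (auto simp: iso_def g_def)
  have gh: "g (h x) = x" if "x \<in> carrier A" for x
    using that bij by (auto simp: g_def bij_betw_def)
  have hmem: "h x \<in> carrier B" if "x \<in> carrier A" for x
    using that hom by (auto simp: hom_def)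
  have "lattice_basis B n (\<lambda>i. h (a i))"
  proof (rule lattice_basisI[where \<Phi> = "(\<lambda>i y. real_of_int (coord A n a (g y) i)) ` {..<n}"])
    show "comm_group B" by fact
    show "(\<lambda>i. h (a i)) \<in> {..<n} \<rightarrow> carrier B" using A.basis_mem hmem by auto
    fix y assume "y \<in> carrier B"
    then obtain x where x: "x \<in> carrier A" "y = h x" using bij by (auto simp: bij_betw_def)
    have "y = h (finprod A (\<lambda>i. a i [^]\<^bsub>A\<^esub> coord A n a x i) {..<n})"
      using A.coord_expand(2)[OF x(1)] x(2) by simp
    also have "\<dots> = finprod B (\<lambda>i. h (a i [^]\<^bsub>A\<^esub> coord A n a x i)) {..<n}"
      using A.basis_closed by (intro hom_finprod A.comm_group_axioms B.comm_group_axioms hom) auto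
    also have "\<dots> = finprod B (\<lambda>i. h (a i) [^]\<^bsub>B\<^esub> coord A n a x i) {..<n}"
      using A.basis_mem hmem
      by (intro B.finprod_cong') (auto simp: hom_int_pow[OF hom _ A.is_group B.is_group])
    finally show "\<exists>k. y = finprod B (\<lambda>i. h (a i) [^]\<^bsub>B\<^esub> (k i :: int)) {..<n}" by blast
  next
    fix \<phi> assume "\<phi> \<in> (\<lambda>i y. real_of_int (coord A n a (g y) i)) ` {..<n}"
    then show "additive_map B \<phi>"
      using additive_map_comp_hom[OF additive_map_of_int[OF A.coord_additive] g] by auto
  next
    fix k :: "nat \<Rightarrow> int" and i
    assume *: "\<And>\<phi>. \<phi> \<in> (\<lambda>i y. real_of_int (coord A n a (g y) i)) ` {..<n} \<Longrightarrow>
        (\<Sum>i<n. real_of_int (k i) * \<phi> (h (a i))) = 0" and i: "i < n"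
    have "(\<Sum>j<n. real_of_int (k j) * real_of_int (coord A n a (g (h (a j))) i)) = 0"
      using *[of "\<lambda>y. real_of_int (coord A n a (g y) i)"] i by auto
    also have "(\<Sum>j<n. real_of_int (k j) * real_of_int (coord A n a (g (h (a j))) i)) =
        (\<Sum>j<n. if i = j then real_of_int (k j) else 0)"
      using i by (intro sum.cong) (auto simp: gh A.basis_mem A.coord_basis)
    finally show "k i = 0" using i by simp
  qed
  then show ?thesis by unfold_locales
qed

lemma comm_group_int_dual:
  assumes "comm_group A"
  shows "comm_group (int_dual A)"
proof (rule comm_groupI)
  interpret comm_group A by fact
  have mem: "f \<in> carrier (int_dual A) \<longleftrightarrow> f \<in> extensional (carrier A) \<and>
      (\<forall>x\<in>carrier A. \<forall>y\<in>carrier A. f (x \<otimes>\<^bsub>A\<^esub> y) = f x + f y)" for f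
    by (auto simp: int_dual_def hom_def)
  show "\<exists>y\<in>carrier (int_dual A). y \<otimes>\<^bsub>int_dual A\<^esub> x = \<one>\<^bsub>int_dual A\<^esub>" if "x \<in> carrier (int_dual A)" for x
  proof
    show "(\<lambda>a\<in>carrier A. - x a) \<in> carrier (int_dual A)" using that by (auto simp: mem)
  qed (auto simp: int_dual_def)
qed (use assms in \<open>auto simp: int_dual_def hom_def fun_eq_iff extensional_def comm_group_def comm_monoid_def
    group_def monoid.m_closed monoid.one_closed\<close>)

lemma comm_group_real_dual:
  assumes "comm_group A"
  shows "comm_group (real_dual A)"
proof (rule comm_groupI)
  interpret comm_group A by fact
  show "\<exists>y\<in>carrier (real_dual A). y \<otimes>\<^bsub>real_dual A\<^esub> x = \<one>\<^bsub>real_dual A\<^esub>" if "x \<in> carrier (real_dual A)" for x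
    using that by (intro bexI[of _ "\<lambda>a\<in>carrier A. - x a"]) (auto simp: real_dual_def)
qed (use assms in \<open>auto simp: real_dual_def fun_eq_iff extensional_def comm_group_def comm_monoid_def
    group_def monoid.m_closed monoid.one_closed\<close>)

lemma int_dual_mem:
  "f \<in> carrier (int_dual A) \<longleftrightarrow> f \<in> extensional (carrier A) \<and> additive_map A f"
  by (auto simp: int_dual_def hom_def additive_map_def)

lemma real_dual_mem:
  "f \<in> carrier (real_dual A) \<longleftrightarrow> f \<in> extensional (carrier A) \<and> additive_map A f"
  by (auto simp: real_dual_def additive_map_def)

lemma additive_map_int_dual_eval: "x \<in> carrier A \<Longrightarrow> additive_map (int_dual A) (\<lambda>f. f x)"
  by (auto simp: additive_map_def int_dual_def)

lemma additive_map_cong_restrict: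
  "comm_group A \<Longrightarrow> additive_map A f \<Longrightarrow> additive_map A (\<lambda>x\<in>carrier A. f x)"
  by (auto simp: additive_map_def comm_group_def comm_monoid_def group_def monoid.m_closed)

lemma (in based_lattice) lattice_int_dual:
  "based_lattice (int_dual A) n (\<lambda>i. \<lambda>x\<in>carrier A. coord A n b x i)" (is "based_lattice _ _ ?d")
proof -
  have cg: "comm_group (int_dual A)" by (rule comm_group_int_dual) unfold_locales
  interpret D: comm_group "int_dual A" by (rule cg)
  have d: "?d \<in> {..<n} \<rightarrow> carrier (int_dual A)"
    using additive_map_cong_restrict[OF comm_group_axioms coord_additive] by (auto simp: int_dual_mem)
  have "lattice_basis (int_dual A) n ?d"
  proof (rule lattice_basisI[where \<Phi> = "(\<lambda>j f. real_of_int (f (b j))) ` {..<n}", OF cg d])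
    fix f assume f: "f \<in> carrier (int_dual A)"
    let ?g = "finprod (int_dual A) (\<lambda>i. ?d i [^]\<^bsub>int_dual A\<^esub> f (b i)) {..<n}"
    have "(\<lambda>i. ?d i [^]\<^bsub>int_dual A\<^esub> f (b i)) \<in> {..<n} \<rightarrow> carrier (int_dual A)"
      using d by auto
    then have g: "?g \<in> carrier (int_dual A)" by (rule D.finprod_closed)
    have "f x = ?g x" if x: "x \<in> carrier A" for x
      using D.additive_map_lincomb[OF additive_map_int_dual_eval[OF x] d, of "\<lambda>i. f (b i)"] x
        additive_map_expand[of f x] f
      by (simp add: int_dual_mem mult.commute)
    moreover have "f \<in> extensional (carrier A)" "?g \<in> extensional (carrier A)"
      using f g by (simp_all add: int_dual_mem)
    ultimately have "f = ?g" by (intro extensionalityI)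
    then show "\<exists>k. f = finprod (int_dual A) (\<lambda>i. ?d i [^]\<^bsub>int_dual A\<^esub> (k i :: int)) {..<n}"
      by (rule exI[of _ "\<lambda>i. f (b i)"])
  next
    fix \<phi> assume "\<phi> \<in> (\<lambda>j f. real_of_int (f (b j))) ` {..<n}"
    then show "additive_map (int_dual A) \<phi>"
      using additive_map_of_int[OF additive_map_int_dual_eval[OF basis_mem]] by auto
  next
    fix k :: "nat \<Rightarrow> int" and i
    assume *: "\<And>\<phi>. \<phi> \<in> (\<lambda>j f. real_of_int (f (b j))) ` {..<n} \<Longrightarrow>
        (\<Sum>i<n. real_of_int (k i) * \<phi> (?d i)) = 0" and i: "i < n"
    have "(\<Sum>j<n. real_of_int (k j) * real_of_int (?d j (b i))) = 0"
      using *[of "\<lambda>f. real_of_int (f (b i))"] i by auto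
    also have "(\<Sum>j<n. real_of_int (k j) * real_of_int (?d j (b i))) =
        (\<Sum>j<n. if i = j then real_of_int (k j) else 0)"
      using i by (intro sum.cong) (auto simp: basis_mem coord_basis)
    finally show "k i = 0" using i by simp
  qed
  then show ?thesis by unfold_locales
qed

section \<open>Lattices of integral chains, a common form for cycles and Prym forms\<close>

definition frag_group :: "('e \<Rightarrow>\<^sub>0 int) set \<Rightarrow> ('e \<Rightarrow>\<^sub>0 int) monoid" where
  "frag_group C = \<lparr>carrier = C, monoid.mult = (+), one = 0\<rparr>"

lemma frag_group_simps [simp]:
  "carrier (frag_group C) = C" "x \<otimes>\<^bsub>frag_group C\<^esub> y = x + y" "\<one>\<^bsub>frag_group C\<^esub> = 0"
  by (simp_all add: frag_group_def)

definition frag_subgroup :: "('e \<Rightarrow>\<^sub>0 int) set \<Rightarrow> bool" where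
  "frag_subgroup C \<longleftrightarrow> 0 \<in> C \<and> (\<forall>x\<in>C. \<forall>y\<in>C. x + y \<in> C) \<and> (\<forall>x\<in>C. - x \<in> C)"

lemma comm_group_frag_group: "frag_subgroup C \<Longrightarrow> comm_group (frag_group C)"
  by (rule comm_groupI) (auto simp: frag_subgroup_def add_ac intro!: bexI[of _ "- _"])

lemma frag_subgroup_cmul:
  assumes "frag_subgroup C" "x \<in> C"
  shows "frag_cmul k x \<in> C"
proof -
  have nat: "frag_cmul (int m) x \<in> C" for m
    using assms by (induction m) (auto simp: frag_subgroup_def frag_cmul_distrib)
  show ?thesis
  proof (cases k)
    case (neg m)
    have "frag_cmul k x = - frag_cmul (int (Suc m)) x" unfolding neg by (simp only: minus_frag_cmul)
    then show ?thesis using nat[of "Suc m"] assms by (simp only: frag_subgroup_def)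
  qed (use nat in simp)
qed

lemma additive_map_lookup: "additive_map (frag_group C) (\<lambda>c. Poly_Mapping.lookup c e)"
  by (simp add: additive_map_def lookup_add)

lemma frag_group_lincomb:
  assumes "frag_subgroup C" "b \<in> {..<n::nat} \<rightarrow> C"
  shows "finprod (frag_group C) (\<lambda>i. b i [^]\<^bsub>frag_group C\<^esub> (k i :: int)) {..<n} = (\<Sum>i<n. frag_cmul (k i) (b i))"
proof (rule poly_mapping_eqI)
  fix e
  interpret comm_group "frag_group C" by (rule comm_group_frag_group[OF assms(1)])
  show "Poly_Mapping.lookup (finprod (frag_group C) (\<lambda>i. b i [^]\<^bsub>frag_group C\<^esub> (k i :: int)) {..<n}) e =
      Poly_Mapping.lookup (\<Sum>i<n. frag_cmul (k i) (b i)) e"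
    using additive_map_lincomb[OF additive_map_lookup[of C e], of b n k] assms(2)
    by (simp add: lookup_sum)
qed

text \<open>Independence is required for real coefficients, because the positivity of the Gram
  matrix is tested on real vectors.\<close>

definition frag_basis :: "('e \<Rightarrow>\<^sub>0 int) set \<Rightarrow> nat \<Rightarrow> (nat \<Rightarrow> 'e \<Rightarrow>\<^sub>0 int) \<Rightarrow> bool" where
  "frag_basis C n b \<longleftrightarrow>
    (\<forall>i<n. b i \<in> C) \<and> (\<forall>x\<in>C. \<exists>k. x = (\<Sum>i<n. frag_cmul (k i) (b i))) \<and>
    (\<forall>y::nat \<Rightarrow> real. (\<forall>e. (\<Sum>i<n. y i * of_int (Poly_Mapping.lookup (b i) e)) = 0) \<longrightarrow> (\<forall>i<n. y i = 0))"

text \<open>Subgroups of free abelian groups are free, by peeling off one edge \<open>e\<close>: the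
  elements vanishing at \<open>e\<close> have a basis by induction, and an element \<open>a\<close>
  with the least positive coefficient \<open>d\<close> at \<open>e\<close> completes it.\<close>

lemma frag_subgroup_basis:
  assumes "finite E" "frag_subgroup C" "(\<Union>c\<in>C. Poly_Mapping.keys c) \<subseteq> E"
  shows "\<exists>n b. frag_basis C n b"
  using assms
proof (induction E arbitrary: C rule: finite_induct)
  case empty
  then have "C = {0}" by (auto simp: frag_subgroup_def)
  then show ?case by (intro exI[of _ 0]) (auto simp: frag_basis_def)
next
  case (insert e E)
  define C' where "C' = {c \<in> C. Poly_Mapping.lookup c e = 0}"
  have sub: "frag_subgroup C'"
    using insert.prems(1) by (auto simp: frag_subgroup_def C'_def lookup_add)
  have keys: "(\<Union>c\<in>C'. Poly_Mapping.keys c) \<subseteq> E"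
    using insert.prems(2) by (auto simp: C'_def in_keys_iff)
  obtain n b where IH: "frag_basis C' n b"
    using insert.IH[OF sub keys] by blast
  have b: "\<And>i. i < n \<Longrightarrow> b i \<in> C'" and span: "\<And>x. x \<in> C' \<Longrightarrow> \<exists>k. x = (\<Sum>i<n. frag_cmul (k i) (b i))"
    using IH by (simp_all add: frag_basis_def)
  have ind: "y i = 0" if "\<And>e. (\<Sum>i<n. y i * real_of_int (Poly_Mapping.lookup (b i) e)) = 0" "i < n" for y i
    using IH that by (simp add: frag_basis_def)
  show ?case
  proof (cases "\<forall>c\<in>C. Poly_Mapping.lookup c e = 0")
    case True
    then have "C' = C" by (auto simp: C'_def)
    then show ?thesis using IH by blast
  next
    case False
    then obtain c where c: "c \<in> C" "Poly_Mapping.lookup c e \<noteq> 0" by auto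
    define P where "P = (\<lambda>d::nat. d > 0 \<and> (\<exists>a\<in>C. Poly_Mapping.lookup a e = int d))"
    have "\<exists>d. P d"
    proof (cases "Poly_Mapping.lookup c e > 0")
      case True
      then show ?thesis using c by (intro exI[of _ "nat (Poly_Mapping.lookup c e)"]) (auto simp: P_def)
    next
      case False
      moreover have "- c \<in> C" using c insert.prems(1) by (simp add: frag_subgroup_def)
      ultimately show ?thesis
        using c by (intro exI[of _ "nat (- Poly_Mapping.lookup c e)"]) (auto simp: P_def intro!: bexI[of _ "- c"])
    qed
    then have P': "P (LEAST d. P d)" by (rule LeastI_ex)
    define d where "d = (LEAST d. P d)"
    have P: "P d" unfolding d_def by (rule P')
    obtain a where a: "a \<in> C" "Poly_Mapping.lookup a e = int d" and d: "d > 0"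
      using P unfolding P_def by blast
    have least: "d \<le> d'" if "P d'" for d'
      unfolding d_def using that by (rule Least_le)
    define b' where "b' = b(n := a)"
    have b': "b' n = a" "\<And>i. i < n \<Longrightarrow> b' i = b i" by (auto simp: b'_def)
    show ?thesis
      unfolding frag_basis_def
    proof (intro exI[of _ "Suc n"] exI[of _ b'] conjI ballI allI impI)
      fix i assume "i < Suc n"
      then show "b' i \<in> C" using b a by (auto simp: b'_def C'_def)
    next
      fix x assume x: "x \<in> C"
      \<comment> \<open>Division with remainder: removing \<open>q\<close> copies of
        \<open>a\<close> leaves at \<open>e\<close> a coefficient in \<open>{0..<int d}\<close>,
        which the minimality of \<open>d\<close> forces to be 0.\<close>
      define q where "q = Poly_Mapping.lookup x e div int d"
      define r where "r = x - frag_cmul q a"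
      have "frag_cmul (- q) a \<in> C"
        by (rule frag_subgroup_cmul[OF insert.prems(1) a(1)])
      moreover have "r = x + frag_cmul (- q) a"
        by (simp only: r_def diff_conv_add_uminus minus_frag_cmul[symmetric])
      ultimately have rC: "r \<in> C"
        using x insert.prems(1) by (simp only: frag_subgroup_def)
      have "Poly_Mapping.lookup r e = Poly_Mapping.lookup x e - q * int d"
        unfolding r_def lookup_minus lookup_frag_cmul a(2) ..
      also have "\<dots> = Poly_Mapping.lookup x e mod int d"
        unfolding q_def by (rule minus_div_mult_eq_mod)
      finally have re: "Poly_Mapping.lookup r e = Poly_Mapping.lookup x e mod int d" .
      have "Poly_Mapping.lookup r e = 0"
      proof (rule ccontr)
        assume "Poly_Mapping.lookup r e \<noteq> 0"
        moreover have "0 \<le> Poly_Mapping.lookup r e" using d by (simp add: re)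
        ultimately have "Poly_Mapping.lookup r e > 0" by linarith
        then have "P (nat (Poly_Mapping.lookup r e))" using rC by (auto simp: P_def)
        then have "d \<le> nat (Poly_Mapping.lookup r e)" by (rule least)
        moreover have "Poly_Mapping.lookup r e < int d" using re d by simp
        ultimately show False using \<open>Poly_Mapping.lookup r e > 0\<close> by (simp add: le_nat_iff)
      qed
      then have "r \<in> C'" using rC by (simp add: C'_def)
      then obtain k where k: "r = (\<Sum>i<n. frag_cmul (k i) (b i))" using span by blast
      have "x = (\<Sum>i<Suc n. frag_cmul ((k(n := q)) i) (b' i))"
        using k by (simp add: r_def b' algebra_simps)
      then show "\<exists>k. x = (\<Sum>i<Suc n. frag_cmul (k i) (b' i))" by blast
    next
      fix y :: "nat \<Rightarrow> real" and i
      assume y: "\<forall>e. (\<Sum>i<Suc n. y i * real_of_int (Poly_Mapping.lookup (b' i) e)) = 0" and i: "i < Suc n"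
      \<comment> \<open>Only the new basis element is non-zero at \<open>e\<close>, so the relation
        at \<open>e\<close> isolates its coefficient \<open>y n\<close>.\<close>
      have "(\<Sum>i<n. y i * real_of_int (Poly_Mapping.lookup (b i) e)) = 0"
        using b by (intro sum.neutral) (auto simp: C'_def)
      then have yn: "y n = 0"
        using spec[OF y, of e] d by (simp add: b' a(2))
      then have "(\<Sum>i<n. y i * real_of_int (Poly_Mapping.lookup (b i) e)) = 0" for e
        using spec[OF y, of e] by (simp add: b')
      then show "y i = 0" using ind[of y i] i yn by (cases "i = n") auto
    qed
  qed
qed

lemma frag_group_lattice:
  assumes "finite E" "frag_subgroup C" "(\<Union>c\<in>C. Poly_Mapping.keys c) \<subseteq> E"
  shows "\<exists>n b. based_lattice (frag_group C) n b \<and> frag_basis C n b"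
proof -
  obtain n b where IH: "frag_basis C n b"
    using frag_subgroup_basis[OF assms] by blast
  have b: "\<And>i. i < n \<Longrightarrow> b i \<in> C" and span: "\<And>x. x \<in> C \<Longrightarrow> \<exists>k. x = (\<Sum>i<n. frag_cmul (k i) (b i))"
    using IH by (simp_all add: frag_basis_def)
  have ind: "y i = 0" if "\<And>e. (\<Sum>i<n. y i * real_of_int (Poly_Mapping.lookup (b i) e)) = 0" "i < n" for y i
    using IH that by (simp add: frag_basis_def)
  interpret comm_group "frag_group C" by (rule comm_group_frag_group[OF assms(2)])
  have bC: "b \<in> {..<n} \<rightarrow> C" using b by auto
  have "lattice_basis (frag_group C) n b"
  proof (rule lattice_basisI[where \<Phi> = "range (\<lambda>e c. real_of_int (Poly_Mapping.lookup c e))"])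
    show "comm_group (frag_group C)" by unfold_locales
    show "b \<in> {..<n} \<rightarrow> carrier (frag_group C)" using bC by simp
    show "\<exists>k. x = finprod (frag_group C) (\<lambda>i. b i [^]\<^bsub>frag_group C\<^esub> (k i :: int)) {..<n}"
      if "x \<in> carrier (frag_group C)" for x
      unfolding frag_group_lincomb[OF assms(2) bC] using span that by simp
    show "additive_map (frag_group C) \<phi>" if "\<phi> \<in> range (\<lambda>e c. real_of_int (Poly_Mapping.lookup c e))" for \<phi>
      using that additive_map_of_int[OF additive_map_lookup] by auto
    fix k :: "nat \<Rightarrow> int" and i
    assume "\<And>\<phi>. \<phi> \<in> range (\<lambda>e c. real_of_int (Poly_Mapping.lookup c e)) \<Longrightarrow> (\<Sum>i<n. of_int (k i) * \<phi> (b i)) = 0" "i < n"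
    then have "real_of_int (k i) = 0" by (intro ind[of "\<lambda>i. of_int (k i)"]) auto
    then show "k i = 0" by simp
  qed
  then have "based_lattice (frag_group C) n b" by unfold_locales
  then show ?thesis using IH by blast
qed

section \<open>Principally polarized tori\<close>

lemma ndet_add_row:
  assumes "i < n" and "\<And>j. j < n \<Longrightarrow> C i j = A i j + B i j"
    and "\<And>r j. r < n \<Longrightarrow> r \<noteq> i \<Longrightarrow> j < n \<Longrightarrow> C r j = A r j \<and> C r j = B r j"
  shows "ndet n C = ndet n A + ndet n B"
  unfolding ndet_def sum.distrib[symmetric] distrib_left[symmetric]
proof (intro sum.cong refl arg_cong2[where f = "(*)"])
  fix p assume "p \<in> {p. p permutes {..<n}}"
  then have p: "p r < n \<longleftrightarrow> r < n" for r by (simp add: permutes_lessThan_iff)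
  have split: "(\<Prod>r<n. D r (p r)) = D i (p i) * (\<Prod>r\<in>{..<n} - {i}. D r (p r))" for D :: "nat \<Rightarrow> nat \<Rightarrow> real"
    using assms(1) by (simp add: prod.remove[of _ i])
  have "(\<Prod>r\<in>{..<n} - {i}. C r (p r)) = (\<Prod>r\<in>{..<n} - {i}. A r (p r))"
    "(\<Prod>r\<in>{..<n} - {i}. C r (p r)) = (\<Prod>r\<in>{..<n} - {i}. B r (p r))"
    using assms(3) p by (force intro!: prod.cong)+
  then show "(\<Prod>r<n. C r (p r)) = (\<Prod>r<n. A r (p r)) + (\<Prod>r<n. B r (p r))"
    using assms(1,2) p[of i] by (simp add: split distrib_right)
qed

lemma ndet_equal_rows:
  assumes "a < n" "b < n" "a \<noteq> b" and "\<And>j. j < n \<Longrightarrow> A a j = A b j"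
  shows "ndet n A = 0"
  using ndet_equal_columns[of a n b "\<lambda>i j. A j i"] assms by (simp add: ndet_transpose[of n A])

lemma alternating_multilinear_ndet:
  fixes \<beta> :: "'a \<Rightarrow> nat \<Rightarrow> real"
  assumes "\<And>j. j < k \<Longrightarrow> additive_map A (\<lambda>x. \<beta> x j)"
  shows "alternating_multilinear A k (\<lambda>x. c * ndet k (\<lambda>i j. \<beta> (x i) j))"
  unfolding alternating_multilinear_def
proof (intro conjI ballI allI impI)
  fix x i a b assume "i < k" "a \<in> carrier A" "b \<in> carrier A"
  then have "ndet k (\<lambda>r j. \<beta> ((x(i := a \<otimes>\<^bsub>A\<^esub> b)) r) j) =
      ndet k (\<lambda>r j. \<beta> ((x(i := a)) r) j) + ndet k (\<lambda>r j. \<beta> ((x(i := b)) r) j)"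
    by (intro ndet_add_row) (auto simp: additive_mapD[OF assms])
  then show "c * ndet k (\<lambda>r j. \<beta> ((x(i := a \<otimes>\<^bsub>A\<^esub> b)) r) j) =
      c * ndet k (\<lambda>r j. \<beta> ((x(i := a)) r) j) + c * ndet k (\<lambda>r j. \<beta> ((x(i := b)) r) j)"
    by (simp add: distrib_left)
next
  fix x :: "nat \<Rightarrow> 'a" and i j assume "i < k" "j < k" "i \<noteq> j \<and> x i = x j"
  then show "c * ndet k (\<lambda>i j. \<beta> (x i) j) = 0"
    using ndet_equal_rows[of i k j "\<lambda>i j. \<beta> (x i) j"] by simp
qed

text \<open>The image of the interval is connected, and a connected set of reals with two points is
  uncountable.\<close>

lemma continuous_countable_constant:
  fixes g :: "real \<Rightarrow> real"
  assumes "continuous_on {0..1} g" "countable (g ` {0..1})"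
  shows "g 0 = g 1"
proof (rule ccontr)
  assume "g 0 \<noteq> g 1"
  moreover have "connected (g ` {0..1})"
    by (rule connected_continuous_image[OF assms(1)]) simp
  ultimately show False
    using connected_uncountable[of "g ` {0..1}" "g 0" "g 1"] assms(2) by auto
qed

text \<open>If \<open>E\<close> is the polarization form, then E(\<lambda>, \<lambda>') is the
  pairing of \<lambda> with \<rho> \<lambda>'. The matrix in \<open>pos_def\<close> is thus the Gram
  matrix of \<open>E\<close> on the basis of \<Lambda> that \<rho> maps to \<open>b\<close>.\<close>

locale principal_torus = M: based_lattice "tform T" n b + L: comm_group "tlam T"
  for T :: "('l, 'm) real_torus" and n :: nat and b :: "nat \<Rightarrow> 'm" +
  fixes \<rho> :: "'l \<Rightarrow> 'm" and \<rho>i :: "'m \<Rightarrow> 'l"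
  defines "\<rho>i \<equiv> inv_into (carrier (tlam T)) \<rho>"
  assumes rho_iso: "\<rho> \<in> iso (tlam T) (tform T)"
    and pair_left: "\<And>m. m \<in> carrier (tform T) \<Longrightarrow> additive_map (tlam T) (\<lambda>l. tpair T l m)"
    and pair_right: "\<And>l. l \<in> carrier (tlam T) \<Longrightarrow> additive_map (tform T) (tpair T l)"
    and pos_def: "\<And>y. (\<exists>i<n. y i \<noteq> 0) \<Longrightarrow>
      0 < (\<Sum>i<n. \<Sum>j<n. y i * y j * tpair T (\<rho>i (b i)) (b j))"
begin

lemma rho_inverse [simp]:
  "m \<in> carrier (tform T) \<Longrightarrow> \<rho> (\<rho>i m) = m"
  "l \<in> carrier (tlam T) \<Longrightarrow> \<rho>i (\<rho> l) = l"
  using rho_iso by (auto simp: \<rho>i_def iso_def bij_betw_def f_inv_into_f)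

lemma rhoi_iso: "\<rho>i \<in> iso (tform T) (tlam T)"
  unfolding \<rho>i_def by (rule L.iso_set_sym[OF rho_iso])

lemma rho_hom: "\<rho> \<in> hom (tlam T) (tform T)" and rhoi_hom: "\<rho>i \<in> hom (tform T) (tlam T)"
  using rho_iso rhoi_iso by (auto simp: iso_def)

lemma rhoi_mem: "m \<in> carrier (tform T) \<Longrightarrow> \<rho>i m \<in> carrier (tlam T)"
  using rhoi_hom by (auto simp: hom_def)

text \<open>With this basis of \<Lambda> the matrix of \<rho> is the identity, and the matrix of the
  pairing is the Gram matrix.\<close>

definition lb :: "nat \<Rightarrow> 'l" where "lb i = \<rho>i (b i)"

sublocale L: based_lattice "tlam T" n lb
  unfolding lb_def by (rule lattice_iso[OF M.based_lattice_axioms L.comm_group_axioms rhoi_iso])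

lemma torus_dim_eq: "torus_dim T = n"
  unfolding torus_dim_def by (rule lattice_rank_eqI[OF M.based_lattice_axioms])

abbreviation gram :: "nat \<Rightarrow> nat \<Rightarrow> real" where "gram i j \<equiv> tpair T (lb i) (b j)"

lemma gram_pos: "ndet n gram > 0"
  using pos_def by (intro ndet_pos_if_pos_def) (simp add: lb_def)

subsection \<open>Real extensions\<close>

text \<open>This resolves the description in \<open>real_ext\<close>: as the Gram matrix is
  invertible, \<Lambda> spans \<open>N\<^sub>\<real>\<close>, and \<open>f\<close> extends to one
  linear functional, given by a vector \<open>w\<close> in the coordinates \<open>x (b j)\<close>.
  The vector does not depend on \<open>x\<close>, which makes the extension differentiable along
  affine lifts, and it reproduces \<open>f\<close> on \<Lambda>.\<close>

lemma real_ext_linear: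
  assumes f: "f \<in> carrier (int_dual (tlam T))"
  shows "\<exists>w. (\<forall>x. additive_map (tform T) x \<longrightarrow> real_ext T f x = (\<Sum>j<n. x (b j) * w j)) \<and>
    (\<forall>l\<in>carrier (tlam T). of_int (f l) = (\<Sum>j<n. tpair T l (b j) * w j))"
proof -
  obtain Q where Q1: "\<And>i j. i < n \<Longrightarrow> j < n \<Longrightarrow> (\<Sum>k<n. gram i k * Q k j) = (if i = j then 1 else 0)"
    and Q2: "\<And>i j. i < n \<Longrightarrow> j < n \<Longrightarrow> (\<Sum>k<n. Q i k * gram k j) = (if i = j then 1 else 0)"
    using ndet_inverse[of n gram] gram_pos by auto
  have fadd: "additive_map (tlam T) f" using f by (simp add: int_dual_mem)
  \<comment> \<open>The solution of the linear system that prescribes the values of \<open>f\<close>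
    on the basis \<open>lb\<close>.\<close>
  define w where "w = (\<lambda>j. \<Sum>i<n. Q j i * of_int (f (lb i)))"
  have gw: "(\<Sum>j<n. gram i j * w j) = of_int (f (lb i))" if i: "i < n" for i
  proof -
    have "(\<Sum>j<n. gram i j * w j) = (\<Sum>k<n. (\<Sum>j<n. gram i j * Q j k) * of_int (f (lb k)))"
      unfolding w_def sum_distrib_left sum_distrib_right by (subst sum.swap) (simp add: mult_ac)
    also have "\<dots> = (\<Sum>k<n. if i = k then of_int (f (lb k)) else 0)"
      using i by (intro sum.cong refl) (simp add: Q1)
    finally show ?thesis using i by simp
  qed
  have fw: "of_int (f l) = (\<Sum>j<n. tpair T l (b j) * w j)" if l: "l \<in> carrier (tlam T)" for l
  proof -
    have "(\<Sum>j<n. tpair T l (b j) * w j) = (\<Sum>j<n. (\<Sum>i<n. of_int (coord (tlam T) n lb l i) * gram i j) * w j)"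
      by (intro sum.cong refl arg_cong2[where f = "(*)"])
         (use L.additive_map_expand[OF pair_left[OF M.basis_mem] l] in simp)
    also have "\<dots> = (\<Sum>i<n. of_int (coord (tlam T) n lb l i) * (\<Sum>j<n. gram i j * w j))"
      unfolding sum_distrib_left sum_distrib_right by (subst sum.swap) (simp add: mult_ac)
    also have "\<dots> = (\<Sum>i<n. of_int (coord (tlam T) n lb l i) * of_int (f (lb i)))"
      by (simp add: gw)
    also have "\<dots> = of_int (f l)"
      using L.additive_map_expand[OF fadd l] by simp
    finally show ?thesis ..
  qed
  have "real_ext T f x = (\<Sum>j<n. x (b j) * w j)" if x: "additive_map (tform T) x" for x
    unfolding real_ext_def
  proof (rule the_equality)
    \<comment> \<open>The real coordinates of \<open>x\<close> in the basis \<open>lb\<close>. The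
      next definition indexes them by lattice elements, as \<open>real_ext\<close> demands; this is
      where injectivity of \<open>lb\<close> enters.\<close>
    define y where "y = (\<lambda>i. \<Sum>j<n. x (b j) * Q j i)"
    define c where "c = (\<lambda>l. y (inv_into {..<n} lb l))"
    have inj: "inj_on lb {..<n}"
    proof (rule inj_onI)
      fix i j assume "i \<in> {..<n}" "j \<in> {..<n}" "lb i = lb j"
      then show "i = j" using L.coord_basis[of i i] L.coord_basis[of i j] by (auto split: if_splits)
    qed
    have c: "c (lb i) = y i" if "i < n" for i
      using inj that by (simp add: c_def)
    show "\<exists>L c. finite L \<and> L \<subseteq> carrier (tlam T) \<and>
       (\<forall>m\<in>carrier (tform T). x m = (\<Sum>l\<in>L. c l * tpair T l m)) \<and>
       (\<Sum>j<n. x (b j) * w j) = (\<Sum>l\<in>L. c l * of_int (f l))"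
    proof (intro exI[of _ "lb ` {..<n}"] exI[of _ c] conjI ballI)
      show "lb ` {..<n} \<subseteq> carrier (tlam T)" using L.basis_mem by auto
      fix m assume m: "m \<in> carrier (tform T)"
      define z where "z = (\<lambda>m. \<Sum>i<n. y i * tpair T (lb i) m)"
      have z_add: "additive_map (tform T) z"
        using pair_right[OF L.basis_mem]
        by (auto simp: additive_map_def z_def sum.distrib[symmetric] distrib_left[symmetric] intro!: sum.cong)
      have zb: "z (b j) = x (b j)" if j: "j < n" for j
      proof -
        have "z (b j) = (\<Sum>k<n. x (b k) * (\<Sum>i<n. Q k i * gram i j))"
          unfolding z_def y_def sum_distrib_left sum_distrib_right by (subst sum.swap) (simp add: mult_ac)
        also have "\<dots> = (\<Sum>k<n. if k = j then x (b k) else 0)"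
          using j by (intro sum.cong refl) (simp add: Q2)
        finally show ?thesis using j by simp
      qed
      have "x m = z m"
        using M.additive_map_expand[OF x m] M.additive_map_expand[OF z_add m] by (simp add: zb)
      then show "x m = (\<Sum>l\<in>lb ` {..<n}. c l * tpair T l m)"
        by (simp add: z_def sum.reindex[OF inj] c)
    next
      have "(\<Sum>j<n. x (b j) * w j) = (\<Sum>i<n. y i * of_int (f (lb i)))"
        unfolding w_def y_def sum_distrib_left sum_distrib_right by (subst sum.swap) (simp add: mult_ac)
      then show "(\<Sum>j<n. x (b j) * w j) = (\<Sum>l\<in>lb ` {..<n}. c l * of_int (f l))"
        by (simp add: sum.reindex[OF inj] c)
    qed simp
    fix r assume "\<exists>L c. finite L \<and> L \<subseteq> carrier (tlam T) \<and>
       (\<forall>m\<in>carrier (tform T). x m = (\<Sum>l\<in>L. c l * tpair T l m)) \<and> r = (\<Sum>l\<in>L. c l * of_int (f l))"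
    then obtain L c where Lc: "L \<subseteq> carrier (tlam T)" "\<And>m. m \<in> carrier (tform T) \<Longrightarrow> x m = (\<Sum>l\<in>L. c l * tpair T l m)"
      "r = (\<Sum>l\<in>L. c l * of_int (f l))" by blast
    \<comment> \<open>Any other representation of \<open>x\<close> has the same value: replacing
      \<open>f\<close> by its formula in \<open>w\<close> and exchanging the sums leaves only the
      numbers \<open>x (b j)\<close>.\<close>
    have "r = (\<Sum>l\<in>L. c l * (\<Sum>j<n. tpair T l (b j) * w j))"
      unfolding Lc(3) using Lc(1) by (intro sum.cong refl) (auto simp: fw)
    also have "\<dots> = (\<Sum>j<n. x (b j) * w j)"
      by (simp add: Lc(2) M.basis_mem sum_distrib_left sum_distrib_right mult.assoc) (rule sum.swap)
    finally show "r = (\<Sum>j<n. x (b j) * w j)" .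
  qed
  with fw show ?thesis by blast
qed

subsection \<open>The group of points\<close>

lemma comm_group_NR: "comm_group (torus_NR T)"
  unfolding torus_NR_def by (rule comm_group_real_dual[OF M.comm_group_axioms])

sublocale NR: comm_group "torus_NR T"
  by (rule comm_group_NR)

lemma NR_mem: "x \<in> carrier (torus_NR T) \<longleftrightarrow> x \<in> extensional (carrier (tform T)) \<and> additive_map (tform T) x"
  by (simp add: torus_NR_def real_dual_mem)

lemma NR_mult: "m \<in> carrier (tform T) \<Longrightarrow> (x \<otimes>\<^bsub>torus_NR T\<^esub> y) m = x m + y m"
  by (simp add: torus_NR_def real_dual_def)

lemma lam_embed_hom: "lam_embed T \<in> hom (tlam T) (torus_NR T)"
proof (rule homI)
  show mem: "lam_embed T l \<in> carrier (torus_NR T)" if "l \<in> carrier (tlam T)" for l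
    using pair_right[OF that] additive_map_cong_restrict[OF M.comm_group_axioms]
    by (auto simp: NR_mem lam_embed_def)
  fix l l' assume l: "l \<in> carrier (tlam T)" "l' \<in> carrier (tlam T)"
  show "lam_embed T (l \<otimes>\<^bsub>tlam T\<^esub> l') = lam_embed T l \<otimes>\<^bsub>torus_NR T\<^esub> lam_embed T l'"
  proof (rule extensionalityI)
    show "lam_embed T l \<otimes>\<^bsub>torus_NR T\<^esub> lam_embed T l' \<in> extensional (carrier (tform T))"
      using NR.m_closed[OF mem mem] l by (simp add: NR_mem)
    fix m assume m: "m \<in> carrier (tform T)"
    then show "lam_embed T (l \<otimes>\<^bsub>tlam T\<^esub> l') m = (lam_embed T l \<otimes>\<^bsub>torus_NR T\<^esub> lam_embed T l') m"
      using additive_mapD[OF pair_left[OF m] l] by (simp add: NR_mult lam_embed_def)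
  qed (simp add: lam_embed_def)
qed

lemma periods_subgroup: "subgroup (lam_embed T ` carrier (tlam T)) (torus_NR T)"
proof -
  interpret group_hom "tlam T" "torus_NR T" "lam_embed T"
    by unfold_locales (rule lam_embed_hom)
  show ?thesis by (rule img_is_subgroup)
qed

sublocale TG: comm_group "torus_group T"
  unfolding torus_group_def by (rule NR.abelian_FactGroup[OF periods_subgroup])

lemma torus_proj_hom: "torus_proj T \<in> hom (torus_NR T) (torus_group T)"
proof -
  interpret normal "lam_embed T ` carrier (tlam T)" "torus_NR T"
    by (rule NR.subgroup_imp_normal[OF periods_subgroup])
  show ?thesis
    using r_coset_hom_Mod by (simp add: torus_group_def torus_proj_def[abs_def])
qed

lemma finprod_torus_proj:
  fixes d :: nat
  assumes "\<And>i. i < d \<Longrightarrow> x i \<in> carrier (torus_NR T)"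
  shows "(\<lambda>m\<in>carrier (tform T). \<Sum>i<d. x i m) \<in> carrier (torus_NR T)"
    and "finprod (torus_group T) (\<lambda>i. torus_proj T (x i)) {..<d} =
      torus_proj T (\<lambda>m\<in>carrier (tform T). \<Sum>i<d. x i m)"
proof -
  have x: "x \<in> {..<d} \<rightarrow> carrier (torus_NR T)" using assms by auto
  have mem: "finprod (torus_NR T) x {..<d} \<in> carrier (torus_NR T)"
    by (rule NR.finprod_closed[OF x])
  have eq: "finprod (torus_NR T) x {..<d} = (\<lambda>m\<in>carrier (tform T). \<Sum>i<d. x i m)"
  proof (rule extensionalityI)
    show "finprod (torus_NR T) x {..<d} \<in> extensional (carrier (tform T))" using mem by (simp add: NR_mem)
    fix m assume m: "m \<in> carrier (tform T)"
    have "additive_map (torus_NR T) (\<lambda>x. x m)" using m by (simp add: additive_map_def NR_mult)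
    from NR.additive_map_finprod[OF this finite_lessThan x] m
    show "finprod (torus_NR T) x {..<d} m = (\<lambda>m\<in>carrier (tform T). \<Sum>i<d. x i m) m"
      by simp
  qed simp
  show "(\<lambda>m\<in>carrier (tform T). \<Sum>i<d. x i m) \<in> carrier (torus_NR T)"
    using mem by (simp add: eq)
  have "torus_proj T (finprod (torus_NR T) x {..<d}) = finprod (torus_group T) (\<lambda>i. torus_proj T (x i)) {..<d}"
    by (rule hom_finprod[OF NR.comm_group_axioms TG.comm_group_axioms torus_proj_hom _ x]) simp
  then show "finprod (torus_group T) (\<lambda>i. torus_proj T (x i)) {..<d} =
      torus_proj T (\<lambda>m\<in>carrier (tform T). \<Sum>i<d. x i m)"
    by (simp add: eq)
qed

lemma torus_proj_eqD:
  assumes "x \<in> carrier (torus_NR T)" "torus_proj T x = torus_proj T y"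
  obtains l where "l \<in> carrier (tlam T)" "\<And>m. m \<in> carrier (tform T) \<Longrightarrow> x m = tpair T l m + y m"
proof -
  have "x \<in> torus_proj T x"
    unfolding torus_proj_def
    using NR.rcos_self[OF assms(1) periods_subgroup] .
  then have "x \<in> torus_proj T y" using assms(2) by simp
  then obtain l where l: "l \<in> carrier (tlam T)" "x = lam_embed T l \<otimes>\<^bsub>torus_NR T\<^esub> y"
    by (auto simp: torus_proj_def r_coset_def)
  show ?thesis
    by (rule that[OF l(1)]) (simp add: l(2) NR_mult lam_embed_def)
qed

lemma torus_proj_eqI:
  assumes l: "l \<in> carrier (tlam T)" and x: "x \<in> carrier (torus_NR T)" and y: "y \<in> carrier (torus_NR T)"
    and eq: "\<And>m. m \<in> carrier (tform T) \<Longrightarrow> x m = tpair T l m + y m"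
  shows "torus_proj T x = torus_proj T y"
proof -
  have "x = lam_embed T l \<otimes>\<^bsub>torus_NR T\<^esub> y"
  proof (rule extensionalityI)
    have "lam_embed T l \<in> carrier (torus_NR T)" using lam_embed_hom l by (auto simp: hom_def)
    from NR.m_closed[OF this y]
    show "lam_embed T l \<otimes>\<^bsub>torus_NR T\<^esub> y \<in> extensional (carrier (tform T))" by (simp add: NR_mem)
    show "x \<in> extensional (carrier (tform T))" using x by (simp add: NR_mem)
    show "x m = (lam_embed T l \<otimes>\<^bsub>torus_NR T\<^esub> y) m" if "m \<in> carrier (tform T)" for m
      using that by (simp add: NR_mult eq lam_embed_def)
  qed
  then have "x \<in> torus_proj T y"
    using l by (auto simp: torus_proj_def r_coset_def)
  then show ?thesis
    unfolding torus_proj_def using NR.repr_independence[OF _ y periods_subgroup] by simp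
qed

subsection \<open>Lifts of cubes\<close>

text \<open>Two lifts differ by a continuous function whose values are among the countably many periods.\<close>

lemma is_lift_unique:
  assumes s: "is_lift T q \<sigma> s" and s': "is_lift T q \<sigma> s'"
    and t: "t \<in> std_cube q" "t' \<in> std_cube q" and m: "m \<in> carrier (tform T)"
  shows "s t m - s' t m = s t' m - s' t' m"
proof -
  define \<gamma> where "\<gamma> = (\<lambda>u::real. \<lambda>k\<in>{..<q}. (1 - u) * t k + u * t' k)"
  define g where "g = (\<lambda>u. s (\<gamma> u) m - s' (\<gamma> u) m)"
  have \<gamma>: "\<gamma> u \<in> std_cube q" if "u \<in> {0..1}" for u
  proof -
    have "(1 - u) * t k + u * t' k \<in> {0..1}" if k: "k < q" for k
    proof -
      have tk: "t k \<in> {0..1}" "t' k \<in> {0..1}" using t k by (auto simp: std_cube_def PiE_iff)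
      have "0 \<le> (1 - u) * t k" "0 \<le> u * t' k" using tk \<open>u \<in> {0..1}\<close> by auto
      moreover have "(1 - u) * t k \<le> 1 - u" "u * t' k \<le> u"
        using tk \<open>u \<in> {0..1}\<close> by (auto intro: mult_left_le)
      ultimately show ?thesis by auto
    qed
    then show ?thesis by (auto simp: \<gamma>_def std_cube_def)
  qed
  have \<gamma>_cont: "continuous_on {0..1} \<gamma>"
  proof (rule continuous_on_coordinatewise_then_product)
    fix k show "continuous_on {0..1} (\<lambda>u. \<gamma> u k)"
      by (cases "k < q") (auto simp: \<gamma>_def intro!: continuous_intros)
  qed
  have "continuous_on {0..1} g"
    unfolding g_def
  proof (rule continuous_on_diff)
    have "continuous_on (\<gamma> ` {0..1}) (\<lambda>t. s t m)" "continuous_on (\<gamma> ` {0..1}) (\<lambda>t. s' t m)"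
      using s s' m \<gamma> by (auto simp: is_lift_def elim!: continuous_on_subset)
    then show "continuous_on {0..1} (\<lambda>u. s (\<gamma> u) m)" "continuous_on {0..1} (\<lambda>u. s' (\<gamma> u) m)"
      using continuous_on_compose2[OF _ \<gamma>_cont order_refl] by auto
  qed
  moreover have "countable (g ` {0..1})"
  proof (rule countable_subset)
    show "g ` {0..1} \<subseteq> (\<lambda>l. tpair T l m) ` carrier (tlam T)"
    proof (rule image_subsetI)
      fix u :: real assume "u \<in> {0..1}"
      then have "s (\<gamma> u) \<in> carrier (torus_NR T)" "torus_proj T (s (\<gamma> u)) = torus_proj T (s' (\<gamma> u))"
        using s s' \<gamma> by (auto simp: is_lift_def)
      then obtain l where "l \<in> carrier (tlam T)" "s (\<gamma> u) m = tpair T l m + s' (\<gamma> u) m"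
        using torus_proj_eqD m by metis
      then show "g u \<in> (\<lambda>l. tpair T l m) ` carrier (tlam T)" by (auto simp: g_def)
    qed
  qed (use L.countable_carrier in auto)
  ultimately have "g 0 = g 1" by (rule continuous_countable_constant)
  moreover have "\<gamma> 0 = t" "\<gamma> 1 = t'"
    using t by (auto simp: \<gamma>_def std_cube_def PiE_iff extensional_def fun_eq_iff)
  ultimately show ?thesis by (simp add: g_def)
qed

lemma cube_lift_is_lift: "is_lift T q \<sigma> s \<Longrightarrow> is_lift T q \<sigma> (cube_lift T q \<sigma>)"
  unfolding cube_lift_def by (rule someI[where P = "is_lift T q \<sigma>"])

text \<open>All that is known about the chosen lift: it differs from a given one by a shift,
  constant on the cube, that derivatives do not see. Its value can be read off at the corner
  0.\<close>

lemma cube_lift_eq: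
  assumes "is_lift T q \<sigma> s"
  shows "\<exists>\<kappa>. \<forall>t\<in>std_cube q. \<forall>m\<in>carrier (tform T). cube_lift T q \<sigma> t m = s t m + \<kappa> m"
proof (intro exI ballI)
  let ?o = "\<lambda>k\<in>{..<q}. 0 :: real"
  have o: "?o \<in> std_cube q" by (auto simp: std_cube_def)
  fix t m assume "t \<in> std_cube q" "m \<in> carrier (tform T)"
  then show "cube_lift T q \<sigma> t m = s t m + (cube_lift T q \<sigma> ?o m - s ?o m)"
    using is_lift_unique[OF cube_lift_is_lift[OF assms] assms _ o] by fastforce
qed

lemma push_tangent_affine:
  assumes lift: "is_lift T q \<sigma> (\<lambda>t. \<lambda>m\<in>carrier (tform T). x0 m + (\<Sum>i<q. t i * a i m))"
    and m: "m \<in> carrier (tform T)"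
  shows "push_tangent T q \<sigma> v m = (\<Sum>i<q. v i * a i m)"
proof -
  obtain \<kappa> where \<kappa>': "\<forall>t\<in>std_cube q. \<forall>m\<in>carrier (tform T).
      cube_lift T q \<sigma> t m = (\<lambda>m\<in>carrier (tform T). x0 m + (\<Sum>i<q. t i * a i m)) m + \<kappa> m"
    using cube_lift_eq[OF lift] ..
  have \<kappa>: "cube_lift T q \<sigma> t m = x0 m + (\<Sum>i<q. t i * a i m) + \<kappa> m"
    if "t \<in> std_cube q" "m \<in> carrier (tform T)" for t m
    using bspec[OF bspec[OF \<kappa>' that(1)] that(2)] that(2) by simp
  \<comment> \<open>The centre is interior to the cube, so small displacements stay where the chosen
    lift is known to be affine.\<close>
  have ev: "\<forall>\<^sub>F s in nhds 0. \<forall>k\<in>{..<q}. 1 / 2 + s * v k \<in> {0..1}"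
  proof (rule eventually_ball_finite, simp, rule ballI)
    fix k
    have "((\<lambda>s. 1 / 2 + s * v k) \<longlongrightarrow> 1 / 2 + 0 * v k) (nhds 0)"
      by (intro tendsto_intros filterlim_ident)
    then have "\<forall>\<^sub>F s in nhds 0. 1 / 2 + s * v k \<in> {0<..<1}"
      by (rule topological_tendstoD) auto
    then show "\<forall>\<^sub>F s in nhds 0. 1 / 2 + s * v k \<in> {0..1}"
      by eventually_elim auto
  qed
  let ?p = "\<lambda>s. \<lambda>k\<in>{..<q}. 1 / 2 + s * v k"
  have "\<forall>\<^sub>F s in nhds 0. cube_lift T q \<sigma> (?p s) m =
      x0 m + (\<Sum>i<q. 1 / 2 * a i m) + \<kappa> m + s * (\<Sum>i<q. v i * a i m)"
    using ev
  proof eventually_elim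
    case (elim s)
    then have "?p s \<in> std_cube q" by (auto simp: std_cube_def)
    then have "cube_lift T q \<sigma> (?p s) m = x0 m + (\<Sum>i<q. (1 / 2 + s * v i) * a i m) + \<kappa> m"
      using \<kappa>[OF _ m] by simp
    also have "(\<Sum>i<q. (1 / 2 + s * v i) * a i m) = (\<Sum>i<q. 1 / 2 * a i m) + s * (\<Sum>i<q. v i * a i m)"
      by (simp add: sum_distrib_left distrib_right sum.distrib mult.assoc)
    finally show ?case by (simp only: add_ac)
  qed
  then have "push_tangent T q \<sigma> v m =
      deriv (\<lambda>s. x0 m + (\<Sum>i<q. 1 / 2 * a i m) + \<kappa> m + s * (\<Sum>i<q. v i * a i m)) 0"
    unfolding push_tangent_def by (rule deriv_cong_ev) simp
  also have "\<dots> = (\<Sum>i<q. v i * a i m)"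
    by (rule DERIV_imp_deriv) (auto intro!: derivative_eq_intros)
  finally show ?thesis .
qed

lemma measure_unit_cube:
  "measure (PiM {..<q::nat} (\<lambda>_. restrict_space lborel {0<..<1::real}))
     (space (PiM {..<q} (\<lambda>_. restrict_space lborel {0<..<1::real}))) = 1"
proof -
  let ?I = "restrict_space lborel {0<..<1::real}"
  have e: "emeasure ?I (space ?I) = 1"
    by (simp add: space_restrict_space emeasure_restrict_space)
  interpret finite_measure ?I
    by (rule finite_measureI) (simp only: e, simp)
  interpret product_sigma_finite "\<lambda>_::nat. ?I"
    by unfold_locales
  have "emeasure (PiM {..<q} (\<lambda>_. ?I)) (space (PiM {..<q} (\<lambda>_. ?I))) = 1"
    unfolding space_PiM using emeasure_PiM[of "{..<q}" "\<lambda>_. space ?I"]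
    by (simp only: e sets.top finite_lessThan prod.neutral_const simp_thms True_implies_equals)
  then show ?thesis by (simp add: measure_def)
qed

text \<open>Along an affine lift the integrand is constant, and the unit cube has measure 1.\<close>

lemma cube_integral_affine:
  assumes lift: "is_lift T q \<sigma> (\<lambda>t. \<lambda>m\<in>carrier (tform T). x0 m + (\<Sum>i<q. t i * a i m))"
    and a: "\<And>i. i < q \<Longrightarrow> additive_map (tform T) (a i)"
    and f: "\<And>i. i < q \<Longrightarrow> f i \<in> carrier (int_dual (tlam T))"
  shows "cube_integral T q \<sigma> f = ndet q (\<lambda>i j. real_ext T (f i) (a j))"
proof -
  obtain \<kappa> where \<kappa>': "\<forall>t\<in>std_cube q. \<forall>m\<in>carrier (tform T).
      cube_lift T q \<sigma> t m = (\<lambda>m\<in>carrier (tform T). x0 m + (\<Sum>i<q. t i * a i m)) m + \<kappa> m"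
    using cube_lift_eq[OF lift] ..
  have \<kappa>: "cube_lift T q \<sigma> t m = x0 m + (\<Sum>i<q. t i * a i m) + \<kappa> m"
    if "t \<in> std_cube q" "m \<in> carrier (tform T)" for t m
    using bspec[OF bspec[OF \<kappa>' that(1)] that(2)] that(2) by simp
  let ?\<mu> = "PiM {..<q} (\<lambda>_. restrict_space lborel {0<..<1::real})"
  have der: "deriv (\<lambda>s. real_ext T (f i) (cube_lift T q \<sigma> (t(j := s)))) (t j) = real_ext T (f i) (a j)"
    if t: "t \<in> space ?\<mu>" and i: "i < q" and j: "j < q" for t i j
  proof -
    have t': "t \<in> {..<q} \<rightarrow>\<^sub>E {0<..<1}"
      using t by (simp add: space_PiM space_restrict_space)
    obtain w where w': "(\<forall>x. additive_map (tform T) x \<longrightarrow> real_ext T (f i) x = (\<Sum>j<n. x (b j) * w j)) \<and>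
        (\<forall>l\<in>carrier (tlam T). of_int (f i l) = (\<Sum>j<n. tpair T l (b j) * w j))"
      using real_ext_linear[OF f[OF i]] ..
    have w: "real_ext T (f i) x = (\<Sum>k<n. x (b k) * w k)" if "additive_map (tform T) x" for x
      using w' that by simp
    \<comment> \<open>The part of the extended form that does not depend on the \<open>j\<close>-th
      coordinate; the rest is linear in \<open>s\<close>.\<close>
    define C where "C = (\<Sum>k<n. (x0 (b k) + (\<Sum>i\<in>{..<q} - {j}. t i * a i (b k)) + \<kappa> (b k)) * w k)"
    \<comment> \<open>The integral is over the open cube, so moving the \<open>j\<close>-th
      coordinate slightly in either direction stays in the domain of the lift.\<close>
    have "t j \<in> {0<..<1}"
      using j by (intro PiE_mem[OF t']) simp
    then have "\<forall>\<^sub>F s in nhds (t j). s \<in> {0<..<1}"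
      by (rule eventually_nhds_in_open[OF open_greaterThanLessThan])
    then have "\<forall>\<^sub>F s in nhds (t j). real_ext T (f i) (cube_lift T q \<sigma> (t(j := s))) =
        C + s * real_ext T (f i) (a j)"
    proof eventually_elim
      case (elim s)
      have c: "t(j := s) \<in> std_cube q"
        unfolding std_cube_def
      proof (rule PiE_I)
        show "(t(j := s)) k \<in> {0..1}" if "k \<in> {..<q}" for k
          using PiE_mem[OF t' that] elim by auto
        show "(t(j := s)) k = undefined" if "k \<notin> {..<q}" for k
          using PiE_arb[OF t' that] that j by auto
      qed
      then have "cube_lift T q \<sigma> (t(j := s)) \<in> carrier (torus_NR T)"
        using cube_lift_is_lift[OF lift] by (simp add: is_lift_def)
      then have "real_ext T (f i) (cube_lift T q \<sigma> (t(j := s))) = (\<Sum>k<n. cube_lift T q \<sigma> (t(j := s)) (b k) * w k)"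
        by (simp add: NR_mem w)
      also have "\<dots> = (\<Sum>k<n. (x0 (b k) + (\<Sum>i\<in>{..<q} - {j}. t i * a i (b k)) + \<kappa> (b k)) * w k + s * (a j (b k) * w k))"
      proof (intro sum.cong refl)
        fix k assume "k \<in> {..<n}"
        then have "cube_lift T q \<sigma> (t(j := s)) (b k) = x0 (b k) + (\<Sum>i<q. (t(j := s)) i * a i (b k)) + \<kappa> (b k)"
          using \<kappa>[OF c M.basis_mem] by simp
        also have "(\<Sum>i<q. (t(j := s)) i * a i (b k)) = s * a j (b k) + (\<Sum>i\<in>{..<q} - {j}. t i * a i (b k))"
          using j by (simp add: sum.remove[of _ j])
        finally have eq: "cube_lift T q \<sigma> (t(j := s)) (b k) =
            x0 (b k) + (s * a j (b k) + (\<Sum>i\<in>{..<q} - {j}. t i * a i (b k))) + \<kappa> (b k)" .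
        show "cube_lift T q \<sigma> (t(j := s)) (b k) * w k =
            (x0 (b k) + (\<Sum>i\<in>{..<q} - {j}. t i * a i (b k)) + \<kappa> (b k)) * w k + s * (a j (b k) * w k)"
          unfolding eq by (simp add: algebra_simps)
      qed
      also have "\<dots> = C + s * real_ext T (f i) (a j)"
        by (simp add: sum.distrib C_def w a j sum_distrib_left)
      finally show ?case .
    qed
    then have "deriv (\<lambda>s. real_ext T (f i) (cube_lift T q \<sigma> (t(j := s)))) (t j) =
        deriv (\<lambda>s. C + s * real_ext T (f i) (a j)) (t j)"
      by (rule deriv_cong_ev) simp
    also have "\<dots> = real_ext T (f i) (a j)"
      by (rule DERIV_imp_deriv) (auto intro!: derivative_eq_intros)
    finally show ?thesis .
  qed
  have "cube_integral T q \<sigma> f = (LINT t | ?\<mu>. ndet q (\<lambda>i j. real_ext T (f i) (a j)))"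
    unfolding cube_integral_def by (intro Bochner_Integration.integral_cong refl ndet_cong der)
  then show ?thesis using measure_unit_cube by simp
qed

subsection \<open>Powers of the polarization\<close>

definition dual_basis :: "nat \<Rightarrow> 'm \<Rightarrow> int" where
  "dual_basis j = (\<lambda>m\<in>carrier (tform T). coord (tform T) n b m j)"

sublocale N: based_lattice "torus_N T" n dual_basis
  unfolding torus_N_def dual_basis_def[abs_def] by (rule M.lattice_int_dual)

text \<open>For \<open>lb\<close> and the basis dual to \<open>b\<close> the comparison matrix is
  the Gram matrix, whose determinant is positive. Hence the choice in \<open>poincare_dual\<close>
  does pick oriented bases.\<close>

lemma oriented_bases_exist: "\<exists>p. oriented_bases T p"
proof -
  have "oriented_bases T (lb, dual_basis)"
    unfolding oriented_bases_def prod.case torus_dim_eq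
  proof (intro conjI exI[of _ gram] allI impI ballI)
    show "lattice_basis (tlam T) n lb" by (rule L.basis)
    show "lattice_basis (torus_N T) n dual_basis" by (rule N.basis)
    show "0 < ndet n gram" by (rule gram_pos)
    fix i m assume "i < n" "m \<in> carrier (tform T)"
    then show "tpair T (lb i) m = (\<Sum>j<n. gram i j * of_int (dual_basis j m))"
      using M.additive_map_expand[OF pair_right[OF L.basis_mem]] by (simp add: dual_basis_def mult.commute)
  qed
  then show ?thesis ..
qed

text \<open>The base changes \<open>?W\<close> from \<open>bs\<close> to \<open>lb\<close> and
  \<open>?N\<close> from \<open>ns\<close> to the dual basis are unimodular, and the polarization
  has matrix \<open>?W\<close> times \<open>?N\<close>. Writing the pairing of \<open>bs\<close>
  with \<open>b\<close> in two ways gives \<open>?W\<close> times \<open>gram\<close> equal to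
  \<open>A\<close> times the transpose of \<open>?N\<close>; as \<open>gram\<close> and
  \<open>A\<close> have positive determinants, the two signs agree and their product is 1.\<close>

lemma oriented_bases_ndet:
  assumes "oriented_bases T (bs, ns)"
  shows "ndet n (\<lambda>i j. of_int (ns j (\<rho> (bs i)))) = 1"
proof -
  interpret BS: based_lattice "tlam T" n bs
    using assms by unfold_locales (simp add: oriented_bases_def torus_dim_eq)
  interpret NS: based_lattice "torus_N T" n ns
    using assms by unfold_locales (simp add: oriented_bases_def torus_dim_eq)
  obtain A where A: "\<And>i m. i < n \<Longrightarrow> m \<in> carrier (tform T) \<Longrightarrow>
      tpair T (bs i) m = (\<Sum>j<n. A i j * of_int (ns j m))" and A_pos: "ndet n A > 0"
    using assms by (auto simp: oriented_bases_def torus_dim_eq)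
  let ?W = "\<lambda>i p. real_of_int (coord (tlam T) n lb (bs i) p)"
  let ?N = "\<lambda>p j. real_of_int (ns j (b p))"
  have ns_add: "additive_map (tform T) (ns j)" if "j < n" for j
    using NS.basis_mem[OF that] by (simp add: torus_N_def int_dual_mem)
  have W: "ndet n ?W = 1 \<or> ndet n ?W = - 1"
    by (rule ndet_change_of_basis[OF BS.based_lattice_axioms L.based_lattice_axioms])
  have "ns j (b p) = coord (torus_N T) n dual_basis (ns j) p" if "j < n" "p < n" for j p
  proof -
    have "ns j (b p) = (\<Sum>q<n. coord (torus_N T) n dual_basis (ns j) q * dual_basis q (b p))"
      using N.additive_map_expand[OF _ NS.basis_mem[OF that(1)], of "\<lambda>f. f (b p)"]
        additive_map_int_dual_eval[OF M.basis_mem[OF that(2)]]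
      by (simp add: torus_N_def)
    also have "\<dots> = (\<Sum>q<n. if q = p then coord (torus_N T) n dual_basis (ns j) q else 0)"
      using that by (intro sum.cong refl) (simp add: dual_basis_def M.basis_mem M.coord_basis)
    finally show ?thesis using that by simp
  qed
  then have "ndet n ?N = ndet n (\<lambda>p j. real_of_int (coord (torus_N T) n dual_basis (ns j) p))"
    by (intro ndet_cong) simp
  also have "\<dots> = ndet n (\<lambda>j p. real_of_int (coord (torus_N T) n dual_basis (ns j) p))"
    by (rule ndet_transpose)
  finally have N: "ndet n ?N = 1 \<or> ndet n ?N = - 1"
    using ndet_change_of_basis[OF NS.based_lattice_axioms N.based_lattice_axioms] by simp
  have "ndet n (\<lambda>i j. of_int (ns j (\<rho> (bs i)))) = ndet n (\<lambda>i j. \<Sum>p<n. ?W i p * ?N p j)"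
  proof (rule ndet_cong)
    fix i j assume ij: "i < n" "j < n"
    have "additive_map (tlam T) (\<lambda>l. real_of_int (ns j (\<rho> l)))"
      using additive_map_of_int[OF additive_map_comp_hom[OF ns_add[OF ij(2)] rho_hom]] .
    from L.additive_map_expand[OF this BS.basis_mem[OF ij(1)]]
    show "real_of_int (ns j (\<rho> (bs i))) = (\<Sum>p<n. ?W i p * ?N p j)"
      by (simp add: lb_def M.basis_mem)
  qed
  then have main: "ndet n (\<lambda>i j. of_int (ns j (\<rho> (bs i)))) = ndet n ?W * ndet n ?N"
    by (simp add: ndet_mult)
  have "ndet n ?W * ndet n gram = ndet n (\<lambda>i l. \<Sum>p<n. ?W i p * gram p l)"
    by (rule ndet_mult[symmetric])
  also have "\<dots> = ndet n (\<lambda>i l. \<Sum>j<n. A i j * ?N l j)"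
  proof (rule ndet_cong)
    fix i l assume il: "i < n" "l < n"
    show "(\<Sum>p<n. ?W i p * gram p l) = (\<Sum>j<n. A i j * ?N l j)"
      using L.additive_map_expand[OF pair_left[OF M.basis_mem[OF il(2)]] BS.basis_mem[OF il(1)]]
        A[OF il(1) M.basis_mem[OF il(2)]] by simp
  qed
  also have "\<dots> = ndet n A * ndet n ?N"
    by (simp add: ndet_mult[where B = "\<lambda>j l. ?N l j"] ndet_transpose[of n ?N])
  finally have "ndet n ?W * ndet n gram = ndet n A * ndet n ?N" .
  then have "ndet n ?W = ndet n ?N"
    using W N A_pos gram_pos by auto
  then show ?thesis using main W by auto
qed

text \<open>A minor complementary to the polarization part, for a matrix of determinant 1. The
  factorial that remains is the one cancelled by the denominator \<open>fact (g0 - d)\<close> in the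
  theorem.\<close>

lemma polarization_power_eq:
  assumes "d \<le> n"
  shows "polarization_power T \<rho> (n - d) = hom_restrict T d d
    (\<lambda>f m. fact (n - d) * ndet d (\<lambda>i j. of_int (f i (\<rho>i (m j)))))"
proof -
  obtain bs ns where some: "(SOME p. oriented_bases T p) = (bs, ns)"
    by (cases "SOME p. oriented_bases T p") auto
  have or: "oriented_bases T (bs, ns)"
    using someI_ex[OF oriented_bases_exist] some by simp
  interpret BS: based_lattice "tlam T" n bs
    using or by unfold_locales (simp add: oriented_bases_def torus_dim_eq)
  interpret NS: based_lattice "torus_N T" n ns
    using or by unfold_locales (simp add: oriented_bases_def torus_dim_eq)
  interpret RB: based_lattice "tform T" n "\<lambda>i. \<rho> (bs i)"
    by (rule lattice_iso[OF BS.based_lattice_axioms M.comm_group_axioms rho_iso])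
  define k where "k = n - d"
  have n: "k + d = n" "n - k = d" using assms by (auto simp: k_def)
  define A where "A = (\<lambda>i j. real_of_int (ns j (\<rho> (bs i))))"
  have A1: "ndet n A = 1" unfolding A_def by (rule oriented_bases_ndet[OF or])
  obtain V where V: "\<And>i j. i < n \<Longrightarrow> j < n \<Longrightarrow> (\<Sum>k<n. A i k * V k j) = (if i = j then 1 else 0)"
    and "\<And>i j. i < n \<Longrightarrow> j < n \<Longrightarrow> (\<Sum>k<n. V i k * A k j) = (if i = j then 1 else 0)"
    using ndet_inverse[of n A] A1 by auto
  have ns_add: "additive_map (tform T) (\<lambda>m. real_of_int (ns j m))" if "j < n" for j
    using NS.basis_mem[OF that] by (simp add: torus_N_def int_dual_mem additive_map_of_int)
  have key: "cup k k d d (cup_power (polarization_form \<rho>) k) (cohom_decomp d d f m) bs ns =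
      fact k * ndet d (\<lambda>i j. of_int (f i (\<rho>i (m j))))"
    if fm: "(f, m) \<in> hom_dom T d d" for f m
  proof -
    have f: "f i \<in> carrier (int_dual (tlam T))" and m: "m i \<in> carrier (tform T)" if "i < d" for i
      using fm that by (auto simp: hom_dom_def)
    \<comment> \<open>Since \<open>V\<close> inverts the polarization matrix, these are the real
      coefficients that express \<open>f j \<circ> \<rho>i\<close> through the functionals
      \<open>ns\<close>.\<close>
    define F' where "F' = (\<lambda>j a. \<Sum>c<n. V a c * of_int (f j (bs c)))"
    have F: "real_of_int (f j (bs a)) = (\<Sum>c<n. F' j c * A a c)" if a: "a < n" for j a
    proof -
      have "(\<Sum>c<n. F' j c * A a c) = (\<Sum>e<n. (\<Sum>c<n. A a c * V c e) * of_int (f j (bs e)))"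
        unfolding F'_def sum_distrib_left sum_distrib_right by (subst sum.swap) (simp add: mult_ac)
      also have "\<dots> = (\<Sum>e<n. if a = e then of_int (f j (bs e)) else 0)"
        using a by (intro sum.cong refl) (simp add: V)
      finally show ?thesis using a by simp
    qed
    have "cup k k d d (cup_power (polarization_form \<rho>) k) (cohom_decomp d d f m) bs ns =
        fact k * ndet (k + d) A * ndet d (\<lambda>i j. \<Sum>a<k + d. F' i a * of_int (ns a (m j)))"
      unfolding cup_polarization_decomp A_def
      by (rule double_permutation_sum[where C = "\<lambda>j a. of_int (ns a (m j))"])
         (simp add: n F, simp add: A_def)
    also have "\<dots> = fact k * ndet d (\<lambda>i j. \<Sum>a<n. F' i a * of_int (ns a (m j)))"
      by (simp add: n A1)
    also have "ndet d (\<lambda>i j. \<Sum>a<n. F' i a * of_int (ns a (m j))) = ndet d (\<lambda>i j. of_int (f i (\<rho>i (m j))))"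
    proof (rule ndet_cong)
      fix i j assume ij: "i < d" "j < d"
      \<comment> \<open>\<open>\<phi>\<close> and \<open>f i \<circ> \<rho>i\<close> are additive
        and agree on the basis \<open>\<rho> (bs a)\<close>, hence also on
        \<open>m j\<close>.\<close>
      define \<phi> where "\<phi> = (\<lambda>m. \<Sum>a<n. F' i a * of_int (ns a m))"
      have \<phi>: "additive_map (tform T) \<phi>"
        using ns_add by (auto simp: additive_map_def \<phi>_def sum.distrib[symmetric] distrib_left[symmetric]
            simp del: of_int_add intro!: sum.cong)
      have "additive_map (tlam T) (f i)" using f[OF ij(1)] by (simp add: int_dual_mem)
      then have \<psi>: "additive_map (tform T) (\<lambda>m. real_of_int (f i (\<rho>i m)))"
        using additive_map_of_int[OF additive_map_comp_hom[OF _ rhoi_hom]] by blast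
      have "\<phi> (m j) = real_of_int (f i (\<rho>i (m j)))"
        unfolding RB.additive_map_expand[OF \<phi> m[OF ij(2)]] RB.additive_map_expand[OF \<psi> m[OF ij(2)]]
        by (intro sum.cong refl) (simp add: \<phi>_def F BS.basis_mem A_def)
      then show "(\<Sum>a<n. F' i a * of_int (ns a (m j))) = real_of_int (f i (\<rho>i (m j)))"
        by (simp add: \<phi>_def)
    qed
    finally show ?thesis .
  qed
  show ?thesis
    unfolding polarization_power_def poincare_dual_def torus_dim_eq some Let_def prod.case k_def[symmetric] n(2)
    by (auto simp: hom_restrict_def fun_eq_iff key)
qed

text \<open>The values are integers, hence rational; the determinant is alternating and additive in
  its rows, which serves the arguments \<open>f\<close>, and after transposition also the arguments
  \<open>m\<close>.\<close>

lemma ndet_class_trop_homology: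
  "hom_restrict T d d (\<lambda>f m. of_int c * ndet d (\<lambda>i j. of_int (f i (\<rho>i (m j))))) \<in> trop_homology T d d"
  unfolding trop_homology_def
proof (intro CollectI conjI allI ballI impI)
  let ?F = "hom_restrict T d d (\<lambda>f m. of_int c * ndet d (\<lambda>i j. of_int (f i (\<rho>i (m j)))))"
  fix f :: "nat \<Rightarrow> 'l \<Rightarrow> int" and m :: "nat \<Rightarrow> 'm"
  show "?F f m = 0" if "(f, m) \<notin> hom_dom T d d" using that by (simp add: hom_restrict_def)
  have "ndet d (\<lambda>i j. of_int (f i (\<rho>i (m j)))) \<in> \<int>" by (rule ndet_Ints) simp
  then show "?F f m \<in> \<rat>" by (auto simp: hom_restrict_def elim!: Ints_cases)
next
  fix m assume m: "m \<in> {..<d} \<rightarrow>\<^sub>E carrier (tform T)"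
  have "alternating_multilinear (int_dual (tlam T)) d
      (\<lambda>f. of_int c * ndet d (\<lambda>i j. of_int (f i (\<rho>i (m j)))))"
    using m by (intro alternating_multilinear_ndet additive_map_of_int additive_map_int_dual_eval rhoi_mem) auto
  \<comment> \<open>Replacing one argument keeps the tuple in the domain, so the cut-off to 0
    outside it does not disturb multilinearity.\<close>
  moreover have "f(i := a) \<in> {..<d} \<rightarrow>\<^sub>E carrier (int_dual (tlam T))"
    if "f \<in> {..<d} \<rightarrow>\<^sub>E carrier (int_dual (tlam T))" "i < d" "a \<in> carrier (int_dual (tlam T))" for f i a
    using that by (auto simp: PiE_iff extensional_def)
  moreover have "a \<otimes>\<^bsub>int_dual (tlam T)\<^esub> a' \<in> carrier (int_dual (tlam T))"
    if "a \<in> carrier (int_dual (tlam T))" "a' \<in> carrier (int_dual (tlam T))" for a a'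
    using that comm_group_int_dual[OF L.comm_group_axioms]
    by (simp add: comm_group_def comm_monoid_def monoid.m_closed)
  ultimately show "alternating_multilinear (int_dual (tlam T)) d
      (\<lambda>f. hom_restrict T d d (\<lambda>f m. of_int c * ndet d (\<lambda>i j. of_int (f i (\<rho>i (m j))))) f m)"
    using m by (simp add: alternating_multilinear_def hom_restrict_def hom_dom_def)
next
  fix f assume f: "f \<in> {..<d} \<rightarrow>\<^sub>E carrier (int_dual (tlam T))"
  have "additive_map (tform T) (\<lambda>m. real_of_int (f i (\<rho>i m)))" if "i < d" for i
  proof -
    have "f i \<in> carrier (int_dual (tlam T))" using f that by auto
    then show ?thesis
      by (intro additive_map_of_int additive_map_comp_hom[OF _ rhoi_hom]) (simp add: int_dual_mem)
  qed
  then have "alternating_multilinear (tform T) d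
      (\<lambda>m. of_int c * ndet d (\<lambda>i j. of_int (f j (\<rho>i (m i)))))"
    by (rule alternating_multilinear_ndet)
  moreover have "ndet d (\<lambda>i j. of_int (f j (\<rho>i (m i)))) = ndet d (\<lambda>i j. of_int (f i (\<rho>i (m j))))" for m
    by (rule ndet_transpose)
  moreover have "m(i := a) \<in> {..<d} \<rightarrow>\<^sub>E carrier (tform T)"
    if "m \<in> {..<d} \<rightarrow>\<^sub>E carrier (tform T)" "i < d" "a \<in> carrier (tform T)" for m i a
    using that by (auto simp: PiE_iff extensional_def)
  ultimately show "alternating_multilinear (tform T) d
      (hom_restrict T d d (\<lambda>f m. of_int c * ndet d (\<lambda>i j. of_int (f i (\<rho>i (m j))))) f)"
    using f by (simp add: alternating_multilinear_def hom_restrict_def hom_dom_def)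
qed

end

section \<open>Metric graphs\<close>

lemma lookup_frag_extend:
  assumes "finite S" "Poly_Mapping.keys c \<subseteq> S"
  shows "Poly_Mapping.lookup (frag_extend f c) x = (\<Sum>i\<in>S. Poly_Mapping.lookup c i * Poly_Mapping.lookup (f i) x)"
  using assms unfolding frag_extend_def lookup_sum lookup_frag_cmul
  by (intro sum.mono_neutral_left) (auto simp: in_keys_iff)

definition cycles :: "('v, 'e) metric_graph \<Rightarrow> ('e \<Rightarrow>\<^sub>0 int) set" where
  "cycles G = {c. Poly_Mapping.keys c \<subseteq> edges G \<and> boundary G c = 0}"

lemma H1_eq: "H1 G = frag_group (cycles G)"
  by (simp add: H1_def frag_group_def cycles_def free_Abelian_group_def kernel_def)

lemma frag_subgroup_cycles: "frag_subgroup (cycles G)"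
  using keys_add by (fastforce simp: frag_subgroup_def cycles_def boundary_def frag_extend_add frag_extend_minus)

lemma cycles_keys: "c \<in> cycles G \<Longrightarrow> Poly_Mapping.keys c \<subseteq> edges G"
  by (simp add: cycles_def)

lemma frag_subgroup_diff: "frag_subgroup C \<Longrightarrow> c \<in> C \<Longrightarrow> c' \<in> C \<Longrightarrow> c - c' \<in> C"
  unfolding diff_conv_add_uminus frag_subgroup_def by blast

lemma cycles_closed:
  "c \<in> cycles G \<Longrightarrow> c' \<in> cycles G \<Longrightarrow> c + c' \<in> cycles G"
  "c \<in> cycles G \<Longrightarrow> - c \<in> cycles G"
  "c \<in> cycles G \<Longrightarrow> c' \<in> cycles G \<Longrightarrow> c - c' \<in> cycles G"
  using frag_subgroup_cycles[of G] frag_subgroup_diff[OF frag_subgroup_cycles] by (simp_all add: frag_subgroup_def)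

lemma lookup_boundary:
  assumes "finite (edges G)" "Poly_Mapping.keys c \<subseteq> edges G"
  shows "Poly_Mapping.lookup (boundary G c) v =
    (\<Sum>e\<in>edges G. Poly_Mapping.lookup c e * (of_bool (tgt G e = v) - of_bool (src G e = v)))"
  unfolding boundary_def lookup_frag_extend[OF assms] lookup_minus
  by (intro sum.cong refl) (auto simp: lookup_frag_of)

definition frag_of_fun :: "'e set \<Rightarrow> ('e \<Rightarrow> int) \<Rightarrow> 'e \<Rightarrow>\<^sub>0 int" where
  "frag_of_fun E k = (\<Sum>e\<in>E. frag_cmul (k e) (frag_of e))"

lemma lookup_frag_of_fun:
  assumes "finite E"
  shows "Poly_Mapping.lookup (frag_of_fun E k) e = (if e \<in> E then k e else 0)"
proof -
  have "Poly_Mapping.lookup (frag_of_fun E k) e = (\<Sum>e'\<in>E. if e' = e then k e' else 0)"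
    unfolding frag_of_fun_def lookup_sum by (intro sum.cong refl) simp
  then show ?thesis using assms by simp
qed

lemma keys_frag_of_fun: "finite E \<Longrightarrow> Poly_Mapping.keys (frag_of_fun E k) \<subseteq> E"
  by (rule subsetI, rule ccontr) (simp add: in_keys_iff lookup_frag_of_fun)

lemma cycle_integral_add:
  "cycle_integral G (c + c') w = cycle_integral G c w + cycle_integral G c' w"
  "cycle_integral G c (w + w') = cycle_integral G c w + cycle_integral G c w'"
  by (simp_all add: cycle_integral_def lookup_add sum.distrib algebra_simps)

lemma cycle_integral_diff:
  "cycle_integral G (c - c') w = cycle_integral G c w - cycle_integral G c' w"
  "cycle_integral G c (w - w') = cycle_integral G c w - cycle_integral G c w'"
  by (simp_all add: cycle_integral_def lookup_minus sum_subtractf algebra_simps)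

lemma cycle_integral_minus:
  "cycle_integral G c (- w) = - cycle_integral G c w"
  by (simp add: cycle_integral_def sum_negf)

lemma path_integral_add:
  "path_integral ps (w + w') = path_integral ps w + path_integral ps w'"
  by (induction ps) (auto simp: path_integral_def lookup_add algebra_simps)

lemma path_integral_append: "path_integral (ps @ qs) w = path_integral ps w + path_integral qs w"
  by (simp add: path_integral_def)

lemma is_path_append: "is_path G x ps y \<Longrightarrow> is_path G y qs z \<Longrightarrow> is_path G x (ps @ qs) z"
  by (induction rule: is_path.induct) (auto intro: is_path.intros)

lemma is_path_segment:
  "e \<in> edges G \<Longrightarrow> a \<in> {0..len G e} \<Longrightarrow> b \<in> {0..len G e} \<Longrightarrow>
    is_path G (edge_point G e a) [(e, a, b)] (edge_point G e b)"
  by (intro is_path.intros)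

text \<open>The net signed length travelled along \<open>e\<close>. The integral of a form over a
  path depends on the path only through these numbers.\<close>

definition displacement :: "('e \<times> real \<times> real) list \<Rightarrow> 'e \<Rightarrow> real" where
  "displacement ps e = (\<Sum>(e', a, b)\<leftarrow>ps. if e' = e then b - a else 0)"

lemma displacement_simps:
  "displacement [] e = 0"
  "displacement ((e', a, b) # ps) e = (if e' = e then b - a else 0) + displacement ps e"
  by (simp_all add: displacement_def)

section \<open>Path integrals modulo periods\<close>

locale metric_curve =
  fixes G :: "('v, 'e) metric_graph"
  assumes curve: "tropical_curve G"
begin

lemma finite_edges: "finite (edges G)" and finite_verts: "finite (verts G)"
  and len_pos: "e \<in> edges G \<Longrightarrow> 0 < len G e"
  and src_mem: "e \<in> edges G \<Longrightarrow> src G e \<in> verts G" and tgt_mem: "e \<in> edges G \<Longrightarrow> tgt G e \<in> verts G"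
  using curve by (auto simp: tropical_curve_def)

lemma edge_point_ends: "edge_point G e 0 = Vertex (src G e)" "e \<in> edges G \<Longrightarrow> edge_point G e (len G e) = Vertex (tgt G e)"
  using len_pos[of e] by (auto simp: edge_point_def)

lemma vertex_path_exists:
  assumes "u \<in> verts G" "v \<in> verts G"
  shows "\<exists>ps. is_path G (Vertex u) ps (Vertex v)"
proof -
  have "(u, v) \<in> ((\<Union>e\<in>edges G. {(src G e, tgt G e), (tgt G e, src G e)}))\<^sup>*"
    using curve assms by (auto simp: tropical_curve_def)
  then show ?thesis
  proof (induction rule: rtrancl_induct)
    case base
    then show ?case using is_path.intros(1) by blast
  next
    case (step y z)
    then obtain ps where ps: "is_path G (Vertex u) ps (Vertex y)" by blast
    obtain e where e: "e \<in> edges G" "(y, z) = (src G e, tgt G e) \<or> (y, z) = (tgt G e, src G e)"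
      using step.hyps(2) by auto
    have m: "0 \<in> {0..len G e}" "len G e \<in> {0..len G e}" using len_pos[OF e(1)] by auto
    have "is_path G (Vertex (src G e)) [(e, 0, len G e)] (Vertex (tgt G e))"
      "is_path G (Vertex (tgt G e)) [(e, len G e, 0)] (Vertex (src G e))"
      using is_path_segment[OF e(1) m] is_path_segment[OF e(1) m(2,1)] e(1) by (simp_all add: edge_point_ends)
    then have "\<exists>qs. is_path G (Vertex y) qs (Vertex z)" using e(2) by auto
    then show ?case using is_path_append[OF ps] by blast
  qed
qed

lemma path_exists:
  assumes "x \<in> points G" "y \<in> points G"
  shows "\<exists>ps. is_path G x ps y"
proof -
  have seg: "\<exists>u\<in>verts G. (\<exists>ps. is_path G z ps (Vertex u)) \<and> (\<exists>ps. is_path G (Vertex u) ps z)"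
    if z: "z \<in> points G" for z
  proof (cases z)
    case (Vertex u)
    then show ?thesis using z is_path.intros(1) by (fastforce simp: points_def)
  next
    case (Interior e t)
    then have e: "e \<in> edges G" "0 < t" "t < len G e" using z by (auto simp: points_def)
    then have m: "0 \<in> {0..len G e}" "t \<in> {0..len G e}" by auto
    have "edge_point G e t = z" using e Interior by (simp add: edge_point_def)
    then have "is_path G z [(e, t, 0)] (Vertex (src G e))" "is_path G (Vertex (src G e)) [(e, 0, t)] z"
      using is_path_segment[OF e(1) m] is_path_segment[OF e(1) m(2,1)] by (simp_all add: edge_point_ends)
    then show ?thesis using src_mem[OF e(1)] by blast
  qed
  obtain u ps where u: "u \<in> verts G" "is_path G x ps (Vertex u)" using seg[OF assms(1)] by blast
  obtain v qs where v: "v \<in> verts G" "is_path G (Vertex v) qs y" using seg[OF assms(2)] by blast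
  obtain rs where "is_path G (Vertex u) rs (Vertex v)" using vertex_path_exists[OF u(1) v(1)] by blast
  then show ?thesis using is_path_append u(2) v(2) by metis
qed

lemma path_integral_displacement:
  assumes "is_path G x ps y"
  shows "path_integral ps w = (\<Sum>e\<in>edges G. of_int (Poly_Mapping.lookup w e) * displacement ps e)"
  using assms
proof (induction rule: is_path.induct)
  case (1 x)
  then show ?case by (simp add: path_integral_def displacement_def)
next
  case (2 e a b ps y)
  have "(\<Sum>e'\<in>edges G. of_int (Poly_Mapping.lookup w e') * displacement ((e, a, b) # ps) e') =
     (\<Sum>e'\<in>edges G. (if e = e' then of_int (Poly_Mapping.lookup w e') * (b - a) else 0) +
        of_int (Poly_Mapping.lookup w e') * displacement ps e')"
    by (intro sum.cong refl) (simp add: displacement_simps distrib_left)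
  also have "\<dots> = of_int (Poly_Mapping.lookup w e) * (b - a) + path_integral ps w"
    using 2 finite_edges by (simp add: sum.distrib)
  finally show ?case by (simp add: path_integral_def)
qed

text \<open>The position on the circle of length \<open>len G e\<close> that arises when everything
  outside the open edge \<open>e\<close> is collapsed to the point 0.\<close>

definition param :: "'e \<Rightarrow> ('v, 'e) gpoint \<Rightarrow> real" where
  "param e z = (case z of Vertex v \<Rightarrow> 0 | Interior e' t \<Rightarrow> if e' = e then t else 0)"

text \<open>After collapsing everything outside \<open>e\<close>, a path becomes a path on a circle
  of length \<open>len G e\<close>, and its displacement is determined by the end points up to full
  turns.\<close>

lemma displacement_mod_len:
  assumes "is_path G x ps y"
  shows "\<exists>k::int. displacement ps e = param e y - param e x + of_int k * len G e"
  using assms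
proof (induction rule: is_path.induct)
  case (1 x)
  then show ?case by (intro exI[of _ 0]) (simp add: displacement_simps)
next
  case (2 e' a b ps y)
  obtain k :: int where k: "displacement ps e = param e y - param e (edge_point G e' b) + of_int k * len G e"
    using "2.IH" ..
  have ep: "\<exists>k::int. param e (edge_point G e' t) = (if e' = e then t else 0) + of_int k * len G e" for t
  proof -
    consider "e' \<noteq> e" | "e' = e" "t = 0" | "e' = e" "t \<noteq> 0" "t = len G e" | "e' = e" "t \<noteq> 0" "t \<noteq> len G e"
      by argo
    \<comment> \<open>The far end of \<open>e\<close> is collapsed to 0 although its parameter is
      the full length; this costs one turn backwards.\<close>
    then have "param e (edge_point G e' t) =
        (if e' = e then t else 0) + of_int (if e' = e \<and> t \<noteq> 0 \<and> t = len G e then - 1 else 0) * len G e"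
    proof cases
      case 3
      then have "edge_point G e' t = Vertex (tgt G e)" by (simp add: edge_point_def)
      then have "param e (edge_point G e' t) = 0" by (simp add: param_def)
      then show ?thesis using 3 by simp
    next
      case 4
      then have "edge_point G e' t = Interior e t" by (simp add: edge_point_def)
      then have "param e (edge_point G e' t) = t" by (simp add: param_def)
      then show ?thesis using 4 by simp
    qed (simp_all add: edge_point_def param_def)
    then show ?thesis ..
  qed
  obtain ka :: int where ka: "param e (edge_point G e' a) = (if e' = e then a else 0) + of_int ka * len G e"
    using ep[of a] ..
  obtain kb :: int where kb: "param e (edge_point G e' b) = (if e' = e then b else 0) + of_int kb * len G e"
    using ep[of b] ..
  have "displacement ((e', a, b) # ps) e = param e y - param e (edge_point G e' a) + of_int (k + ka - kb) * len G e"
    unfolding displacement_simps k ka kb by (simp add: algebra_simps)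
  then show ?case ..
qed

text \<open>Along a closed path the increments of \<open>hat v\<close> telescope to \<open>0\<close>, so the displacements of a closed
  path are the coefficients of a cycle.\<close>

definition hat :: "'v \<Rightarrow> ('v, 'e) gpoint \<Rightarrow> real" where
  "hat v z = (case z of Vertex u \<Rightarrow> of_bool (u = v)
    | Interior e t \<Rightarrow> (1 - t / len G e) * of_bool (src G e = v) + t / len G e * of_bool (tgt G e = v))"

text \<open>\<open>hat v\<close> is affine along every edge, so each segment changes it by exactly
  the term that the segment adds on the left.\<close>

lemma displacement_boundary:
  assumes "is_path G x ps y"
  shows "(\<Sum>e\<in>edges G. displacement ps e / len G e * (of_bool (tgt G e = v) - of_bool (src G e = v))) = hat v y - hat v x"
  using assms
proof (induction rule: is_path.induct)
  case (1 x)
  then show ?case by (simp add: displacement_simps)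
next
  case (2 e a b ps y)
  let ?\<delta> = "\<lambda>e. of_bool (tgt G e = v) - of_bool (src G e = v) :: real"
  have l: "len G e > 0" using len_pos 2 by simp
  have ep: "hat v (edge_point G e t) = of_bool (src G e = v) + t / len G e * ?\<delta> e" for t
    using l by (auto simp: hat_def edge_point_def algebra_simps)
  have "(\<Sum>e'\<in>edges G. displacement ((e, a, b) # ps) e' / len G e' * ?\<delta> e') =
     (\<Sum>e'\<in>edges G. (if e = e' then (b - a) / len G e' * ?\<delta> e' else 0) + displacement ps e' / len G e' * ?\<delta> e')"
    by (intro sum.cong refl) (simp add: displacement_simps add_divide_distrib distrib_right)
  also have "\<dots> = (b - a) / len G e * ?\<delta> e + (hat v y - hat v (edge_point G e b))"
    using 2 finite_edges by (simp add: sum.distrib)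
  also have "\<dots> = hat v y - hat v (edge_point G e a)"
    unfolding ep by (simp add: diff_divide_distrib left_diff_distrib)
  finally show ?case .
qed

text \<open>With common end points the displacements differ by whole turns \<open>k e\<close> around
  each edge. The chain with these coefficients is closed because the increments of every
  \<open>hat v\<close> agree, and its integrals are the differences of the path integrals. Thus the
  chosen path is immaterial modulo periods.\<close>

lemma path_difference_cycle:
  assumes ps: "is_path G x ps y" and qs: "is_path G x qs y"
  obtains c where "c \<in> cycles G" "\<And>w. path_integral ps w = cycle_integral G c w + path_integral qs w"
proof -
  have "\<exists>k::int. displacement ps e - displacement qs e = of_int k * len G e" for e
  proof -
    obtain k :: int where k: "displacement ps e = param e y - param e x + of_int k * len G e"
      using displacement_mod_len[OF ps] ..
    obtain l :: int where l: "displacement qs e = param e y - param e x + of_int l * len G e"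
      using displacement_mod_len[OF qs] ..
    have "displacement ps e - displacement qs e = of_int (k - l) * len G e"
      unfolding k l by (simp add: algebra_simps)
    then show ?thesis ..
  qed
  then obtain k :: "'e \<Rightarrow> int" where k: "\<And>e. displacement ps e - displacement qs e = of_int (k e) * len G e"
    by metis
  define c where "c = frag_of_fun (edges G) k"
  have ck: "Poly_Mapping.lookup c e = k e" if "e \<in> edges G" for e
    using that by (simp add: c_def lookup_frag_of_fun finite_edges)
  have keys: "Poly_Mapping.keys c \<subseteq> edges G"
    by (simp add: c_def keys_frag_of_fun finite_edges)
  have "boundary G c = 0"
  proof (rule poly_mapping_eqI)
    fix v
    let ?\<delta> = "\<lambda>e. of_bool (tgt G e = v) - of_bool (src G e = v) :: real"
    have "real_of_int (Poly_Mapping.lookup (boundary G c) v) = (\<Sum>e\<in>edges G. of_int (k e) * ?\<delta> e)"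
      unfolding lookup_boundary[OF finite_edges keys] of_int_sum
      by (intro sum.cong refl) (simp add: ck)
    also have "\<dots> = (\<Sum>e\<in>edges G. displacement ps e / len G e * ?\<delta> e) - (\<Sum>e\<in>edges G. displacement qs e / len G e * ?\<delta> e)"
      unfolding sum_subtractf[symmetric] left_diff_distrib[symmetric] diff_divide_distrib[symmetric] k
      using len_pos by (intro sum.cong refl) force
    also have "\<dots> = 0"
      unfolding displacement_boundary[OF ps] displacement_boundary[OF qs] by simp
    finally show "Poly_Mapping.lookup (boundary G c) v = Poly_Mapping.lookup 0 v" by simp
  qed
  then have "c \<in> cycles G" using keys by (simp add: cycles_def)
  moreover have "path_integral ps w = cycle_integral G c w + path_integral qs w" for w
  proof -
    have "path_integral ps w - path_integral qs w =
        (\<Sum>e\<in>edges G. of_int (Poly_Mapping.lookup w e) * (displacement ps e - displacement qs e))"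
      by (simp add: path_integral_displacement[OF ps] path_integral_displacement[OF qs]
          sum_subtractf right_diff_distrib)
    also have "\<dots> = cycle_integral G c w"
      unfolding cycle_integral_def k by (intro sum.cong refl) (simp add: ck)
    finally show ?thesis by simp
  qed
  ultimately show ?thesis by (rule that)
qed

end

section \<open>Double covers\<close>

locale cover =
  fixes Gt :: "('v, 'e) metric_graph" and G :: "('w, 'f) metric_graph"
    and \<pi> :: "('v, 'e, 'w, 'f) graph_cover"
  assumes cover: "double_cover Gt G \<pi>"
begin

sublocale Gt: metric_curve Gt
  using cover by unfold_locales (simp add: double_cover_def)

sublocale G: metric_curve G
  using cover by unfold_locales (simp add: double_cover_def)

abbreviation \<iota> :: "'e \<Rightarrow> 'e" where "\<iota> \<equiv> sheet_swap Gt \<pi>"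

definition fiber :: "'f \<Rightarrow> 'e set" where
  "fiber f = {e \<in> edges Gt. emap \<pi> e = f}"

lemma harmonic: "harmonic_morphism Gt G \<pi>"
  using cover by (simp add: double_cover_def)

lemma emap_mem: "e \<in> edges Gt \<Longrightarrow> emap \<pi> e \<in> edges G"
  and edeg_pos: "e \<in> edges Gt \<Longrightarrow> edeg \<pi> e \<ge> 1"
  and src_emap: "e \<in> edges Gt \<Longrightarrow> src G (emap \<pi> e) = vmap \<pi> (src Gt e)"
  and tgt_emap: "e \<in> edges Gt \<Longrightarrow> tgt G (emap \<pi> e) = vmap \<pi> (tgt Gt e)"
  and len_emap: "e \<in> edges Gt \<Longrightarrow> len G (emap \<pi> e) = of_nat (edeg \<pi> e) * len Gt e"
  using harmonic unfolding harmonic_morphism_def by auto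

lemma vdeg_src: "v \<in> verts Gt \<Longrightarrow> f \<in> edges G \<Longrightarrow> src G f = vmap \<pi> v \<Longrightarrow>
    (\<Sum>e\<in>{e \<in> fiber f. src Gt e = v}. edeg \<pi> e) = vdeg \<pi> v"
  and vdeg_tgt: "v \<in> verts Gt \<Longrightarrow> f \<in> edges G \<Longrightarrow> tgt G f = vmap \<pi> v \<Longrightarrow>
    (\<Sum>e\<in>{e \<in> fiber f. tgt Gt e = v}. edeg \<pi> e) = vdeg \<pi> v"
  using harmonic unfolding harmonic_morphism_def fiber_def by (simp_all add: conj_ac)

lemma finite_fiber: "finite (fiber f)"
  using Gt.finite_edges by (simp add: fiber_def)

text \<open>Grouping the edges over \<open>f\<close> by source, harmonicity turns every group into a
  local degree, and the local degrees over the source of \<open>f\<close> add up to 2.\<close>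

lemma sum_edeg_fiber:
  assumes f: "f \<in> edges G"
  shows "(\<Sum>e\<in>fiber f. edeg \<pi> e) = 2"
proof -
  let ?V = "{v \<in> verts Gt. vmap \<pi> v = src G f}"
  have "(\<Sum>e\<in>fiber f. edeg \<pi> e) = (\<Sum>v\<in>?V. \<Sum>e\<in>{e \<in> fiber f. src Gt e = v}. edeg \<pi> e)"
  proof (rule sum.group[symmetric])
    show "src Gt ` fiber f \<subseteq> ?V"
      using Gt.src_mem src_emap by (auto simp: fiber_def)
  qed (auto simp: finite_fiber Gt.finite_verts)
  also have "\<dots> = (\<Sum>v\<in>?V. vdeg \<pi> v)"
    using f by (intro sum.cong refl) (simp add: vdeg_src)
  also have "\<dots> = 2"
    using cover G.src_mem[OF f] by (simp add: double_cover_def)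
  finally show ?thesis .
qed

text \<open>Dilation factors are at least 1 and add up to 2 over an edge, so the only possibilities
  are 2 and 1 + 1.\<close>

lemma fiber_cases:
  assumes e: "e \<in> edges Gt"
  obtains (dilated) "fiber (emap \<pi> e) = {e}" "edeg \<pi> e = 2"
  | (free) e' where "e' \<noteq> e" "fiber (emap \<pi> e) = {e, e'}" "edeg \<pi> e = 1" "edeg \<pi> e' = 1"
proof -
  let ?F = "fiber (emap \<pi> e)"
  have eF: "e \<in> ?F" using e by (simp add: fiber_def)
  have pos: "edeg \<pi> e' \<ge> 1" if "e' \<in> ?F" for e' using that edeg_pos by (simp add: fiber_def)
  have s: "edeg \<pi> e + (\<Sum>e'\<in>?F - {e}. edeg \<pi> e') = 2"
    using sum_edeg_fiber[OF emap_mem[OF e]] by (simp add: sum.remove[OF finite_fiber eF])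
  show ?thesis
  proof (cases "?F - {e} = {}")
    case True
    then have "?F = {e}" using eF by auto
    then show ?thesis using s dilated by simp
  next
    case False
    then obtain e' where e': "e' \<in> ?F - {e}" by auto
    have s': "edeg \<pi> e + (edeg \<pi> e' + (\<Sum>x\<in>?F - {e} - {e'}. edeg \<pi> x)) = 2"
      using s unfolding sum.remove[OF finite_Diff[OF finite_fiber] e'] .
    then have d: "edeg \<pi> e = 1" "edeg \<pi> e' = 1" and z: "(\<Sum>x\<in>?F - {e} - {e'}. edeg \<pi> x) = 0"
      using pos[OF eF] pos[of e'] e' by auto
    have "?F - {e} - {e'} = {}"
    proof (rule ccontr)
      assume "?F - {e} - {e'} \<noteq> {}"
      then obtain x where x: "x \<in> ?F - {e} - {e'}" by auto
      then have "edeg \<pi> x = 0" using z finite_fiber by simp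
      then show False using pos[of x] x by auto
    qed
    then have "?F = {e, e'}" using eF e' by auto
    then show ?thesis using free[of e'] e' d by auto
  qed
qed

lemma sheet_swap_free:
  assumes "e \<in> edges Gt" "e' \<noteq> e" "fiber (emap \<pi> e) = {e, e'}"
  shows "\<iota> e = e'"
proof -
  have mem: "x \<in> edges Gt \<and> emap \<pi> x = emap \<pi> e \<longleftrightarrow> x = e \<or> x = e'" for x
    using assms(3) by (auto simp: fiber_def)
  have ex: "\<exists>x\<in>edges Gt. x \<noteq> e \<and> emap \<pi> x = emap \<pi> e"
    using mem[of e'] assms(2) by auto
  have "(THE x. x \<in> edges Gt \<and> x \<noteq> e \<and> emap \<pi> x = emap \<pi> e) = e'"
    using mem assms(2) by (intro the_equality) blast+
  then show ?thesis using assms(1) ex by (simp add: sheet_swap_def)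
qed

lemma sheet_swap_dilated:
  assumes "fiber (emap \<pi> e) = {e}"
  shows "\<iota> e = e"
proof -
  have "x = e" if "x \<in> edges Gt" "emap \<pi> x = emap \<pi> e" for x
    using assms that unfolding fiber_def by blast
  then show ?thesis unfolding sheet_swap_def by (auto simp del: not_ex)
qed

lemma sheet_swap_outside: "e \<notin> edges Gt \<Longrightarrow> \<iota> e = e"
  by (simp add: sheet_swap_def)

text \<open>The last identity is the edgewise form of pulling back a pushforward. Over a dilated
  edge the multiplicity 2 replaces the missing second sheet.\<close>

lemma sheet_swap_props:
  assumes e: "e \<in> edges Gt"
  shows "\<iota> e \<in> edges Gt" "emap \<pi> (\<iota> e) = emap \<pi> e" "\<iota> (\<iota> e) = e" "len Gt (\<iota> e) = len Gt e"
    and "int (edeg \<pi> e) * (\<Sum>e'\<in>fiber (emap \<pi> e). k e') = k e + k (\<iota> e)"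
proof -
  have "\<iota> e \<in> edges Gt \<and> emap \<pi> (\<iota> e) = emap \<pi> e \<and> \<iota> (\<iota> e) = e \<and> len Gt (\<iota> e) = len Gt e \<and>
      int (edeg \<pi> e) * (\<Sum>e'\<in>fiber (emap \<pi> e). k e') = k e + k (\<iota> e)"
    using e
  proof (cases rule: fiber_cases)
    case dilated
    then show ?thesis using e sheet_swap_dilated[OF dilated(1)] by simp
  next
    case (free e')
    have i: "\<iota> e = e'" by (rule sheet_swap_free[OF e free(1,2)])
    have e': "e' \<in> edges Gt" "emap \<pi> e' = emap \<pi> e" using free(2) by (auto simp: fiber_def)
    have "\<iota> e' = e" using free e' by (intro sheet_swap_free) auto
    moreover have "len Gt e' = len Gt e"
      using len_emap[OF e] len_emap[OF e'(1)] free e' by simp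
    ultimately show ?thesis using i e' free by simp
  qed
  then show "\<iota> e \<in> edges Gt" "emap \<pi> (\<iota> e) = emap \<pi> e" "\<iota> (\<iota> e) = e" "len Gt (\<iota> e) = len Gt e"
    "int (edeg \<pi> e) * (\<Sum>e'\<in>fiber (emap \<pi> e). k e') = k e + k (\<iota> e)" by auto
qed

lemma sheet_swap_involution: "\<iota> (\<iota> e) = e"
  using sheet_swap_props(3) sheet_swap_outside by (cases "e \<in> edges Gt") auto

abbreviation swap :: "('e \<Rightarrow>\<^sub>0 int) \<Rightarrow> 'e \<Rightarrow>\<^sub>0 int" where "swap \<equiv> chain_swap Gt \<pi>"

lemma lookup_swap: "Poly_Mapping.lookup (swap c) e = Poly_Mapping.lookup c (\<iota> e)"
proof -
  have eq: "e = \<iota> x \<longleftrightarrow> x = \<iota> e" for x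
    using sheet_swap_involution[of x] sheet_swap_involution[of e] by auto
  have "Poly_Mapping.lookup (swap c) e = (\<Sum>i\<in>Poly_Mapping.keys c. if i = \<iota> e then Poly_Mapping.lookup c i else 0)"
    unfolding chain_swap_def lookup_frag_extend[OF finite_keys order_refl]
    by (intro sum.cong refl) (simp add: eq)
  also have "\<dots> = Poly_Mapping.lookup c (\<iota> e)"
    by (simp add: in_keys_iff)
  finally show ?thesis .
qed

lemma swap_add: "swap (c + c') = swap c + swap c'" and swap_diff: "swap (c - c') = swap c - swap c'"
  and swap_minus: "swap (- c) = - swap c"
  by (simp_all add: chain_swap_def frag_extend_add frag_extend_diff frag_extend_minus)

lemma swap_swap: "swap (swap c) = c"
  by (rule poly_mapping_eqI) (simp add: lookup_swap sheet_swap_involution)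

lemma cycle_integral_swap: "cycle_integral Gt (swap c) (swap w) = cycle_integral Gt c w"
  unfolding cycle_integral_def lookup_swap
  by (rule sum.reindex_bij_witness[of _ \<iota> \<iota>])
     (auto simp: sheet_swap_involution sheet_swap_props)

section \<open>Pushforward and pullback of cycles\<close>

definition push :: "('e \<Rightarrow>\<^sub>0 int) \<Rightarrow> 'f \<Rightarrow>\<^sub>0 int" where
  "push = frag_extend (frag_of \<circ> emap \<pi>)"

text \<open>Dilated edges are pulled back with multiplicity \<open>2\<close>; this makes the pullback of a cycle a cycle.\<close>

definition pull :: "('f \<Rightarrow>\<^sub>0 int) \<Rightarrow> 'e \<Rightarrow>\<^sub>0 int" where
  "pull c = frag_of_fun (edges Gt) (\<lambda>e. int (edeg \<pi> e) * Poly_Mapping.lookup c (emap \<pi> e))"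

lemma lookup_push:
  assumes "Poly_Mapping.keys c \<subseteq> edges Gt"
  shows "Poly_Mapping.lookup (push c) f = (\<Sum>e\<in>fiber f. Poly_Mapping.lookup c e)"
proof -
  have "Poly_Mapping.lookup (push c) f = (\<Sum>e\<in>edges Gt. if emap \<pi> e = f then Poly_Mapping.lookup c e else 0)"
    unfolding push_def lookup_frag_extend[OF Gt.finite_edges assms] by (intro sum.cong refl) auto
  then show ?thesis
    using Gt.finite_edges by (simp add: fiber_def sum.inter_filter)
qed

lemma lookup_pull: "e \<in> edges Gt \<Longrightarrow>
    Poly_Mapping.lookup (pull c) e = int (edeg \<pi> e) * Poly_Mapping.lookup c (emap \<pi> e)"
  by (simp add: pull_def lookup_frag_of_fun Gt.finite_edges)

lemma pull_add: "pull (c + c') = pull c + pull c'"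
  by (rule poly_mapping_eqI)
     (simp add: pull_def lookup_frag_of_fun Gt.finite_edges lookup_add distrib_left)

lemma push_add: "push (c + c') = push c + push c'"
  by (simp add: push_def frag_extend_add)

lemma push_cycles:
  assumes c: "c \<in> cycles Gt"
  shows "push c \<in> cycles G"
proof -
  have "boundary G (push c) = frag_extend (frag_of \<circ> vmap \<pi>) (boundary Gt c)"
    using cycles_keys[OF c]
  proof (induction c rule: frag_induction)
    case (one e)
    then show ?case by (simp add: push_def boundary_def frag_extend_diff src_emap tgt_emap)
  next
    case (diff a b)
    then show ?case by (simp add: push_def boundary_def frag_extend_diff)
  qed (simp add: push_def boundary_def)
  then have "boundary G (push c) = 0" using c by (simp add: cycles_def)
  moreover have "Poly_Mapping.keys (push c) \<subseteq> edges G"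
    using keys_frag_extend[of "frag_of \<circ> emap \<pi>" c] cycles_keys[OF c] emap_mem
    by (fastforce simp: push_def keys_frag_of)
  ultimately show ?thesis by (simp add: cycles_def)
qed

text \<open>Formulated for an arbitrary \<open>end\<close> so as to serve sources and targets alike,
  since harmonicity holds at the two kinds of half-edges separately. Within each fibre the dilation
  factors at \<open>v\<close> sum to the local degree.\<close>

lemma pull_half_boundary:
  assumes "\<And>f. f \<in> edges G \<Longrightarrow> end' f = vmap \<pi> v \<Longrightarrow> (\<Sum>e\<in>{e \<in> fiber f. end e = v}. edeg \<pi> e) = vdeg \<pi> v"
    and "\<And>e. e \<in> edges Gt \<Longrightarrow> end' (emap \<pi> e) = vmap \<pi> (end e)"
  shows "(\<Sum>e\<in>edges Gt. int (edeg \<pi> e) * Poly_Mapping.lookup c (emap \<pi> e) * of_bool (end e = v)) =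
    int (vdeg \<pi> v) * (\<Sum>f\<in>edges G. Poly_Mapping.lookup c f * of_bool (end' f = vmap \<pi> v))"
proof -
  have "(\<Sum>e\<in>edges Gt. int (edeg \<pi> e) * Poly_Mapping.lookup c (emap \<pi> e) * of_bool (end e = v)) =
    (\<Sum>f\<in>edges G. \<Sum>e\<in>{e \<in> edges Gt. emap \<pi> e = f}. int (edeg \<pi> e) * Poly_Mapping.lookup c (emap \<pi> e) * of_bool (end e = v))"
    using emap_mem by (intro sum.group[symmetric]) (auto simp: Gt.finite_edges G.finite_edges)
  also have "\<dots> = (\<Sum>f\<in>edges G. int (vdeg \<pi> v) * (Poly_Mapping.lookup c f * of_bool (end' f = vmap \<pi> v)))"
  proof (rule sum.cong[OF refl])
    fix f assume f: "f \<in> edges G"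
    have "(\<Sum>e\<in>{e \<in> edges Gt. emap \<pi> e = f}. int (edeg \<pi> e) * Poly_Mapping.lookup c (emap \<pi> e) * of_bool (end e = v)) =
        (\<Sum>e\<in>fiber f. if end e = v then int (edeg \<pi> e) * Poly_Mapping.lookup c f else 0)"
      unfolding fiber_def by (intro sum.cong refl) auto
    also have "\<dots> = (\<Sum>e\<in>{e \<in> fiber f. end e = v}. int (edeg \<pi> e) * Poly_Mapping.lookup c f)"
      by (rule sum.inter_filter[symmetric, OF finite_fiber])
    also have "\<dots> = int (\<Sum>e\<in>{e \<in> fiber f. end e = v}. edeg \<pi> e) * Poly_Mapping.lookup c f"
      by (simp add: sum_distrib_right)
    also have "\<dots> = int (vdeg \<pi> v) * (Poly_Mapping.lookup c f * of_bool (end' f = vmap \<pi> v))"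
    proof (cases "end' f = vmap \<pi> v")
      case True
      then show ?thesis using assms(1)[OF f] by simp
    next
      case False
      then have empty: "{e \<in> fiber f. end e = v} = {}" using assms(2) by (auto simp: fiber_def)
      show ?thesis unfolding empty using False by simp
    qed
    finally show "(\<Sum>e\<in>{e \<in> edges Gt. emap \<pi> e = f}. int (edeg \<pi> e) * Poly_Mapping.lookup c (emap \<pi> e) * of_bool (end e = v)) =
        int (vdeg \<pi> v) * (Poly_Mapping.lookup c f * of_bool (end' f = vmap \<pi> v))" .
  qed
  finally show ?thesis by (simp add: sum_distrib_left)
qed

text \<open>The boundary of the pullback at \<open>v\<close> is the local degree of \<open>v\<close>
  times the boundary at its image, because both half-boundaries scale by the same factor.\<close>

lemma pull_cycles:
  assumes c: "c \<in> cycles G"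
  shows "pull c \<in> cycles Gt"
proof -
  have keys: "Poly_Mapping.keys (pull c) \<subseteq> edges Gt"
    by (simp add: pull_def keys_frag_of_fun Gt.finite_edges)
  have "boundary Gt (pull c) = 0"
  proof (rule poly_mapping_eqI)
    fix v
    let ?k = "\<lambda>e. int (edeg \<pi> e) * Poly_Mapping.lookup c (emap \<pi> e)"
    have eq: "Poly_Mapping.lookup (boundary Gt (pull c)) v =
        (\<Sum>e\<in>edges Gt. ?k e * of_bool (tgt Gt e = v)) - (\<Sum>e\<in>edges Gt. ?k e * of_bool (src Gt e = v))"
      unfolding lookup_boundary[OF Gt.finite_edges keys]
      by (simp add: lookup_pull right_diff_distrib sum_subtractf)
    show "Poly_Mapping.lookup (boundary Gt (pull c)) v = Poly_Mapping.lookup 0 v"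
    proof (cases "v \<in> verts Gt")
      case True
      have "Poly_Mapping.lookup (boundary Gt (pull c)) v =
          int (vdeg \<pi> v) * (\<Sum>f\<in>edges G. Poly_Mapping.lookup c f * of_bool (tgt G f = vmap \<pi> v)) -
          int (vdeg \<pi> v) * (\<Sum>f\<in>edges G. Poly_Mapping.lookup c f * of_bool (src G f = vmap \<pi> v))"
        unfolding eq using True
        by (intro arg_cong2[where f = "(-)"] pull_half_boundary) (simp_all add: vdeg_src vdeg_tgt src_emap tgt_emap)
      also have "\<dots> = int (vdeg \<pi> v) * Poly_Mapping.lookup (boundary G c) (vmap \<pi> v)"
        unfolding lookup_boundary[OF G.finite_edges cycles_keys[OF c]]
        by (simp add: right_diff_distrib sum_subtractf)
      finally show ?thesis using c by (simp add: cycles_def)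
    next
      case False
      then have "src Gt e \<noteq> v" "tgt Gt e \<noteq> v" if "e \<in> edges Gt" for e
        using that Gt.src_mem Gt.tgt_mem by auto
      then show ?thesis unfolding eq by simp
    qed
  qed
  then show ?thesis using keys by (simp add: cycles_def)
qed

lemma pull_push:
  assumes c: "Poly_Mapping.keys c \<subseteq> edges Gt"
  shows "pull (push c) = c + swap c"
proof (rule poly_mapping_eqI)
  fix e
  show "Poly_Mapping.lookup (pull (push c)) e = Poly_Mapping.lookup (c + swap c) e"
  proof (cases "e \<in> edges Gt")
    case True
    then show ?thesis
      by (simp add: lookup_pull lookup_push[OF c] sheet_swap_props(5) lookup_add lookup_swap)
  next
    case False
    then have "Poly_Mapping.lookup c e = 0" using c by (auto simp: in_keys_iff)
    then show ?thesis using False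
      by (simp add: pull_def lookup_frag_of_fun Gt.finite_edges lookup_add lookup_swap sheet_swap_outside)
  qed
qed

lemma push_pull:
  assumes c: "Poly_Mapping.keys c \<subseteq> edges G"
  shows "push (pull c) = c + c"
proof (rule poly_mapping_eqI)
  fix f
  have "Poly_Mapping.lookup (push (pull c)) f = (\<Sum>e\<in>fiber f. int (edeg \<pi> e) * Poly_Mapping.lookup c f)"
    unfolding pull_def lookup_push[OF keys_frag_of_fun[OF Gt.finite_edges]]
    by (intro sum.cong refl) (auto simp: lookup_frag_of_fun Gt.finite_edges fiber_def)
  also have "\<dots> = int (\<Sum>e\<in>fiber f. edeg \<pi> e) * Poly_Mapping.lookup c f"
    by (simp add: sum_distrib_right)
  also have "\<dots> = Poly_Mapping.lookup (c + c) f"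
    using c sum_edeg_fiber[of f] by (cases "f \<in> edges G") (auto simp: lookup_add in_keys_iff)
  finally show "Poly_Mapping.lookup (push (pull c)) f = Poly_Mapping.lookup (c + c) f" .
qed

text \<open>The swap is the pullback of the pushforward minus the identity, so closedness follows
  without constructing an involution on vertices.\<close>

lemma swap_cycles:
  assumes "c \<in> cycles Gt"
  shows "swap c \<in> cycles Gt"
proof -
  have "swap c = pull (push c) - c"
    using pull_push[OF cycles_keys[OF assms]] by simp
  then show ?thesis using cycles_closed(3)[OF pull_cycles[OF push_cycles[OF assms]] assms] by simp
qed

end

section \<open>The Prym variety\<close>

context cover
begin

definition forms :: "('e \<Rightarrow>\<^sub>0 int) set" where
  "forms = (\<lambda>c. c - swap c) ` cycles Gt"

definition invariant :: "('e \<Rightarrow>\<^sub>0 int) set" where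
  "invariant = {c \<in> cycles Gt. swap c = c}"

definition cls :: "('e \<Rightarrow>\<^sub>0 int) \<Rightarrow> ('e \<Rightarrow>\<^sub>0 int) set" where
  "cls c = invariant #>\<^bsub>frag_group (cycles Gt)\<^esub> c"

lemma forms_cycles: "m \<in> forms \<Longrightarrow> m \<in> cycles Gt"
  by (auto simp: forms_def cycles_closed swap_cycles)

lemma forms_swap: "m \<in> forms \<Longrightarrow> swap m = - m"
  by (auto simp: forms_def swap_diff swap_swap)

lemma frag_subgroup_forms: "frag_subgroup forms"
  unfolding frag_subgroup_def
proof (intro conjI ballI)
  have "0 \<in> cycles Gt" using frag_subgroup_cycles[of Gt] by (simp add: frag_subgroup_def)
  then have "0 - swap 0 \<in> forms" unfolding forms_def by (rule imageI)
  then show "0 \<in> forms" by (simp add: chain_swap_def)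
  fix x assume "x \<in> forms"
  then obtain c where c: "c \<in> cycles Gt" "x = c - swap c" by (auto simp: forms_def)
  have "- c - swap (- c) \<in> forms" unfolding forms_def using cycles_closed(2)[OF c(1)] by (rule imageI)
  then show "- x \<in> forms" by (simp add: c(2) swap_minus)
  fix y assume "y \<in> forms"
  then obtain c' where c': "c' \<in> cycles Gt" "y = c' - swap c'" by (auto simp: forms_def)
  have "c + c' - swap (c + c') \<in> forms" unfolding forms_def using cycles_closed(1)[OF c(1) c'(1)] by (rule imageI)
  then show "x + y \<in> forms" by (simp add: c(2) c'(2) swap_add algebra_simps)
qed

lemma tform_prym: "tform (prym Gt \<pi>) = frag_group forms"
  by (simp add: prym_def harmonic_forms_def H1_eq forms_def) (simp add: frag_group_def)

lemma tlam_prym: "tlam (prym Gt \<pi>) = frag_group (cycles Gt) Mod invariant"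
  by (simp add: prym_def H1_eq invariant_def)

lemma group_hom_antisym: "group_hom (frag_group (cycles Gt)) (frag_group forms) (\<lambda>c. c - swap c)"
proof -
  interpret C: comm_group "frag_group (cycles Gt)" by (rule comm_group_frag_group[OF frag_subgroup_cycles])
  interpret F: comm_group "frag_group forms" by (rule comm_group_frag_group[OF frag_subgroup_forms])
  show ?thesis
    by unfold_locales (auto simp: hom_def forms_def swap_add)
qed

lemma kernel_antisym: "kernel (frag_group (cycles Gt)) (frag_group forms) (\<lambda>c. c - swap c) = invariant"
  by (auto simp: kernel_def invariant_def)

lemma normal_invariant: "normal invariant (frag_group (cycles Gt))"
  using group_hom.normal_kernel[OF group_hom_antisym] by (simp add: kernel_antisym)

lemma cls_elem: "x \<in> cls c \<longleftrightarrow> (\<exists>k\<in>invariant. x = k + c)"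
  by (auto simp: cls_def r_coset_def)

lemma carrier_tlam_prym: "carrier (tlam (prym Gt \<pi>)) = cls ` cycles Gt"
  by (simp add: tlam_prym carrier_FactGroup cls_def[abs_def])

lemma cls_mem: "c \<in> cycles Gt \<Longrightarrow> cls c \<in> carrier (tlam (prym Gt \<pi>))"
  by (simp add: carrier_tlam_prym)

lemma cls_add:
  assumes "c \<in> cycles Gt" "c' \<in> cycles Gt"
  shows "cls c \<otimes>\<^bsub>tlam (prym Gt \<pi>)\<^esub> cls c' = cls (c + c')"
  using normal.rcos_sum[OF normal_invariant, of c c'] assms
  by (simp add: tlam_prym cls_def)

lemma zero_invariant: "0 \<in> invariant"
  using frag_subgroup_cycles[of Gt] by (simp add: invariant_def frag_subgroup_def chain_swap_def)

lemma the_elem_cls: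
  assumes "\<And>k. k \<in> invariant \<Longrightarrow> h (k + c) = h c"
  shows "the_elem (h ` cls c) = h c"
proof -
  have "h ` cls c = {h c}"
    using assms zero_invariant by (auto simp: cls_elem image_iff)
  then show ?thesis by simp
qed

lemma prym_polarization_cls: "prym_polarization Gt \<pi> (cls c) = c - swap c"
  unfolding prym_polarization_def
  by (rule the_elem_cls) (simp add: invariant_def swap_add)

text \<open>The first isomorphism theorem for \<open>c \<mapsto> c - swap c\<close>, whose kernel is
  the lattice of invariant cycles and whose image is the lattice of forms. This is the principality
  of the polarization.\<close>

lemma prym_polarization_iso: "prym_polarization Gt \<pi> \<in> iso (tlam (prym Gt \<pi>)) (tform (prym Gt \<pi>))"
  using group_hom.FactGroup_iso_set[OF group_hom_antisym, unfolded kernel_antisym] forms_def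
  unfolding tlam_prym tform_prym prym_polarization_def[abs_def] by simp

text \<open>The swap is an isometry, so an invariant cycle pairs to 0 with an anti-invariant form
  and the integral is constant on classes.\<close>

lemma tpair_cls:
  assumes "w \<in> forms"
  shows "tpair (prym Gt \<pi>) (cls c) w = cycle_integral Gt c w"
proof -
  have "cycle_integral Gt k w = 0" if k: "k \<in> invariant" for k
  proof -
    have "cycle_integral Gt k w = cycle_integral Gt (swap k) (swap w)"
      by (simp add: cycle_integral_swap)
    also have "\<dots> = - cycle_integral Gt k w"
      using k by (simp add: forms_swap[OF assms] cycle_integral_minus invariant_def)
    finally show ?thesis by simp
  qed
  then show ?thesis
    unfolding prym_def real_torus.simps
    by (intro the_elem_cls) (simp add: cycle_integral_add)
qed

text \<open>The origin of the factor 2: swapping both arguments preserves the pairing, while the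
  form changes sign.\<close>

lemma cycle_integral_antisym:
  assumes "w \<in> forms"
  shows "cycle_integral Gt (c - swap c) w = 2 * cycle_integral Gt c w"
proof -
  have "cycle_integral Gt (swap c) w = cycle_integral Gt (swap (swap c)) (swap w)"
    by (simp add: cycle_integral_swap)
  also have "\<dots> = - cycle_integral Gt c w"
    by (simp add: swap_swap forms_swap[OF assms] cycle_integral_minus)
  finally show ?thesis by (simp add: cycle_integral_diff)
qed

lemma cls_inverse:
  assumes m: "m \<in> forms"
  obtains c where "c \<in> cycles Gt" "m = c - swap c"
    "inv_into (carrier (tlam (prym Gt \<pi>))) (prym_polarization Gt \<pi>) m = cls c"
proof -
  obtain c where c: "c \<in> cycles Gt" "m = c - swap c" using m by (auto simp: forms_def)
  have "inj_on (prym_polarization Gt \<pi>) (carrier (tlam (prym Gt \<pi>)))"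
    using prym_polarization_iso by (auto simp: iso_def bij_betw_def)
  then have "inv_into (carrier (tlam (prym Gt \<pi>))) (prym_polarization Gt \<pi>) (prym_polarization Gt \<pi> (cls c)) = cls c"
    using cls_mem[OF c(1)] by (rule inv_into_f_f)
  then show ?thesis using that[OF c] by (simp only: prym_polarization_cls c(2))
qed

text \<open>The classes of the endomorphisms \<open>Id - \<iota>\<close> and \<open>\<pi>\<^sup>*\<pi>\<^sub>* = Id + \<iota>\<close> add up to \<open>2 Id\<close>, and their traces
  are twice the ranks of their images.\<close>

lemma genus_eq:
  assumes "based_lattice (frag_group forms) n b"
  shows "genus Gt = n + genus G"
proof -
  interpret F: based_lattice "frag_group forms" n b by fact
  obtain N a where a: "based_lattice (frag_group (cycles Gt)) N a"
    using frag_group_lattice[OF Gt.finite_edges frag_subgroup_cycles UN_least[OF cycles_keys]] by blast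
  obtain g d where d: "based_lattice (frag_group (cycles G)) g d"
    using frag_group_lattice[OF G.finite_edges frag_subgroup_cycles UN_least[OF cycles_keys]] by blast
  interpret A: based_lattice "frag_group (cycles Gt)" N a by fact
  interpret D: based_lattice "frag_group (cycles G)" g d by fact
  have double: "coord (frag_group C) r u (x + x) i = 2 * coord (frag_group C) r u x i"
    if "based_lattice (frag_group C) r u" "x \<in> C" "i < r" for C :: "('x \<Rightarrow>\<^sub>0 int) set" and r u x i
    using additive_mapD[OF based_lattice.coord_additive[OF that(1,3)], of x x] that(2) by simp
  have amem: "a i \<in> cycles Gt" if "i < N" for i using A.basis_mem[OF that] by simp
  have bmem: "b i \<in> forms" if "i < n" for i using F.basis_mem[OF that] by simp
  have dmem: "d i \<in> cycles G" if "i < g" for i using D.basis_mem[OF that] by simp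
  let ?c = "coord (frag_group (cycles Gt)) N a"
  \<comment> \<open>The map \<open>c \<mapsto> c - swap c\<close> is factored through its image,
    with the inclusion as second map; in the opposite order the composite doubles forms, since the
    swap acts on them by -1.\<close>
  have "(\<Sum>i<N. ?c (a i - swap (a i)) i) = (\<Sum>j<n. coord (frag_group forms) n b (b j - swap (b j)) j)"
    using group_hom.homh[OF group_hom_antisym] forms_cycles
    by (intro lattice_trace[where g = "\<lambda>x. x", OF a assms]) (auto simp: hom_def)
  also have "\<dots> = (\<Sum>j<n. 2 * coord (frag_group forms) n b (b j) j)"
    by (intro sum.cong refl) (simp add: forms_swap bmem double[OF assms])
  also have "\<dots> = 2 * int n" by (simp add: F.coord_basis)
  finally have 1: "(\<Sum>i<N. ?c (a i - swap (a i)) i) = 2 * int n" .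
  \<comment> \<open>In the opposite order the composite is multiplication by the degree 2 on the
    cycles of \<open>G\<close>.\<close>
  have "(\<Sum>i<N. ?c (pull (push (a i))) i) = (\<Sum>j<g. coord (frag_group (cycles G)) g d (push (pull (d j))) j)"
    using push_cycles pull_cycles
    by (intro lattice_trace[OF a d]) (auto simp: hom_def push_add pull_add)
  also have "\<dots> = (\<Sum>j<g. 2 * coord (frag_group (cycles G)) g d (d j) j)"
    by (intro sum.cong refl) (simp add: push_pull dmem cycles_keys double[OF d])
  also have "\<dots> = 2 * int g" by (simp add: D.coord_basis)
  finally have 2: "(\<Sum>i<N. ?c (pull (push (a i))) i) = 2 * int g" .
  have "(\<Sum>i<N. ?c (a i - swap (a i)) i) + (\<Sum>i<N. ?c (pull (push (a i))) i) = (\<Sum>i<N. 2 * ?c (a i) i)"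
    unfolding sum.distrib[symmetric]
  proof (rule sum.cong[OF refl])
    fix i assume "i \<in> {..<N}"
    then have i: "i < N" by simp
    have "?c (a i - swap (a i)) i + ?c (pull (push (a i))) i = ?c (a i - swap (a i) + pull (push (a i))) i"
      using additive_mapD[OF A.coord_additive[OF i], of "a i - swap (a i)" "pull (push (a i))"]
      by (simp add: amem i cycles_closed swap_cycles push_cycles pull_cycles)
    also have "a i - swap (a i) + pull (push (a i)) = a i + a i"
      using pull_push[OF cycles_keys[OF amem[OF i]]] by simp
    finally show "?c (a i - swap (a i)) i + ?c (pull (push (a i))) i = 2 * ?c (a i) i"
      using double[OF a amem[OF i] i] by simp
  qed
  also have "\<dots> = 2 * int N" by (simp add: A.coord_basis)
  finally have "N = n + g" using 1 2 by simp
  moreover have "genus Gt = N" "genus G = g"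
    unfolding genus_def H1_eq using lattice_rank_eqI a d by blast+
  ultimately show ?thesis by simp
qed

end


section \<open>The Prym variety as a principally polarized torus, and its Abel--Prym cycle\<close>

locale cover_basis = cover Gt G \<pi>
  for Gt :: "('v, 'e) metric_graph" and G :: "('w, 'f) metric_graph" and \<pi> :: "('v, 'e, 'w, 'f) graph_cover" +
  fixes n :: nat and b :: "nat \<Rightarrow> 'e \<Rightarrow>\<^sub>0 int"
  assumes lat: "based_lattice (frag_group forms) n b" and basis: "frag_basis forms n b"
begin

abbreviation T :: "(('e \<Rightarrow>\<^sub>0 int) set, 'e \<Rightarrow>\<^sub>0 int) real_torus" where "T \<equiv> prym Gt \<pi>"

abbreviation pinv :: "('e \<Rightarrow>\<^sub>0 int) \<Rightarrow> ('e \<Rightarrow>\<^sub>0 int) set" where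
  "pinv \<equiv> inv_into (carrier (tlam T)) (prym_polarization Gt \<pi>)"

text \<open>Lifting \<open>m\<close> to \<open>c - swap c\<close>, its preimage under the
  polarization is the class of \<open>c\<close>, which carries half of the integral of
  \<open>m\<close>. Equivalently, the cycle \<open>m\<close> itself represents twice that
  preimage.\<close>

lemma tpair_pinv:
  assumes "m \<in> forms" "w \<in> forms"
  shows "tpair T (pinv m) w = cycle_integral Gt m w / 2"
proof -
  obtain c where c: "c \<in> cycles Gt" "m = c - swap c" "pinv m = cls c"
    using assms(1) by (rule cls_inverse)
  show ?thesis
    unfolding c(3) tpair_cls[OF assms(2)] unfolding c(2) cycle_integral_antisym[OF assms(2)] by simp
qed

text \<open>The length pairing is diagonal in the edges, so the quadratic form is a sum of squares
  weighted by lengths; positivity comes from here.\<close>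

lemma cycle_integral_lincomb:
  "(\<Sum>i<n. \<Sum>j<n. y i * y j * cycle_integral Gt (b i) (b j)) =
    (\<Sum>e\<in>edges Gt. len Gt e * (\<Sum>i<n. y i * of_int (Poly_Mapping.lookup (b i) e))\<^sup>2)"
proof -
  let ?l = "\<lambda>i e. real_of_int (Poly_Mapping.lookup (b i) e)"
  have "(\<Sum>i<n. \<Sum>j<n. y i * y j * cycle_integral Gt (b i) (b j)) =
      (\<Sum>i<n. \<Sum>j<n. \<Sum>e\<in>edges Gt. len Gt e * ((y i * ?l i e) * (y j * ?l j e)))"
    unfolding cycle_integral_def sum_distrib_left by (intro sum.cong refl) (simp add: mult_ac)
  also have "\<dots> = (\<Sum>i<n. \<Sum>e\<in>edges Gt. \<Sum>j<n. len Gt e * ((y i * ?l i e) * (y j * ?l j e)))"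
    by (intro sum.cong refl sum.swap)
  also have "\<dots> = (\<Sum>e\<in>edges Gt. \<Sum>i<n. \<Sum>j<n. len Gt e * ((y i * ?l i e) * (y j * ?l j e)))"
    by (rule sum.swap)
  also have "\<dots> = (\<Sum>e\<in>edges Gt. len Gt e * (\<Sum>i<n. y i * ?l i e)\<^sup>2)"
    unfolding power2_eq_square sum_product unfolding sum_distrib_left ..
  finally show ?thesis .
qed

sublocale P: principal_torus T n b "prym_polarization Gt \<pi>" pinv
proof -
  interpret C: comm_group "frag_group (cycles Gt)" by (rule comm_group_frag_group[OF frag_subgroup_cycles])
  have tl: "comm_group (tlam T)"
    unfolding tlam_prym by (rule C.abelian_FactGroup[OF normal_imp_subgroup[OF normal_invariant]])
  have tf: "based_lattice (tform T) n b" unfolding tform_prym by (rule lat)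
  have bmem: "b i \<in> forms" if "i < n" for i
    using basis that by (simp add: frag_basis_def)
  have "principal_torus_axioms T n b (prym_polarization Gt \<pi>)"
  proof
    show "prym_polarization Gt \<pi> \<in> iso (tlam T) (tform T)" by (rule prym_polarization_iso)
    fix m assume "m \<in> carrier (tform T)"
    then have m: "m \<in> forms" by (simp add: tform_prym)
    show "additive_map (tlam T) (\<lambda>l. tpair T l m)"
      unfolding additive_map_def carrier_tlam_prym
      by (auto simp: cls_add tpair_cls[OF m] cycle_integral_add)
  next
    fix l assume "l \<in> carrier (tlam T)"
    then obtain c where c: "c \<in> cycles Gt" "l = cls c" by (auto simp: carrier_tlam_prym)
    show "additive_map (tform T) (tpair T l)"
      unfolding additive_map_def tform_prym c(2)
    proof (intro ballI)
      fix x y assume xy: "x \<in> carrier (frag_group forms)" "y \<in> carrier (frag_group forms)"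
      then have "x + y \<in> forms" using frag_subgroup_forms by (simp add: frag_subgroup_def)
      then show "tpair T (cls c) (x \<otimes>\<^bsub>frag_group forms\<^esub> y) = tpair T (cls c) x + tpair T (cls c) y"
        using xy by (simp add: tpair_cls cycle_integral_add)
    qed
  next
    fix y :: "nat \<Rightarrow> real" assume "\<exists>i<n. y i \<noteq> 0"
    \<comment> \<open>Independence over the reals provides an edge on which the combination of forms
      does not vanish; its square alone makes the sum positive.\<close>
    then obtain e where e: "(\<Sum>i<n. y i * of_int (Poly_Mapping.lookup (b i) e)) \<noteq> 0"
      using basis unfolding frag_basis_def by blast
    have eE: "e \<in> edges Gt"
    proof (rule ccontr)
      assume "e \<notin> edges Gt"
      then have "Poly_Mapping.lookup (b i) e = 0" if "i < n" for i
        using cycles_keys[OF forms_cycles[OF bmem[OF that]]] by (auto simp: in_keys_iff)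
      then show False using e by simp
    qed
    have "0 < (\<Sum>e\<in>edges Gt. len Gt e * (\<Sum>i<n. y i * of_int (Poly_Mapping.lookup (b i) e))\<^sup>2)"
      using e Gt.len_pos eE by (intro sum_pos2[OF Gt.finite_edges eE]) (auto simp: less_imp_le)
    also have "\<dots> = 2 * (\<Sum>i<n. \<Sum>j<n. y i * y j * tpair T (pinv (b i)) (b j))"
      unfolding cycle_integral_lincomb[symmetric] sum_distrib_left
      by (intro sum.cong refl) (simp add: tpair_pinv bmem)
    finally show "0 < (\<Sum>i<n. \<Sum>j<n. y i * y j * tpair T (pinv (b i)) (b j))" by simp
  qed
  then show "principal_torus T n b (prym_polarization Gt \<pi>)"
    by (intro principal_torus.intro tl tf)
qed

lemma path_integral_NR:
  "(\<lambda>m\<in>carrier (tform T). path_integral ps m) \<in> carrier (torus_NR T)"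
  unfolding P.NR_mem
  by (intro conjI restrict_extensional additive_map_cong_restrict P.M.comm_group_axioms)
     (simp add: additive_map_def tform_prym path_integral_add)

text \<open>Changing the path or the representative of the coset alters the integrals by those of a
  cycle, which on forms is a period of the Prym torus. Hence any convenient path computes the
  Abel--Prym map, and the image of the coset is a single point, as \<open>torus_map\<close>
  presupposes.\<close>

lemma abel_prym_path:
  assumes ps: "is_path Gt q ps p"
  shows "abel_prym Gt \<pi> q p = torus_proj T (\<lambda>m\<in>carrier (tform T). path_integral ps m)"
proof -
  define ps1 where "ps1 = (SOME ps. is_path Gt q ps p)"
  have ps1: "is_path Gt q ps1 p" unfolding ps1_def using ps by (rule someI)
  obtain c1 where c1: "c1 \<in> cycles Gt"
    "\<And>w. path_integral ps1 w = cycle_integral Gt c1 w + path_integral ps w"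
    using Gt.path_difference_cycle[OF ps1 ps] by blast
  let ?R = "\<lambda>z. \<lambda>m\<in>carrier (tform T). z m"
  have const: "torus_proj T (?R z) = torus_proj T (\<lambda>m\<in>carrier (tform T). path_integral ps m)"
    if z: "z \<in> abel_jacobi Gt q p" for z
  proof -
    obtain c where c: "c \<in> cycles Gt" and
      z: "\<And>m. m \<in> cycles Gt \<Longrightarrow> z m = cycle_integral Gt c m + path_integral ps1 m"
      using z by (auto simp: abel_jacobi_def torus_proj_def r_coset_def torus_NR_def real_dual_def
          lam_embed_def jacobian_def harmonic_forms_def H1_eq ps1_def)
    have zm: "z m = cycle_integral Gt (c + c1) m + path_integral ps m" if "m \<in> forms" for m
      using that by (simp add: z forms_cycles c1(2) cycle_integral_add)
    show ?thesis
    proof (rule P.torus_proj_eqI)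
      \<comment> \<open>\<open>c\<close> comes from the representative of the coset in the Jacobian,
        \<open>c1\<close> from replacing the chosen path by \<open>ps\<close>.\<close>
      show "cls (c + c1) \<in> carrier (tlam T)" by (intro cls_mem cycles_closed c c1)
      have add: "x + y \<in> forms" if "x \<in> forms" "y \<in> forms" for x y
        using that frag_subgroup_forms by (simp add: frag_subgroup_def)
      show "?R z \<in> carrier (torus_NR T)"
        unfolding P.NR_mem
        by (intro conjI restrict_extensional additive_map_cong_restrict P.M.comm_group_axioms)
           (auto simp: additive_map_def tform_prym zm add path_integral_add cycle_integral_add)
      show "(\<lambda>m\<in>carrier (tform T). path_integral ps m) \<in> carrier (torus_NR T)" by (rule path_integral_NR)
      fix m assume "m \<in> carrier (tform T)"
      then show "?R z m = tpair T (cls (c + c1)) m + (\<lambda>m\<in>carrier (tform T). path_integral ps m) m"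
        by (simp add: tform_prym zm tpair_cls)
    qed
  qed
  have "abel_jacobi Gt q p \<noteq> {}"
    using frag_subgroup_cycles[of Gt]
    by (auto simp: abel_jacobi_def torus_proj_def r_coset_def jacobian_def H1_eq frag_subgroup_def)
  then have "(\<lambda>z. torus_proj T (?R z)) ` abel_jacobi Gt q p = {torus_proj T (\<lambda>m\<in>carrier (tform T). path_integral ps m)}"
    using const by auto
  then show ?thesis
    by (simp add: abel_prym_def prym_eps_def torus_map_def)
qed

text \<open>Fixed paths from \<open>q\<close> to the sources of the edges are prolonged along these
  edges: the fixed parts give the constant \<open>x0\<close>, and the last segments contribute
  linearly in \<open>t\<close>. The prolonging paths depend on the cell alone, so the lift is
  continuous.\<close>

lemma abel_prym_sum_lift:
  fixes e :: "nat \<Rightarrow> 'e"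
  assumes q: "q \<in> points Gt" and e: "\<And>i. i < d \<Longrightarrow> e i \<in> edges Gt"
  shows "\<exists>x0. is_lift T d
      (abel_prym_sum Gt \<pi> q d \<circ> (\<lambda>t. \<lambda>i\<in>{..<d}. edge_point Gt (e i) (t i * len Gt (e i))))
      (\<lambda>t. \<lambda>m\<in>carrier (tform T). x0 m + (\<Sum>i<d. t i * (len Gt (e i) * of_int (Poly_Mapping.lookup m (e i)))))"
proof -
  have "\<forall>i\<in>{..<d}. \<exists>ps. is_path Gt q ps (Vertex (src Gt (e i)))"
    using Gt.path_exists[OF q] Gt.src_mem e by (auto simp: points_def)
  then obtain ps where ps: "\<forall>i\<in>{..<d}. is_path Gt q (ps i) (Vertex (src Gt (e i)))"
    by (rule bchoice[THEN exE])
  define x0 where "x0 = (\<lambda>m. \<Sum>i<d. path_integral (ps i) m)"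
  let ?len = "\<lambda>i. len Gt (e i)"
  let ?s = "\<lambda>t. \<lambda>m\<in>carrier (tform T). x0 m + (\<Sum>i<d. t i * (?len i * of_int (Poly_Mapping.lookup m (e i))))"
  let ?\<sigma> = "\<lambda>t. \<lambda>i\<in>{..<d}. edge_point Gt (e i) (t i * ?len i)"
  have "is_lift T d (abel_prym_sum Gt \<pi> q d \<circ> ?\<sigma>) ?s"
    unfolding is_lift_def
  proof (intro conjI ballI)
    fix t assume t: "t \<in> std_cube d"
    define rs where "rs = (\<lambda>i. ps i @ [(e i, 0, t i * ?len i)])"
    define x where "x = (\<lambda>i. \<lambda>m\<in>carrier (tform T). path_integral (rs i) m)"
    have x: "x i \<in> carrier (torus_NR T)" for i unfolding x_def by (rule path_integral_NR)
    have ap: "abel_prym Gt \<pi> q (edge_point Gt (e i) (t i * ?len i)) = torus_proj T (x i)" if i: "i < d" for i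
    proof -
      have l: "?len i > 0" using Gt.len_pos[OF e[OF i]] .
      have "t i \<in> {0..1}" using PiE_mem[OF t[unfolded std_cube_def]] i by simp
      then have "t i * ?len i \<in> {0..?len i}" using l by (auto intro: mult_left_le_one_le)
      then have "is_path Gt (Vertex (src Gt (e i))) [(e i, 0, t i * ?len i)] (edge_point Gt (e i) (t i * ?len i))"
        using is_path_segment[OF e[OF i], of 0 "t i * ?len i"] l by (simp add: Gt.edge_point_ends)
      then have "is_path Gt q (rs i) (edge_point Gt (e i) (t i * ?len i))"
        unfolding rs_def using ps i by (intro is_path_append) auto
      then show ?thesis unfolding x_def by (rule abel_prym_path)
    qed
    have sum_x: "(\<lambda>m\<in>carrier (tform T). \<Sum>i<d. x i m) = ?s t"
      by (rule restrict_ext)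
         (simp add: x_def rs_def path_integral_append x0_def sum.distrib path_integral_def[of "[_]"] mult_ac)
    show "?s t \<in> carrier (torus_NR T)"
      using P.finprod_torus_proj(1)[of d x, OF x] unfolding sum_x .
    have "(abel_prym_sum Gt \<pi> q d \<circ> ?\<sigma>) t = finprod (torus_group T) (\<lambda>i. torus_proj T (x i)) {..<d}"
      unfolding abel_prym_sum_def o_def
    proof (rule P.TG.finprod_cong')
      show "(\<lambda>i. torus_proj T (x i)) \<in> {..<d} \<rightarrow> carrier (torus_group T)"
        using P.torus_proj_hom x by (auto simp: hom_def)
      show "abel_prym Gt \<pi> q (?\<sigma> t i) = torus_proj T (x i)" if "i \<in> {..<d}" for i
        using that by (simp add: ap)
    qed simp
    then show "torus_proj T (?s t) = (abel_prym_sum Gt \<pi> q d \<circ> ?\<sigma>) t"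
      using P.finprod_torus_proj(2)[of d x, OF x] unfolding sum_x by simp
  next
    fix m assume m: "m \<in> carrier (tform T)"
    have "continuous_on (std_cube d) (\<lambda>t. t i)" for i
      by (rule continuous_on_subset[OF continuous_on_product_coordinates]) simp
    then have "continuous_on (std_cube d) (\<lambda>t. x0 m + (\<Sum>i<d. t i * (?len i * of_int (Poly_Mapping.lookup m (e i)))))"
      by (intro continuous_intros)
    then show "continuous_on (std_cube d) (\<lambda>t. ?s t m)" using m by simp
  qed
  then show ?thesis by (rule exI[of _ x0])
qed

text \<open>A cell contributes a determinant of periods, which carries the edge lengths, times a
  determinant of tangent vectors, which does not. Summed by Cauchy--Binet, the lengths assemble into
  the length pairing of the cycles \<open>m j\<close>.\<close>

lemma abel_prym_cycle_eq:
  assumes q: "q \<in> points Gt"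
  shows "abel_prym_cycle Gt \<pi> q d = hom_restrict T d d
    (\<lambda>f m. of_int (fact d * 2 ^ d) * ndet d (\<lambda>i j. of_int (f i (pinv (m j)))))"
proof -
  have key: "(\<Sum>(\<sigma>, w) \<in># push_chain T d d (abel_prym_sum Gt \<pi> q d) (fundamental_chain Gt d).
        cube_integral T d \<sigma> f * w m) =
      of_int (fact d * 2 ^ d) * ndet d (\<lambda>i j. of_int (f i (pinv (m j))))"
    if fm: "(f, m) \<in> hom_dom T d d" for f m
  proof -
    have f: "f i \<in> carrier (int_dual (tlam T))" and mT: "m i \<in> carrier (tform T)" if "i < d" for i
      using fm that by (auto simp: hom_dom_def)
    have m: "m i \<in> forms" if "i < d" for i using mT[OF that] by (simp add: tform_prym)
    have "\<forall>i\<in>{..<d}. \<exists>w. (\<forall>x. additive_map (tform T) x \<longrightarrow> real_ext T (f i) x = (\<Sum>j<n. x (b j) * w j)) \<and>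
        (\<forall>l\<in>carrier (tlam T). of_int (f i l) = (\<Sum>j<n. tpair T l (b j) * w j))"
      using P.real_ext_linear f by blast
    then obtain w where w': "\<forall>i\<in>{..<d}. (\<forall>x. additive_map (tform T) x \<longrightarrow> real_ext T (f i) x = (\<Sum>j<n. x (b j) * w i j)) \<and>
        (\<forall>l\<in>carrier (tlam T). of_int (f i l) = (\<Sum>j<n. tpair T l (b j) * w i j))"
      by (rule bchoice[THEN exE])
    have w1: "real_ext T (f i) x = (\<Sum>j<n. x (b j) * w i j)" if "i < d" "additive_map (tform T) x" for i x
      using w' that by simp
    have w2: "of_int (f i l) = (\<Sum>j<n. tpair T l (b j) * w i j)" if "i < d" "l \<in> carrier (tlam T)" for i l
      using w' that by simp
    \<comment> \<open>\<open>F i e\<close> is the extension of \<open>f i\<close> evaluated on the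
      displacement along the whole edge \<open>e\<close>; \<open>C\<close> is the slope of a form
      along \<open>e\<close>.\<close>
    define F where "F = (\<lambda>i e. \<Sum>k<n. len Gt e * of_int (Poly_Mapping.lookup (b k) e) * w i k)"
    define C where "C = (\<lambda>i e. real_of_int (Poly_Mapping.lookup (m i) e))"
    let ?\<sigma> = "\<lambda>e t. \<lambda>i\<in>{..<d}. edge_point Gt (e i) (t i * len Gt (e i))"
    let ?v = "\<lambda>e j k. if k = j then 1 / len Gt (e j) else (0::real)"
    let ?A = "abel_prym_sum Gt \<pi> q d"
    have cell: "cube_integral T d (?A \<circ> ?\<sigma> e) f * ndet d (\<lambda>i j. push_tangent T d (?A \<circ> ?\<sigma> e) (?v e j) (m i)) =
        ndet d (\<lambda>i j. F i (e j)) * ndet d (\<lambda>i j. C i (e j))"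
      if eE: "e \<in> {..<d} \<rightarrow>\<^sub>E edges Gt" for e
    proof -
      have e: "e i \<in> edges Gt" if "i < d" for i using eE that by auto
      define a where "a = (\<lambda>i m. len Gt (e i) * real_of_int (Poly_Mapping.lookup m (e i)))"
      have a_add: "additive_map (tform T) (a i)" for i
        by (simp add: additive_map_def tform_prym a_def lookup_add distrib_left)
      obtain x0 where lift: "is_lift T d (?A \<circ> ?\<sigma> e) (\<lambda>t. \<lambda>m\<in>carrier (tform T). x0 m + (\<Sum>i<d. t i * a i m))"
        using abel_prym_sum_lift[of q d e, OF q e] unfolding a_def ..
      have "cube_integral T d (?A \<circ> ?\<sigma> e) f = ndet d (\<lambda>i j. real_ext T (f i) (a j))"
        by (rule P.cube_integral_affine[OF lift a_add f])
      also have "\<dots> = ndet d (\<lambda>i j. F i (e j))"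
        by (rule ndet_cong) (simp only: w1 a_add, simp add: F_def a_def)
      finally have 1: "cube_integral T d (?A \<circ> ?\<sigma> e) f = ndet d (\<lambda>i j. F i (e j))" .
      have "push_tangent T d (?A \<circ> ?\<sigma> e) (?v e j) (m i) = C i (e j)" if ij: "i < d" "j < d" for i j
      proof -
        have "push_tangent T d (?A \<circ> ?\<sigma> e) (?v e j) (m i) = (\<Sum>k<d. ?v e j k * a k (m i))"
          by (rule P.push_tangent_affine[OF lift mT[OF ij(1)]])
        \<comment> \<open>The primitive vector is \<open>1 / len\<close> times the coordinate
          vector, which cancels the length in \<open>a\<close>.\<close>
        also have "\<dots> = (\<Sum>k<d. if k = j then a j (m i) / len Gt (e j) else 0)"
          by (intro sum.cong refl) simp
        also have "\<dots> = C i (e j)"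
          using ij(2) Gt.len_pos[OF e[OF ij(2)]] by (simp add: a_def C_def)
        finally show ?thesis .
      qed
      then have 2: "ndet d (\<lambda>i j. push_tangent T d (?A \<circ> ?\<sigma> e) (?v e j) (m i)) = ndet d (\<lambda>i j. C i (e j))"
        by (rule ndet_cong)
      show ?thesis unfolding 1 2 ..
    qed
    \<comment> \<open>The sum over the edges is the length pairing of \<open>m j\<close> with the
      basis, contracted with \<open>w i\<close>. This is \<open>f i\<close> applied to the class of
      the cycle \<open>m j\<close>, that is, to twice \<open>pinv (m j)\<close>.\<close>
    have FC: "(\<Sum>e\<in>edges Gt. F i e * C j e) = 2 * of_int (f i (pinv (m j)))" if ij: "i < d" "j < d" for i j
    proof -
      have mc: "m j \<in> cycles Gt" by (rule forms_cycles[OF m[OF ij(2)]])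
      have "(\<Sum>e\<in>edges Gt. F i e * C j e) = (\<Sum>k<n. \<Sum>e\<in>edges Gt.
          of_int (Poly_Mapping.lookup (m j) e) * of_int (Poly_Mapping.lookup (b k) e) * len Gt e * w i k)"
        unfolding F_def C_def sum_distrib_right by (subst sum.swap) (simp add: mult_ac)
      also have "\<dots> = (\<Sum>k<n. cycle_integral Gt (m j) (b k) * w i k)"
        by (simp add: cycle_integral_def sum_distrib_right)
      also have "\<dots> = (\<Sum>k<n. 2 * (tpair T (pinv (m j)) (b k) * w i k))"
        using basis by (intro sum.cong refl) (simp add: tpair_pinv m[OF ij(2)] frag_basis_def)
      also have "\<dots> = 2 * (\<Sum>k<n. tpair T (pinv (m j)) (b k) * w i k)"
        by (simp add: sum_distrib_left)
      also have "\<dots> = 2 * of_int (f i (pinv (m j)))"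
        using w2[OF ij(1) P.rhoi_mem[OF mT[OF ij(2)]]] by simp
      finally show ?thesis .
    qed
    have "(\<Sum>(\<sigma>, w) \<in># push_chain T d d ?A (fundamental_chain Gt d). cube_integral T d \<sigma> f * w m) =
        (\<Sum>e\<in>{..<d} \<rightarrow>\<^sub>E edges Gt. cube_integral T d (?A \<circ> ?\<sigma> e) f *
          ndet d (\<lambda>i j. push_tangent T d (?A \<circ> ?\<sigma> e) (?v e j) (m i)))"
      by (simp add: push_chain_def fundamental_chain_def sum_unfold_sum_mset image_mset.compositionality o_def)
    also have "\<dots> = (\<Sum>e\<in>{..<d} \<rightarrow>\<^sub>E edges Gt. ndet d (\<lambda>i j. F i (e j)) * ndet d (\<lambda>i j. C i (e j)))"
      by (rule sum.cong[OF refl cell])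
    also have "\<dots> = fact d * ndet d (\<lambda>i j. \<Sum>e\<in>edges Gt. F i e * C j e)"
      by (rule sum_PiE_ndet_ndet[OF Gt.finite_edges])
    also have "\<dots> = fact d * ndet d (\<lambda>i j. 2 * of_int (f i (pinv (m j))))"
      by (intro arg_cong2[where f = "(*)"] refl ndet_cong FC)
    also have "\<dots> = of_int (fact d * 2 ^ d) * ndet d (\<lambda>i j. of_int (f i (pinv (m j))))"
      by (simp add: ndet_def prod.distrib sum_distrib_left mult_ac)
    finally show ?thesis .
  qed
  show ?thesis
    unfolding abel_prym_cycle_def chain_class_def
    by (auto simp: hom_restrict_def fun_eq_iff key)
qed

end

theorem theoremE:
  fixes Gt :: "('v, 'e) metric_graph" and G :: "('w, 'f) metric_graph"
    and \<pi> :: "('v, 'e, 'w, 'f) graph_cover" and q :: "('v, 'e) gpoint" and g0 :: nat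
  assumes "double_cover Gt G \<pi>" and "q \<in> points Gt"
    and "g0 = torus_dim (prym Gt \<pi>)"
  shows "int g0 = int (genus Gt) - int (genus G) \<and>
    (\<forall>d. 1 \<le> d \<and> d \<le> g0 \<longrightarrow>
       abel_prym_cycle Gt \<pi> q d \<in> trop_homology (prym Gt \<pi>) d d \<and>
       (\<lambda>f m. abel_prym_cycle Gt \<pi> q d f m / fact d) =
       (\<lambda>f m. 2 ^ d / fact (g0 - d) *
          polarization_power (prym Gt \<pi>) (prym_polarization Gt \<pi>) (g0 - d) f m))"
proof -
  interpret cover Gt G \<pi> by unfold_locales (rule assms(1))
  obtain n b where nb: "based_lattice (frag_group forms) n b" "frag_basis forms n b"
    using frag_group_lattice[OF Gt.finite_edges frag_subgroup_forms UN_least[OF cycles_keys[OF forms_cycles]]] by blast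
  interpret cover_basis Gt G \<pi> n b by (intro cover_basis.intro cover_basis_axioms.intro cover_axioms nb)
  have g0: "g0 = n" using assms(3) P.torus_dim_eq by simp
  show ?thesis
  proof (intro conjI allI impI)
    show "int g0 = int (genus Gt) - int (genus G)"
      using genus_eq[OF nb(1)] g0 by simp
    fix d assume d: "1 \<le> d \<and> d \<le> g0"
    show "abel_prym_cycle Gt \<pi> q d \<in> trop_homology (prym Gt \<pi>) d d"
      unfolding abel_prym_cycle_eq[OF assms(2)] by (rule P.ndet_class_trop_homology)
    \<comment> \<open>On the left \<open>fact d\<close> cancels the factorial of Cauchy--Binet, on
      the right \<open>fact (g0 - d)\<close> that of the polarization power; both sides become
      \<open>2 ^ d\<close> times the same determinant.\<close>
    show "(\<lambda>f m. abel_prym_cycle Gt \<pi> q d f m / fact d) =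
       (\<lambda>f m. 2 ^ d / fact (g0 - d) *
          polarization_power (prym Gt \<pi>) (prym_polarization Gt \<pi>) (g0 - d) f m)"
      unfolding abel_prym_cycle_eq[OF assms(2)] using d
      by (auto simp: g0 P.polarization_power_eq hom_restrict_def fun_eq_iff)
  qed
qed

end
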